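(* For $(P_6,\text{HHD})$-free graphs, the Weighted Efficient Dominating Set (WED) problem is solvable in polynomial time.
   Context: All graphs are finite, undirected and simple. A vertex dominates itself and its neighbors. A set $D\subseteq V$ is an efficient dominating set (e.d.) of $G=(V,E)$ if every vertex of $G$ is dominated by exactly one vertex of $D$. The WED problem: given a graph $G=(V,E)$ and a vertex weight function $\omega:V\to\mathbb{N}$, find an e.d. $D$ of $G$ of minimum total weight $\sum_{v\in D}\omega(v)$ if $G$ has an e.d., or determine that $G$ has no e.d. "$F$-free" means containing no induced subgraph isomorphic to $F$. $P_k$ (resp. $C_k$) is the chordless path (resp. cycle) on $k$ vertices. A hole is a $C_k$ with $k\ge 5$; the house is the complement of $P_5$; the domino is obtained from a $P_5$ $x_1,\ldots,x_5$ by adding a vertex adjacent exactly to $x_1,x_3,x_5$. A graph is HHD-free if it has no induced house, hole or domino; $(P_6,\text{HHD})$-free means HHD-free and $P_6$-free. *)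

theory Defs
  imports "HOL-Library.Log_Nat" "HOL-Computational_Algebra.Polynomial"
begin

section \<open>Finite simple graphs and forbidden induced subgraphs\<close>

type_synonym 'a graph = "'a set \<times> 'a set set"

abbreviation verts :: "'a graph \<Rightarrow> 'a set" where "verts \<equiv> fst"
abbreviation edges :: "'a graph \<Rightarrow> 'a set set" where "edges \<equiv> snd"

definition simple_graph :: "'a graph \<Rightarrow> bool" where
  "simple_graph G \<longleftrightarrow> finite (verts G) \<and> (\<forall>e \<in> edges G. e \<subseteq> verts G \<and> card e = 2)"

definition induced_subgraph :: "'a graph \<Rightarrow> 'a set \<Rightarrow> 'a graph" where
  "induced_subgraph G S = (S, {e \<in> edges G. e \<subseteq> S})"

definition isomorphic :: "'a graph \<Rightarrow> 'b graph \<Rightarrow> bool" where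
  "isomorphic G H \<longleftrightarrow>
    (\<exists>f. bij_betw f (verts G) (verts H) \<and>
         (\<forall>u \<in> verts G. \<forall>v \<in> verts G. {u, v} \<in> edges G \<longleftrightarrow> {f u, f v} \<in> edges H))"

definition free_of :: "'b graph \<Rightarrow> 'a graph \<Rightarrow> bool" where
  "free_of F G \<longleftrightarrow> \<not> (\<exists>S \<subseteq> verts G. isomorphic (induced_subgraph G S) F)"

definition complement :: "'a graph \<Rightarrow> 'a graph" where
  "complement G =
    (verts G, {{u, v} | u v. u \<in> verts G \<and> v \<in> verts G \<and> u \<noteq> v \<and> {u, v} \<notin> edges G})"

definition path_graph :: "nat \<Rightarrow> nat graph" where
  "path_graph k = ({..<k}, {{i, Suc i} | i. Suc i < k})"

definition cycle_graph :: "nat \<Rightarrow> nat graph" where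
  "cycle_graph k = ({..<k}, {{i, Suc i mod k} | i. i < k})"

definition house :: "nat graph" where
  "house = complement (path_graph 5)"

definition domino :: "nat graph" where
  "domino = (insert 5 (verts (path_graph 5)), edges (path_graph 5) \<union> {{5, 0}, {5, 2}, {5, 4}})"

definition HHD_free :: "'a graph \<Rightarrow> bool" where
  "HHD_free G \<longleftrightarrow> free_of house G \<and> (\<forall>k \<ge> 5. free_of (cycle_graph k) G) \<and> free_of domino G"


section \<open>Weighted efficient domination\<close>

definition dominates :: "'a graph \<Rightarrow> 'a \<Rightarrow> 'a \<Rightarrow> bool" where
  "dominates G u v \<longleftrightarrow> u = v \<or> {u, v} \<in> edges G"

definition efficient_dominating_set :: "'a graph \<Rightarrow> 'a set \<Rightarrow> bool" where
  "efficient_dominating_set G D \<longleftrightarrow>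
    D \<subseteq> verts G \<and> (\<forall>v \<in> verts G. \<exists>!d. d \<in> D \<and> dominates G d v)"

definition min_weight_eds :: "'a graph \<Rightarrow> ('a \<Rightarrow> nat) \<Rightarrow> 'a set \<Rightarrow> bool" where
  "min_weight_eds G w D \<longleftrightarrow>
    efficient_dominating_set G D \<and>
    (\<forall>D'. efficient_dominating_set G D' \<longrightarrow> sum w D \<le> sum w D')"


section \<open>Random access machines with logarithmic cost\<close>

text \<open>
  The machine is a RAM with while-programs instead of jumps. Its memory consists of named
  arrays of natural numbers; a program can access only finitely many of them, and a scalar
  variable is an array used at index 0 only. Arithmetic is limited to addition and
  truncated subtraction. Every evaluated subexpression, array indices included, is charged
  the bit length of its value (\<open>floorlog 2 n\<close> is the number of binary digits of \<open>n\<close>, and 0 for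
  \<open>n = 0\<close>), which makes running times polynomially related to those of Turing machines.
\<close>

type_synonym memory = "string \<Rightarrow> nat \<Rightarrow> nat"

datatype aexp = Const nat | Read string aexp | Plus aexp aexp | Minus aexp aexp

primrec aval :: "aexp \<Rightarrow> memory \<Rightarrow> nat" where
  "aval (Const n) m = n"
| "aval (Read x e) m = m x (aval e m)"
| "aval (Plus a b) m = aval a m + aval b m"
| "aval (Minus a b) m = aval a m - aval b m"

primrec acost :: "aexp \<Rightarrow> memory \<Rightarrow> nat" where
  "acost (Const n) m = 1 + floorlog 2 n"
| "acost (Read x e) m = 1 + floorlog 2 (aval (Read x e) m) + acost e m"
| "acost (Plus a b) m = 1 + floorlog 2 (aval (Plus a b) m) + acost a m + acost b m"
| "acost (Minus a b) m = 1 + floorlog 2 (aval (Minus a b) m) + acost a m + acost b m"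

text \<open>
  \<open>Write x i e\<close> stores the value of \<open>e\<close> in cell \<open>i\<close> of the array \<open>x\<close>; conditions hold if their
  value is nonzero.
\<close>

datatype com =
    Skip
  | Write string aexp aexp
  | Seq com com
  | Cond aexp com com
  | While aexp com

text \<open>\<open>exec c m t m'\<close>: started in \<open>m\<close>, the program \<open>c\<close> halts in \<open>m'\<close> with total cost \<open>t\<close>.\<close>

inductive exec :: "com \<Rightarrow> memory \<Rightarrow> nat \<Rightarrow> memory \<Rightarrow> bool" where
  Skip: "exec Skip m 1 m"
| Write: "exec (Write x i e) m (1 + acost i m + acost e m)
            (m(x := (m x)(aval i m := aval e m)))"
| Seq: "exec c m s m' \<Longrightarrow> exec d m' t m'' \<Longrightarrow> exec (Seq c d) m (s + t) m''"
| CondTrue: "aval b m \<noteq> 0 \<Longrightarrow> exec c m t m' \<Longrightarrow> exec (Cond b c d) m (1 + acost b m + t) m'"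
| CondFalse: "aval b m = 0 \<Longrightarrow> exec d m t m' \<Longrightarrow> exec (Cond b c d) m (1 + acost b m + t) m'"
| WhileFalse: "aval b m = 0 \<Longrightarrow> exec (While b c) m (1 + acost b m) m"
| WhileTrue: "aval b m \<noteq> 0 \<Longrightarrow> exec c m s m' \<Longrightarrow> exec (While b c) m' t m'' \<Longrightarrow>
    exec (While b c) m (1 + acost b m + s + t) m''"

text \<open>
  Input and output are lists of numbers, held in the arrays \<open>in\<close> and \<open>out\<close> from index 1 on,
  with their length at index 0.
\<close>

definition input_memory :: "nat list \<Rightarrow> memory" where
  "input_memory xs =
    (\<lambda>x i. if x = ''in'' \<and> i \<le> length xs then (length xs # xs) ! i else 0)"

definition output_list :: "memory \<Rightarrow> nat list" where
  "output_list m = map (m ''out'') [1..<Suc (m ''out'' 0)]"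

definition input_size :: "nat list \<Rightarrow> nat" where
  "input_size xs = (\<Sum>x\<leftarrow>xs. Suc (floorlog 2 x))"

text \<open>
  A search problem is given by its set \<open>I\<close> of instances, their encoding, and the relation
  \<open>ans\<close> between an instance and the encodings of its correct answers. Nothing is required of
  the program on inputs that do not encode an element of \<open>I\<close>.
\<close>

definition poly_time_solvable ::
  "'i set \<Rightarrow> ('i \<Rightarrow> nat list) \<Rightarrow> ('i \<Rightarrow> nat list \<Rightarrow> bool) \<Rightarrow> bool" where
  "poly_time_solvable I enc ans \<longleftrightarrow>
    (\<exists>(c :: com) (p :: nat poly). \<forall>x \<in> I. \<exists>t m.
       exec c (input_memory (enc x)) t m \<and>
       t \<le> poly p (input_size (enc x)) \<and>
       ans x (output_list m))"


section \<open>The algorithmic problem\<close>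

text \<open>
  As input of an algorithm, a graph has its vertices numbered \<open>0, \<dots>, n - 1\<close>. The input consists
  of \<open>n\<close>, the adjacency matrix row by row, and the weights.
\<close>

type_synonym wed_instance = "nat graph \<times> (nat \<Rightarrow> nat)"

definition wed_instances :: "(nat graph \<Rightarrow> bool) \<Rightarrow> wed_instance set" where
  "wed_instances \<C> = {(G, w). simple_graph G \<and> (\<exists>n. verts G = {..<n}) \<and> \<C> G}"

definition wed_encoding :: "wed_instance \<Rightarrow> nat list" where
  "wed_encoding = (\<lambda>(G, w). let n = card (verts G) in
     n # [of_bool ({i, j} \<in> edges G). i \<leftarrow> [0..<n], j \<leftarrow> [0..<n]] @ map w [0..<n])"

text \<open>
  The answer is 1 followed by the increasing list of the vertices of an optimal solution, or
  just 0 if there is no solution.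
\<close>

definition wed_answer :: "wed_instance \<Rightarrow> nat list \<Rightarrow> bool" where
  "wed_answer = (\<lambda>(G, w) ys.
     if \<exists>D. efficient_dominating_set G D
     then \<exists>D. min_weight_eds G w D \<and> ys = 1 # sorted_list_of_set D
     else ys = [0])"

definition WED_poly_time_on :: "(nat graph \<Rightarrow> bool) \<Rightarrow> bool" where
  "WED_poly_time_on \<C> \<longleftrightarrow> poly_time_solvable (wed_instances \<C>) wed_encoding wed_answer"

end

theory Submission
  imports Defs
begin

text \<open>
  Let \<open>G\<close> be a \<open>(P\<^sub>6, HHD)\<close>-free graph. An efficient dominating set is an independent set of the
  square of \<open>G\<close> whose closed neighbourhoods cover \<open>G\<close>, so it is found among the heaviest
  independent sets of the square for the weights \<open>M |N[v]| - w v\<close> with large \<open>M\<close>. If \<open>G\<close> has an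
  efficient dominating set, then its square is chordal: on an induced cycle \<open>c\<close> of the square,
  house, domino and holes force consecutive vertices to be at distance exactly two and their
  middle vertices \<open>u i\<close> to form a cycle as well, and then the vertices dominating the \<open>c i\<close>,
  together with suitable \<open>c i\<close> and \<open>u i\<close>, give an induced \<open>P\<^sub>6\<close>. Frank's algorithm (eliminate
  simplicial vertices, subtracting their residual weight from their neighbours, then select
  greedily backwards) therefore solves the problem. On other inputs the candidate it returns is
  not an efficient dominating set, which is easy to check.
\<close>

section \<open>Holes and forbidden subgraphs\<close>

text \<open>Dominators serve as end vertices: vertices more than two apart have different
  dominators, dominators are pairwise nonadjacent, and none is adjacent to a vertex dominated by
  another. A path on four vertices thus nearly extends to an induced \<open>P6\<close>; the
  difficulty is that the dominators of its ends may also dominate its inner vertices, and the case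
  distinctions below ask which cycle vertex shares its dominator with a middle vertex. The second
  obstacle is the machine, which has no multiplication and charges for bit lengths, while the
  program has to halt in polynomial time even if the square is not chordal and no simplicial vertex
  is found. It is therefore written in a language of bounded loops, whose programs are polynomial by
  construction, and bit lengths are treated once for all programs. The predicate \<open>hole\<close>
  carries no lower bound on the length: 4 is the bound for chordality, 5 that for the holes of
  HHD.\<close>

definition hole :: "('a \<Rightarrow> 'a \<Rightarrow> bool) \<Rightarrow> (int \<Rightarrow> 'a) \<Rightarrow> int \<Rightarrow> bool" where
  "hole E c k \<longleftrightarrow> (\<forall>i j. c i = c j \<longleftrightarrow> k dvd i - j) \<and>
     (\<forall>i j. E (c i) (c j) \<longleftrightarrow> k dvd i - j - 1 \<or> k dvd i - j + 1)"

lemma hole_eq: "hole E c k \<Longrightarrow> c i = c j \<longleftrightarrow> k dvd i - j"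
  by (simp add: hole_def)

lemma hole_adj: "hole E c k \<Longrightarrow> E (c i) (c j) \<longleftrightarrow> k dvd i - j - 1 \<or> k dvd i - j + 1"
  by (simp add: hole_def)

text \<open>Cycles are indexed by all integers modulo \<open>k\<close>, so that rotation and
  reflection are substitutions: a fact about \<open>c 0\<close> and its neighbours
  \<open>c 1\<close> and \<open>c (- 1)\<close> transfers to every place without a separate
  treatment of the wrap-around.\<close>

lemma hole_rotate: "hole E c k \<Longrightarrow> hole E (\<lambda>i. c (i + s)) k"
  by (simp add: hole_def)

lemma hole_reflect:
  assumes "hole E c k"
  shows "hole E (\<lambda>i. c (- i)) k"
proof -
  have "- i - - j = - (i - j)" for i j :: int by simp
  then have 1: "k dvd - i - - j \<longleftrightarrow> k dvd i - j" for i j by (simp only: dvd_minus_iff)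
  have "- i - - j - 1 = - (i - j + 1)" for i j :: int by simp
  then have 2: "k dvd - i - - j - 1 \<longleftrightarrow> k dvd i - j + 1" for i j by (simp only: dvd_minus_iff)
  have "- i - - j + 1 = - (i - j - 1)" for i j :: int by simp
  then have 3: "k dvd - i - - j + 1 \<longleftrightarrow> k dvd i - j - 1" for i j by (simp only: dvd_minus_iff)
  show ?thesis
    unfolding hole_def hole_eq[OF assms] hole_adj[OF assms] 1 2 3 by blast
qed

lemma small_not_dvd:
  fixes k a :: int
  assumes "a \<noteq> 0" "\<bar>a\<bar> < k"
  shows "\<not> k dvd a"
  using assms dvd_imp_le_int[of a k] by auto

lemma hole_of_nat:
  fixes f :: "nat \<Rightarrow> 'a"
  assumes sym: "\<And>a b. E a b \<Longrightarrow> E b a" and irr: "\<And>a. \<not> E a a" and k: "k \<ge> 3"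
    and inj: "\<And>i j. i < j \<Longrightarrow> j < k \<Longrightarrow> f i \<noteq> f j"
    and adj: "\<And>i j. i < j \<Longrightarrow> j < k \<Longrightarrow> E (f i) (f j) \<longleftrightarrow> j = Suc i \<or> (i = 0 \<and> Suc j = k)"
  shows "hole E (\<lambda>i. f (nat (i mod int k))) (int k)"
proof -
  have adj': "E (f a) (f b) \<longleftrightarrow> b = Suc a \<or> a = Suc b \<or> (a = 0 \<and> Suc b = k) \<or> (b = 0 \<and> Suc a = k)"
    if "a < k" "b < k" for a b
  proof (cases a b rule: linorder_cases)
    case less
    then show ?thesis using adj[of a b] that by auto
  next
    case equal
    then show ?thesis using irr k by auto
  next
    case greater
    moreover have "E (f a) (f b) \<longleftrightarrow> E (f b) (f a)" using sym by blast
    ultimately show ?thesis using adj[of b a] that by auto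
  qed
  have inj': "f a = f b \<longleftrightarrow> a = b" if "a < k" "b < k" for a b
    using inj[of a b] inj[of b a] that by (metis linorder_neqE_nat)
  have *: "(f (nat (i mod int k)) = f (nat (j mod int k)) \<longleftrightarrow> int k dvd i - j) \<and>
    (E (f (nat (i mod int k))) (f (nat (j mod int k))) \<longleftrightarrow> int k dvd i - j - 1 \<or> int k dvd i - j + 1)" for i j
  proof -
    define a b where "a = nat (i mod int k)" and "b = nat (j mod int k)"
    have a: "int a = i mod int k" and b: "int b = j mod int k" using k by (simp_all add: a_def b_def)
    have ak: "a < k" "b < k"
    proof -
      have "int a < int k" "int b < int k" unfolding a b using k by auto
      then show "a < k" "b < k" by auto
    qed
    have d: "int k dvd i - j + c \<longleftrightarrow> int k dvd int a - int b + c" for c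
    proof -
      have "i - j + c = (int a - int b + c) + int k * (i div int k - j div int k)"
        using mult_div_mod_eq[of "int k" i] mult_div_mod_eq[of "int k" j]
        unfolding a b by (simp add: algebra_simps)
      then show ?thesis by (simp only: dvd_add_left_iff[OF dvd_triv_left])
    qed
    \<comment> \<open>Both representatives are below \<open>k\<close>, so the differences in
      question stay below \<open>2 * k\<close> in absolute value.\<close>
    have r: "int k dvd z \<longleftrightarrow> z = 0 \<or> z = int k \<or> z = - int k" if "\<bar>z\<bar> < 2 * int k" for z
    proof
      assume "int k dvd z"
      then obtain q where q: "z = int k * q" by auto
      then have "\<bar>q\<bar> < 2" using that k by (auto simp: abs_mult)
      then have "q = 0 \<or> q = 1 \<or> q = -1" by linarith
      then show "z = 0 \<or> z = int k \<or> z = - int k" using q by auto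
    qed auto
    have "int k dvd i - j \<longleftrightarrow> a = b" using d[of 0] r[of "int a - int b"] ak k by auto
    moreover have "int k dvd i - j - 1 \<longleftrightarrow> a = Suc b \<or> (a = 0 \<and> Suc b = k)"
      using d[of "-1"] r[of "int a - int b - 1"] ak k by auto
    moreover have "int k dvd i - j + 1 \<longleftrightarrow> b = Suc a \<or> (b = 0 \<and> Suc a = k)"
      using d[of 1] r[of "int a - int b + 1"] ak k by auto
    ultimately show ?thesis
      unfolding a_def[symmetric] b_def[symmetric] inj'[OF ak] adj'[OF ak] by blast
  qed
  then show ?thesis unfolding hole_def by blast
qed

section \<open>Shortest paths and induced cycles through a given vertex\<close>

definition shortest_between ::
    "('a \<Rightarrow> 'a \<Rightarrow> bool) \<Rightarrow> 'a set \<Rightarrow> 'a set \<Rightarrow> 'a set \<Rightarrow> (nat \<Rightarrow> 'a) \<Rightarrow> nat \<Rightarrow> bool" where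
  "shortest_between E W A B p r \<longleftrightarrow>
     p 0 \<in> A \<and> p r \<in> B \<and> (\<forall>i\<le>r. p i \<in> W) \<and> (\<forall>i<r. E (p i) (p (Suc i))) \<and>
     (\<forall>j\<le>r. \<forall>i<j. E (p i) (p j) \<longrightarrow> j = Suc i) \<and> (\<forall>j\<le>r. \<forall>i<j. p i \<noteq> p j) \<and>
     (\<forall>i\<le>r. p i \<in> A \<longrightarrow> i = 0) \<and> (\<forall>i\<le>r. p i \<in> B \<longrightarrow> i = r)"

lemma shortest_betweenD:
  assumes "shortest_between E W A B p r"
  shows "p 0 \<in> A" "p r \<in> B" "\<And>i. i \<le> r \<Longrightarrow> p i \<in> W"
    "\<And>i. i < r \<Longrightarrow> E (p i) (p (Suc i))"
    "\<And>i j. i < j \<Longrightarrow> j \<le> r \<Longrightarrow> E (p i) (p j) \<Longrightarrow> j = Suc i"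
    "\<And>i j. i < j \<Longrightarrow> j \<le> r \<Longrightarrow> p i \<noteq> p j"
    "\<And>i. i \<le> r \<Longrightarrow> p i \<in> A \<Longrightarrow> i = 0"
    "\<And>i. i \<le> r \<Longrightarrow> p i \<in> B \<Longrightarrow> i = r"
  using assms unfolding shortest_between_def by blast+

text \<open>A walk of least length will do: a chord or a repeated vertex could be cut short, and so
  could a later visit to \<open>A\<close> or an earlier one to \<open>B\<close>.\<close>

lemma shortest_path:
  assumes reach: "(\<lambda>x y. x \<in> W \<and> y \<in> W \<and> E x y)\<^sup>*\<^sup>* a b"
    and aW: "a \<in> W" and a: "a \<in> A" and b: "b \<in> B"
  obtains p :: "nat \<Rightarrow> 'a" and r where "shortest_between E W A B p r"
proof -
  define walk where "walk r p \<longleftrightarrow> p 0 \<in> A \<and> p r \<in> B \<and> (\<forall>i\<le>r. p i \<in> W) \<and>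
    (\<forall>i<r. E (p i) (p (Suc i)))" for r and p :: "nat \<Rightarrow> 'a"
  obtain n where "((\<lambda>x y. x \<in> W \<and> y \<in> W \<and> E x y) ^^ n) a b"
    using reach by (auto dest: rtranclp_imp_relpowp)
  then obtain f where f: "f 0 = a" "f n = b" "\<forall>i<n. f i \<in> W \<and> f (Suc i) \<in> W \<and> E (f i) (f (Suc i))"
    unfolding relpowp_fun_conv by blast
  have "f i \<in> W" if "i \<le> n" for i
    using f aW that by (cases i) auto
  then have "\<exists>r p. walk r p" using f a b unfolding walk_def by blast
  then obtain r where r: "\<exists>p. walk r p" and least: "\<And>s p. s < r \<Longrightarrow> \<not> walk s p"
    using exists_least_iff[of "\<lambda>r. \<exists>p. walk r p"] by blast
  then obtain p where w: "walk r p" by blast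
  note p = w[unfolded walk_def]
  have pW: "\<And>i. i \<le> r \<Longrightarrow> p i \<in> W" using p by auto
  have "shortest_between E W A B p r"
    unfolding shortest_between_def
  proof (intro conjI allI impI)
    show "p 0 \<in> A" "p r \<in> B" using p by auto
    show "E (p i) (p (Suc i))" if "i < r" for i using p that by auto
    show "p i \<in> W" if "i \<le> r" for i using pW that .
    show "j = Suc i" if ij: "i < j" "j \<le> r" "E (p i) (p j)" for i j
    proof (rule ccontr)
      assume "j \<noteq> Suc i"
      then have lt: "Suc i < j" using ij by simp
      define q where "q = (\<lambda>l. if l \<le> i then p l else p (l + (j - Suc i)))"
      have e: "r - (j - Suc i) + (j - Suc i) = r" using ij by simp
      have "walk (r - (j - Suc i)) q"
        unfolding walk_def
      proof (intro conjI allI impI)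
        show "q 0 \<in> A" using p by (simp add: q_def)
        show "q (r - (j - Suc i)) \<in> B" using p lt ij e by (auto simp: q_def)
        fix l
        show "q l \<in> W" if "l \<le> r - (j - Suc i)" using that pW ij by (auto simp: q_def)
        show "E (q l) (q (Suc l))" if "l < r - (j - Suc i)"
          using that p ij lt by (cases "l = i") (auto simp: q_def)
      qed
      then show False using least[of "r - (j - Suc i)"] lt ij by auto
    qed
    show "p i \<noteq> p j" if ij: "i < j" "j \<le> r" for i j
    proof
      assume eq: "p i = p j"
      define q where "q = (\<lambda>l. if l \<le> i then p l else p (l + (j - i)))"
      have e: "r - (j - i) + (j - i) = r" using ij by simp
      have "walk (r - (j - i)) q"
        unfolding walk_def
      proof (intro conjI allI impI)
        show "q 0 \<in> A" using p by (simp add: q_def)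
        show "q (r - (j - i)) \<in> B"
        proof (cases "j = r")
          case True
          then have "r - (j - i) = i" using ij by simp
          then show ?thesis using p eq True by (simp add: q_def)
        next
          case False
          then show ?thesis using p ij by (auto simp: q_def)
        qed
        fix l
        show "q l \<in> W" if "l \<le> r - (j - i)" using that pW ij by (auto simp: q_def)
        show "E (q l) (q (Suc l))" if "l < r - (j - i)"
        proof (cases "l = i")
          case True
          have "j < r" using True that ij by simp
          then have "E (p j) (p (Suc j))" using p by auto
          moreover have "q (Suc l) = p (Suc j)" using True ij by (simp add: q_def)
          moreover have "q l = p j" using True eq by (simp add: q_def)
          ultimately show ?thesis by simp
        next
          case False
          then show ?thesis using that p ij by (auto simp: q_def)
        qed
      qed
      then show False using least[of "r - (j - i)"] ij by auto
    qed
    show "i = 0" if "i \<le> r" "p i \<in> A" for i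
    proof (rule ccontr)
      assume "i \<noteq> 0"
      moreover have "walk (r - i) (\<lambda>l. p (l + i))" using that p unfolding walk_def by auto
      ultimately show False using least[of "r - i"] that by auto
    qed
    show "i = r" if "i \<le> r" "p i \<in> B" for i
    proof (rule ccontr)
      assume "i \<noteq> r"
      moreover have "walk i p" using that p unfolding walk_def by auto
      ultimately show False using least[of i] that by auto
    qed
  qed
  then show thesis by (rule that)
qed

text \<open>A shortest path through \<open>W\<close> from the neighbours of \<open>x\<close> to
  those of \<open>y\<close> touches \<open>x\<close> and \<open>y\<close> only at its ends, and
  \<open>v\<close> sees nothing of it. In a graph without longer holes the resulting cycle has
  length four, which yields a common neighbour of \<open>x\<close> and \<open>y\<close> in
  \<open>W\<close>; in a chordal graph it cannot exist.\<close>

lemma apex_hole: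
  assumes sym: "\<And>a b. E a b \<Longrightarrow> E b a" and irr: "\<And>a. \<not> E a a"
    and vx: "E v x" and vy: "E v y" and xy: "x \<noteq> y" "\<not> E x y"
    and W: "\<And>w. w \<in> W \<Longrightarrow> w \<noteq> v \<and> \<not> E v w"
    and reach: "(\<lambda>x y. x \<in> W \<and> y \<in> W \<and> E x y)\<^sup>*\<^sup>* a b"
    and aW: "a \<in> W" and xa: "E x a" and yb: "E y b"
  obtains c k where "k \<ge> 4" "hole E c k" "c 0 = v" "c 1 = x" "c (k - 1) = y" "c 2 \<in> W"
proof -
  obtain p r where "shortest_between E W (Collect (E x)) (Collect (E y)) p r"
    by (rule shortest_path[OF reach aW, of "Collect (E x)" "Collect (E y)"]) (use xa yb in auto)
  note p = shortest_betweenD[OF this, unfolded mem_Collect_eq]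
  \<comment> \<open>The order is \<open>v\<close>, \<open>x\<close>, \<open>p 0\<close>, ...,
    \<open>p r\<close>, \<open>y\<close>; hence the shift by two and the length
    \<open>r + 4\<close>.\<close>
  define f where "f = (\<lambda>i. if i = 0 then v else if i = 1 then x else if i = r + 3 then y else p (i - 2))"
  have xW: "x \<notin> W" "y \<notin> W" using W vx vy by auto
  have vne: "v \<noteq> x" "v \<noteq> y" using vx vy irr by auto
  have h: "hole E (\<lambda>i. f (nat (i mod int (r + 4)))) (int (r + 4))"
  proof (rule hole_of_nat)
    show "E b a" if "E a b" for a b using sym that .
    show "\<not> E a a" for a by (fact irr)
    show "3 \<le> r + 4" by simp
    show "f i \<noteq> f j" if ij: "i < j" "j < r + 4" for i j
    proof -
      have q: "p (l - 2) \<in> W" if "l < r + 3" for l using p(3)[of "l - 2"] that by simp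
      have q2: "p (l - 2) \<noteq> x" "p (l - 2) \<noteq> y" "p (l - 2) \<noteq> v" if "l < r + 3" for l
        using q[OF that] xW W by auto
      have q3: "p (i - 2) \<noteq> p (j - 2)" if "2 \<le> i" "j < r + 3"
        using p(6)[of "i - 2" "j - 2"] ij that by auto
      consider "i = 0" | "i = 1" | "2 \<le> i" by linarith
      then show ?thesis
      proof cases
        case 1
        then show ?thesis using ij vne q2[of j] by (auto simp: f_def)
      next
        case 2
        then show ?thesis using ij xy q2[of j] by (auto simp: f_def)
      next
        case 3
        then show ?thesis using ij q2[of i] q3 by (auto simp: f_def)
      qed
    qed
    show "E (f i) (f j) \<longleftrightarrow> j = Suc i \<or> i = 0 \<and> Suc j = r + 4" if ij: "i < j" "j < r + 4" for i j
    proof -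
      have q: "p (l - 2) \<in> W" if "l < r + 3" for l using p(3)[of "l - 2"] that by simp
      have q2: "\<not> E v (p (l - 2))" if "l < r + 3" for l
        using q[OF that] W by auto
      have q3: "E (p (i - 2)) (p (j - 2)) \<longleftrightarrow> j = Suc i" if "2 \<le> i" "j < r + 3"
      proof
        assume "E (p (i - 2)) (p (j - 2))"
        moreover have "i - 2 < j - 2" "j - 2 \<le> r" using ij that by auto
        ultimately have "j - 2 = Suc (i - 2)" using p(5) by blast
        then show "j = Suc i" using that by linarith
      next
        assume "j = Suc i"
        then have "j - 2 = Suc (i - 2)" using that by linarith
        then show "E (p (i - 2)) (p (j - 2))" using p(4)[of "i - 2"] ij that by auto
      qed
      have q4: "E x (p (j - 2)) \<longleftrightarrow> j = 2" if "2 \<le> j" "j < r + 3"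
      proof
        assume "E x (p (j - 2))"
        then show "j = 2" using p(7)[of "j - 2"] that by auto
      qed (use p(1) in simp)
      have q5: "E (p (i - 2)) y \<longleftrightarrow> i = r + 2" if "2 \<le> i" "i < r + 3"
      proof
        assume "E (p (i - 2)) y"
        then have "E y (p (i - 2))" by (rule sym)
        moreover have "i - 2 \<le> r" using that by linarith
        ultimately have "i - 2 = r" using p(8) by blast
        then show "i = r + 2" using that by linarith
      next
        assume "i = r + 2"
        then show "E (p (i - 2)) y" using sym[OF p(2)] by simp
      qed
      consider "i = 0" | "i = 1" | "2 \<le> i" by linarith
      then show ?thesis
      proof cases
        case 1
        then show ?thesis using ij vx vy q2[of j] by (auto simp: f_def)
      next
        case 2
        then show ?thesis using ij xy q4 by (auto simp: f_def)
      next
        case 3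
        then show ?thesis using ij q3 q5 by (auto simp: f_def)
      qed
    qed
  qed
  show thesis
  proof (rule that[OF _ h])
    have "nat (1 mod int (r + 4)) = 1" by simp
    moreover have "nat (2 mod int (r + 4)) = 2" by simp
    moreover have "nat ((int (r + 4) - 1) mod int (r + 4)) = r + 3" by simp
    ultimately show "f (nat (1 mod int (r + 4))) = x" "f (nat (2 mod int (r + 4))) \<in> W"
       "f (nat ((int (r + 4) - 1) mod int (r + 4))) = y" using p(3)[of 0]
      by (simp_all add: f_def)
  qed (auto simp: f_def)
qed

text \<open>Each forbidden graph is a rule listing its adjacencies and non-adjacencies, which
  already force the vertices to be distinct. In \<open>no_house\<close>, \<open>y\<close> is the
  roof over the edge \<open>x2 x3\<close> of a 4-cycle.\<close>

locale P6_HHD_free =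
  fixes E :: "'a \<Rightarrow> 'a \<Rightarrow> bool"
  assumes sym: "E a b \<Longrightarrow> E b a" and irr: "\<not> E a a"
    and no_hole: "k \<ge> 5 \<Longrightarrow> \<not> hole E c k"
    and no_P6: "E x1 x2 \<Longrightarrow> E x2 x3 \<Longrightarrow> E x3 x4 \<Longrightarrow> E x4 x5 \<Longrightarrow> E x5 x6 \<Longrightarrow>
      \<not> E x1 x3 \<Longrightarrow> \<not> E x1 x4 \<Longrightarrow> \<not> E x1 x5 \<Longrightarrow> \<not> E x1 x6 \<Longrightarrow> \<not> E x2 x4 \<Longrightarrow> \<not> E x2 x5 \<Longrightarrow>
      \<not> E x2 x6 \<Longrightarrow> \<not> E x3 x5 \<Longrightarrow> \<not> E x3 x6 \<Longrightarrow> \<not> E x4 x6 \<Longrightarrow> False"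
    and no_house: "E x1 x2 \<Longrightarrow> E x2 x3 \<Longrightarrow> E x3 x4 \<Longrightarrow> E x4 x1 \<Longrightarrow> \<not> E x1 x3 \<Longrightarrow> \<not> E x2 x4 \<Longrightarrow>
      E y x2 \<Longrightarrow> E y x3 \<Longrightarrow> \<not> E y x1 \<Longrightarrow> \<not> E y x4 \<Longrightarrow> False"
    and no_domino: "E x1 x2 \<Longrightarrow> E x2 x3 \<Longrightarrow> E x3 x4 \<Longrightarrow> E x4 x5 \<Longrightarrow> E y x1 \<Longrightarrow> E y x3 \<Longrightarrow> E y x5 \<Longrightarrow>
      \<not> E x1 x3 \<Longrightarrow> \<not> E x1 x4 \<Longrightarrow> \<not> E x1 x5 \<Longrightarrow> \<not> E x2 x4 \<Longrightarrow> \<not> E x2 x5 \<Longrightarrow> \<not> E x3 x5 \<Longrightarrow>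
      \<not> E y x2 \<Longrightarrow> \<not> E y x4 \<Longrightarrow> False"
begin

lemma nsym: "\<not> E a b \<Longrightarrow> \<not> E b a"
  using sym by blast

text \<open>The length \<open>r\<close> decides which forbidden graph appears. For
  \<open>r = 1\<close> the 4-cycle \<open>x\<close>, \<open>p 0\<close>, \<open>u\<close>,
  \<open>v\<close> has the roof \<open>p 1\<close>; for \<open>r = 2\<close> the 4-cycles
  \<open>v\<close>, \<open>x\<close>, \<open>p 0\<close>, \<open>u\<close> and \<open>u\<close>,
  \<open>p 0\<close>, \<open>p 1\<close>, \<open>p 2\<close> form a domino; for
  \<open>r \<ge> 3\<close> the path closes with \<open>u\<close> to a hole of length
  \<open>r + 2\<close>.\<close>

lemma no_private_neighbour_near:
  assumes K: "\<And>w. w \<in> K \<Longrightarrow> w \<noteq> v \<and> \<not> E v w"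
    and vx: "E v x" and vu: "E v u" and xu: "x \<noteq> u" "\<not> E x u"
    and p: "\<And>i. i \<le> r \<Longrightarrow> p i \<in> K" "E x (p 0)" "E u (p 0)"
    "\<And>i. i < r \<Longrightarrow> E (p i) (p (Suc i))"
    "\<And>i j. i < j \<Longrightarrow> j \<le> r \<Longrightarrow> E (p i) (p j) \<Longrightarrow> j = Suc i"
    "\<And>i j. i < j \<Longrightarrow> j \<le> r \<Longrightarrow> p i \<noteq> p j"
    and int: "\<And>i. 0 < i \<Longrightarrow> i < r \<Longrightarrow> \<not> E x (p i) \<and> \<not> E u (p i)"
    and last: "E u (p r)" "\<not> E x (p r)"
  shows False
proof -
  have nv: "\<not> E v (p i)" "v \<noteq> p i" if "i \<le> r" for i using K p(1) that by auto
  have up: "u \<noteq> p i" if "i \<le> r" for i using nv(1) vu that by auto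
  consider "r = 0" | "r = 1" | "r = 2" | "r \<ge> 3" by linarith
  then show False
  proof cases
    case 1
    then show False using p(2) last by simp
  next
    case 2
    have "E (p 0) (p 1)" using p(4)[of 0] 2 by simp
    moreover have "\<not> E v (p 0)" "\<not> E v (p 1)" "E u (p 1)" "\<not> E x (p 1)" using nv(1) last 2 by auto
    ultimately show False
      using no_house[OF p(2) sym[OF p(3)] sym[OF vu] vx xu(2), of "p 1"] sym by metis
  next
    case 3
    have "E (p 0) (p 1)" "E (p 1) (p 2)" using p(4)[of 0] p(4)[of 1] 3 by (simp_all add: numeral_2_eq_2)
    moreover have "\<not> E (p 0) (p 2)" using p(5)[of 0 2] 3 by auto
    moreover have "\<not> E v (p 0)" "\<not> E v (p 1)" "\<not> E v (p 2)" "E u (p 2)" "\<not> E x (p 2)"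
      "\<not> E x (p 1)" "\<not> E u (p 1)" using nv(1) last int[of 1] 3 by auto
    ultimately show False
      using no_domino[OF vx p(2) _ _ sym[OF vu] p(3), of "p 1" "p 2"] nsym[OF xu(2)] by simp
  next
    case 4
    define f where "f = (\<lambda>i. if i = 0 then u else p (i - 1))"
    have "hole E (\<lambda>i. f (nat (i mod int (r + 2)))) (int (r + 2))"
    proof (rule hole_of_nat)
      show "E b a" if "E a b" for a b using sym that .
      show "\<not> E a a" for a by (fact irr)
      show "3 \<le> r + 2" using 4 by simp
      show "f i \<noteq> f j" if "i < j" "j < r + 2" for i j
        using p(6)[of "i - 1" "j - 1"] up[of "j - 1"] that by (auto simp: f_def)
      show "E (f i) (f j) \<longleftrightarrow> j = Suc i \<or> i = 0 \<and> Suc j = r + 2" if "i < j" "j < r + 2" for i j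
      proof (cases "i = 0")
        case True
        have "E u (p (j - 1)) \<longleftrightarrow> j = 1 \<or> j = r + 1"
        proof (cases "j = 1 \<or> j = r + 1")
          case False
          then have "0 < j - 1" "j - 1 < r" using that True by auto
          then show ?thesis using int[of "j - 1"] False by blast
        qed (use p(3) last in auto)
        then show ?thesis using that True by (simp add: f_def)
      next
        case False
        have "E (p (i - 1)) (p (j - 1)) \<longleftrightarrow> j = Suc i"
        proof
          assume "E (p (i - 1)) (p (j - 1))"
          moreover have "i - 1 < j - 1" "j - 1 \<le> r" using that False by auto
          ultimately have "j - 1 = Suc (i - 1)" using p(5) by blast
          then show "j = Suc i" using False by linarith
        next
          assume "j = Suc i"
          then show "E (p (i - 1)) (p (j - 1))" using p(4)[of "i - 1"] that False by auto
        qed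
        then show ?thesis using that False by (simp add: f_def)
      qed
    qed
    then show False using no_hole[of "int (r + 2)"] 4 by auto
  qed
qed

text \<open>The main consequence of excluding house, hole and domino. Absence of holes gives
  \<open>x\<close> and \<open>u\<close> a common neighbour in \<open>K\<close>; if some vertex of
  \<open>K\<close> were adjacent to just one of them, a shortest path in \<open>K\<close> from the
  common neighbours to such vertices would contradict
  \<open>no_private_neighbour_near\<close>.\<close>

lemma separator_twins:
  assumes K: "\<And>w. w \<in> K \<Longrightarrow> w \<noteq> v \<and> \<not> E v w"
    and conn: "\<And>a b. a \<in> K \<Longrightarrow> b \<in> K \<Longrightarrow> (\<lambda>x y. x \<in> K \<and> y \<in> K \<and> E x y)\<^sup>*\<^sup>* a b"
    and vx: "E v x" and vu: "E v u" and xu: "x \<noteq> u" "\<not> E x u"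
    and a: "a \<in> K" "E x a" and b: "b \<in> K" "E u b" and z: "z \<in> K"
  shows "E x z \<longleftrightarrow> E u z"
proof (rule ccontr)
  assume z': "\<not> (E x z \<longleftrightarrow> E u z)"
  obtain c k where c: "k \<ge> 4" "hole E c k" "c 0 = v" "c 1 = x" "c (k - 1) = u" "c 2 \<in> K"
    using apex_hole[OF sym irr vx vu xu K conn[OF a(1) b(1)] a b(2)] by blast
  then have k: "k = 4" using no_hole[of k c] by linarith
  have xc: "E x (c 2)" "E u (c 2)"
    using hole_adj[OF c(2), of 1 2] hole_adj[OF c(2), of 3 2] c(4,5) k by auto
  obtain p r where "shortest_between E K {w. E x w \<and> E u w} {w. E x w \<noteq> E u w} p r"
    by (rule shortest_path[OF conn[OF c(6) z] c(6), of "{w. E x w \<and> E u w}" "{w. E x w \<noteq> E u w}"])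
      (use xc z' in auto)
  note p = shortest_betweenD[OF this, unfolded mem_Collect_eq]
  have int: "\<not> E x (p i) \<and> \<not> E u (p i)" if "0 < i" "i < r" for i
    using p(7)[of i] p(8)[of i] that by auto
  show False
  proof (cases "E u (p r)")
    case True
    then have l: "E u (p r)" "\<not> E x (p r)" using p(2) by auto
    show False by (rule no_private_neighbour_near[OF K vx vu xu p(3) conjunct1[OF p(1)] conjunct2[OF p(1)] p(4,5,6) int l])
  next
    case False
    then have l: "E x (p r)" "\<not> E u (p r)" using p(2) by auto
    have ux: "u \<noteq> x" "\<not> E u x" using xu(1) nsym[OF xu(2)] by auto
    show False
      by (rule no_private_neighbour_near[OF K vu vx ux p(3) conjunct2[OF p(1)] conjunct1[OF p(1)] p(4,5,6) _ l]) (use int in auto)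
  qed
qed

end

section \<open>Induced cycles in the square of a graph\<close>

definition square :: "('a \<Rightarrow> 'a \<Rightarrow> bool) \<Rightarrow> 'a \<Rightarrow> 'a \<Rightarrow> bool" where
  "square E a b \<longleftrightarrow> a \<noteq> b \<and> (E a b \<or> (\<exists>m. E a m \<and> E m b))"

lemma squareI: "E a m \<Longrightarrow> E m b \<Longrightarrow> a \<noteq> b \<Longrightarrow> square E a b"
  unfolding square_def by blast

lemma squareI1: "E a b \<Longrightarrow> a \<noteq> b \<Longrightarrow> square E a b"
  unfolding square_def by blast

context P6_HHD_free
begin

text \<open>The vertices \<open>c 2\<close>, ..., \<open>c (k - 2)\<close> are more than two away
  from \<open>v = c 0\<close>, so the paths realising their square adjacencies avoid the closed
  neighbourhood of \<open>v\<close>, and they all lie in one component \<open>K\<close> of the rest.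
  Nonadjacent neighbours of \<open>v\<close> that attach to \<open>K\<close> are twins on
  \<open>K\<close>. If \<open>v\<close> were adjacent to \<open>x = c 1\<close>, then
  \<open>x\<close> and a middle vertex of \<open>v\<close> and \<open>y = c (- 1)\<close> would be
  such twins and \<open>x\<close> would be adjacent to \<open>y\<close>; if \<open>u\<close> and
  \<open>u'\<close> were nonadjacent, \<open>u\<close> would be adjacent to both \<open>x\<close>
  and \<open>y\<close>. Either way \<open>x\<close> and \<open>y\<close> would be adjacent in the
  square.\<close>

lemma square_hole_apex:
  assumes h: "hole (square E) c k" and k: "k \<ge> 4"
  shows "\<not> E (c 0) (c 1)" (is ?A)
    and "\<not> E (c 0) (c 1) \<Longrightarrow> \<not> E (c 0) (c (- 1)) \<Longrightarrow> E (c 0) u \<Longrightarrow> E u (c 1) \<Longrightarrow>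
       E (c 0) u' \<Longrightarrow> E u' (c (- 1)) \<Longrightarrow> E u u'" (is "PROP ?B")
proof -
  define v x y where "v = c 0" and "x = c 1" and "y = c (- 1)"
  define W where "W = {w. w \<noteq> v \<and> \<not> E v w}"
  define K where "K = {w. (\<lambda>a b. a \<in> W \<and> b \<in> W \<and> E a b)\<^sup>*\<^sup>* (c 2) w}"
  have far: "c n \<noteq> v \<and> \<not> square E v (c n)" if "2 \<le> n" "n \<le> k - 2" for n
  proof -
    have "\<not> k dvd n" "\<not> k dvd 0 - n - 1" "\<not> k dvd 0 - n + 1"
      using small_not_dvd[of n k] small_not_dvd[of "0 - n - 1" k] small_not_dvd[of "0 - n + 1" k] that
      by auto
    then show ?thesis using hole_eq[OF h, of n 0] hole_adj[OF h, of 0 n] unfolding v_def by simp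
  qed
  have farW: "z \<in> W" if "z \<noteq> v" "\<not> square E v z" for z
    using that squareI1[of E v z] unfolding W_def by auto
  have c2K: "c 2 \<in> K" unfolding K_def by simp
  have KW: "w \<in> W" if "w \<in> K" for w
  proof -
    have "(\<lambda>a b. a \<in> W \<and> b \<in> W \<and> E a b)\<^sup>*\<^sup>* (c 2) w" using that by (simp add: K_def)
    then show ?thesis
      by (cases rule: rtranclp.cases) (use farW far[of 2] k in auto)
  qed
  have Kstep: "b \<in> K" if "a \<in> K" "b \<in> W" "E a b" for a b
    using KW[OF that(1)] that unfolding K_def by (auto intro: rtranclp.rtrancl_into_rtrancl)
  have conn: "(\<lambda>a b. a \<in> K \<and> b \<in> K \<and> E a b)\<^sup>*\<^sup>* a b" if "a \<in> K" "b \<in> K" for a b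
  proof -
    have *: "(\<lambda>a b. a \<in> K \<and> b \<in> K \<and> E a b)\<^sup>*\<^sup>* (c 2) w" if "w \<in> K" for w
    proof -
      have "(\<lambda>a b. a \<in> W \<and> b \<in> W \<and> E a b)\<^sup>*\<^sup>* (c 2) w" using that by (simp add: K_def)
      then show ?thesis
      proof (induction rule: rtranclp_induct)
        case (step a b)
        then have "a \<in> K" by (simp add: K_def)
        then show ?case using step Kstep by (auto intro: rtranclp.rtrancl_into_rtrancl)
      qed simp
    qed
    have "symp (\<lambda>a b. a \<in> K \<and> b \<in> K \<and> E a b)\<^sup>*\<^sup>*"
      by (rule symp_rtranclp) (auto intro!: sympI intro: sym)
    then show ?thesis using *[OF that(1)] *[OF that(2)] by (meson rtranclp_trans sympE)
  qed
  \<comment> \<open>As \<open>z\<close> is more than two away from \<open>v\<close>, the middle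
    vertex of a path of length two from \<open>z\<close> to \<open>b\<close> is neither
    \<open>v\<close> nor a neighbour of \<open>v\<close>, so it stays in \<open>K\<close>.\<close>
  have attach: "(\<exists>a\<in>K. E b a) \<and> (\<not> E v b \<longrightarrow> b \<in> K)"
    if z: "z \<in> K" "z \<noteq> v" "\<not> square E v z" and zb: "square E z b" and b: "b \<noteq> v" for z b
  proof (cases "E z b")
    case True
    then show ?thesis using Kstep[OF z(1) _ True] z(1) sym b unfolding W_def by blast
  next
    case False
    then obtain m where m: "E z m" "E m b" using zb unfolding square_def by blast
    have "m \<noteq> v" using m(1) z(2,3) squareI1 sym by metis
    moreover have "\<not> E v m" using m(1) z(2,3) squareI sym by metis
    ultimately have "m \<in> K" using Kstep[OF z(1) _ m(1)] unfolding W_def by blast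
    then show ?thesis using Kstep[OF _ _ m(2)] m(2) sym b unfolding W_def by blast
  qed
  have adj: "square E (c n) (c (n + 1))" "square E (c n) (c (n - 1))" for n
    using hole_adj[OF h, of n "n + 1"] hole_adj[OF h, of n "n - 1"] by auto
  have inK: "c (2 + int n) \<in> K" if "2 + int n \<le> k - 2" for n
    using that
  proof (induction n)
    case 0
    then show ?case using c2K by simp
  next
    case (Suc n)
    then have *: "c (2 + int n) \<in> K" by simp
    have "c (2 + int (Suc n)) \<noteq> v" "\<not> square E v (c (2 + int (Suc n)))"
      using far[of "2 + int (Suc n)"] Suc.prems by auto
    moreover from this have "\<not> E v (c (2 + int (Suc n)))" using squareI1 by metis
    moreover have "square E (c (2 + int n)) (c (2 + int (Suc n)))"
      using adj(1)[of "2 + int n"] by (simp add: algebra_simps)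
    ultimately show ?case using attach[OF *] far[of "2 + int n"] Suc.prems by auto
  qed
  have ck: "c (k - 2) \<in> K" using inK[of "nat (k - 4)"] k by (simp add: algebra_simps)
  have yk: "y = c (k - 1)" unfolding y_def using hole_eq[OF h, of "-1" "k - 1"] by simp
  have nd: "\<not> k dvd 1" "\<not> k dvd 2" "\<not> k dvd 3" using small_not_dvd[of _ k] k by auto
  have ne: "x \<noteq> v" "y \<noteq> v" "x \<noteq> y" unfolding x_def y_def v_def
    using hole_eq[OF h] nd by auto
  have nxy: "\<not> square E x y" unfolding x_def y_def using hole_adj[OF h, of 1 "-1"] nd by simp
  have xK: "(\<exists>a\<in>K. E x a) \<and> (\<not> E v x \<longrightarrow> x \<in> K)"
    using attach[OF c2K _ _ _ ne(1)] far[of 2] adj(2)[of 2] k unfolding x_def by simp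
  have yK: "(\<exists>a\<in>K. E y a) \<and> (\<not> E v y \<longrightarrow> y \<in> K)"
    using attach[OF ck _ _ _ ne(2)] far[of "k - 2"] adj(1)[of "k - 2"] k unfolding yk by simp
  have K': "w \<noteq> v \<and> \<not> E v w" if "w \<in> K" for w using KW[OF that] by (simp add: W_def)
  have twins: "E a z \<longleftrightarrow> E b z"
    if "E v a" "E v b" "a \<noteq> b" "\<not> E a b" "\<exists>w\<in>K. E a w" "\<exists>w\<in>K. E b w" "z \<in> K" for a b z
    using separator_twins[OF K' conn that(1-4) _ _ _ _ that(7)] that(5,6) by blast
  show ?A
  proof
    assume "E (c 0) (c 1)"
    then have vx: "E v x" by (simp add: v_def x_def)
    have "\<not> E v y" using squareI[of E x v y] vx sym ne nxy by blast
    then have yinK: "y \<in> K" using yK by blast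
    have "square E v y" using adj(2)[of 0] by (simp add: v_def y_def)
    with \<open>\<not> E v y\<close> obtain u where u: "E v u" "E u y" unfolding square_def by blast
    have nxy': "\<not> E x y" using squareI1 ne nxy by metis
    have "x \<noteq> u" using u(2) nxy' by blast
    moreover have "\<not> E x u" using u(2) squareI ne nxy by metis
    ultimately have "E x y" using twins[OF vx u(1) _ _ _ _ yinK] xK yinK u(2) by blast
    then show False using nxy' by simp
  qed
  show "PROP ?B"
  proof -
    assume a: "\<not> E (c 0) (c 1)" "\<not> E (c 0) (c (- 1))" "E (c 0) u" "E u (c 1)" "E (c 0) u'" "E u' (c (- 1))"
    then have b: "E v u" "E u x" "E v u'" "E u' y" "x \<in> K" "y \<in> K"
      using xK yK by (auto simp: v_def x_def y_def)
    have xy: "\<not> (E u x \<and> E u y)" using squareI[of E x u y] sym ne nxy by blast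
    show "E u u'"
    proof (rule ccontr)
      assume "\<not> E u u'"
      moreover have "u \<noteq> u'" using xy b by blast
      ultimately have "E u y" using twins[OF b(1,3) _ _ _ _ b(6)] b by blast
      then show False using xy b by blast
    qed
  qed
qed

lemma square_hole_not_adj:
  assumes h: "hole (square E) c k" and k: "k \<ge> 4"
  shows "\<not> E (c i) (c j)"
proof
  assume e: "E (c i) (c j)"
  have s: "\<not> E (c n) (c (n + 1))" for n
    using square_hole_apex(1)[OF hole_rotate[OF h, of n] k] by (simp add: algebra_simps)
  have "c i \<noteq> c j" using e irr by auto
  then have "square E (c i) (c j)" using e squareI1 by metis
  then consider "k dvd i - j - 1" | "k dvd i - j + 1" using hole_adj[OF h] by blast
  then show False
  proof cases
    case 1
    then have "c i = c (j + 1)" using hole_eq[OF h, of i "j + 1"] by (simp add: algebra_simps)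
    then show False using s[of j] e sym by metis
  next
    case 2
    then have "c (i + 1) = c j" using hole_eq[OF h, of "i + 1" j] by (simp add: algebra_simps)
    then show False using s[of i] e by metis
  qed
qed

lemma square_hole_middles_adj:
  assumes h: "hole (square E) c k" and k: "k \<ge> 4"
    and u: "E u (c i)" "E u (c (i + 1))" and u': "E u' (c (i + 1))" "E u' (c (i + 2))"
  shows "E u u'"
proof -
  let ?c = "\<lambda>j. c (j + (i + 1))"
  have h': "hole (square E) ?c k" using hole_rotate[OF h] .
  have e: "?c 0 = c (i + 1)" "?c 1 = c (i + 2)" "?c (- 1) = c i" by (simp_all add: algebra_simps)
  have "E u' u"
    using square_hole_apex(2)[OF h' k, of u' u] square_hole_not_adj[OF h k] u u' sym unfolding e by blast
  then show ?thesis by (rule sym)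
qed

text \<open>Neighbours of \<open>u\<close> are pairwise within distance two, so a third one on the
  cycle would complete a triangle of the square, which an induced cycle of length at least four does
  not contain.\<close>

lemma square_hole_middle_nbrs:
  assumes h: "hole (square E) c k" and k: "k \<ge> 4"
    and u: "E u (c i)" "E u (c (i + 1))" and j: "E u (c j)"
  shows "k dvd i - j \<or> k dvd i + 1 - j"
proof (rule ccontr)
  assume n: "\<not> ?thesis"
  have s: "c l = c j \<or> square E (c l) (c j)" if "E u (c l)" for l
    using that j squareI sym by metis
  have e: "i + 1 - j - 1 = i - j" "i + 1 - j + 1 = i - j + 2" "i - j + 1 = i + 1 - j" by simp_all
  have "k dvd i - j - 1" using s[OF u(1)] n unfolding hole_eq[OF h] hole_adj[OF h] e by blast
  moreover have "k dvd i - j + 2" using s[OF u(2)] n unfolding hole_eq[OF h] hole_adj[OF h] e by blast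
  ultimately have "k dvd (i - j + 2) - (i - j - 1)" by (rule dvd_diff[rotated])
  then show False using small_not_dvd[of 3 k] k by simp
qed

end

section \<open>Efficient domination excludes holes in the square\<close>

locale P6_HHD_free_ed = P6_HHD_free E for E :: "'a \<Rightarrow> 'a \<Rightarrow> bool" +
  fixes D :: "'a set"
  assumes ed: "\<exists>!d. d \<in> D \<and> (d = v \<or> E d v)"
begin

definition dm :: "'a \<Rightarrow> 'a \<Rightarrow> bool" where
  "dm d v \<longleftrightarrow> d = v \<or> E d v"

definition dom :: "'a \<Rightarrow> 'a" where
  "dom v = (THE d. d \<in> D \<and> dm d v)"

lemma dom: "dom v \<in> D" "dm (dom v) v"
  using theI'[OF ed[of v]] unfolding dom_def dm_def by auto

lemma dom_unique: "d \<in> D \<Longrightarrow> dm d v \<Longrightarrow> dom v = d"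
  using ed[of v] dom[of v] unfolding dm_def by blast

lemma dom_dom [simp]: "dom (dom v) = dom v"
  by (rule dom_unique) (simp_all add: dom(1) dm_def)

lemma dm_dom_iff: "dm (dom a) b \<longleftrightarrow> dom b = dom a"
  using dom_unique[OF dom(1)] dom(2) by metis

lemma dom_not_adj: "\<not> E (dom a) (dom b)"
proof
  assume e: "E (dom a) (dom b)"
  then have "dm (dom a) (dom b)" by (simp add: dm_def)
  then have "dom a = dom b" unfolding dm_dom_iff by simp
  then show False using e irr by simp
qed

lemma not_dom_adj: "dom b \<noteq> dom a \<Longrightarrow> \<not> E (dom a) b"
  using dm_dom_iff dm_def by metis

lemma dom_adj_cases: "dom a = a \<or> E (dom a) a"
  using dom(2) dm_def by metis

lemma dom_far: "a \<noteq> b \<Longrightarrow> \<not> square E a b \<Longrightarrow> dom a \<noteq> dom b"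
  using dom_adj_cases squareI squareI1 sym by metis

text \<open>Meant for nonadjacent vertices with a common neighbour. The choice depends only on the
  unordered pair, so a cycle traversed backwards has the same middle vertices.\<close>

definition middle :: "'a \<Rightarrow> 'a \<Rightarrow> 'a" where
  "middle a b = (if dom a = dom b then dom a else SOME m. E m a \<and> E m b)"

lemma middle_commute: "middle a b = middle b a"
  unfolding middle_def by (simp add: conj_commute)

lemma middle_adj:
  assumes "square E a b" "\<not> E a b"
  shows "E (middle a b) a \<and> E (middle a b) b"
proof (cases "dom a = dom b")
  case True
  have "a \<noteq> b" using assms(1) by (simp add: square_def)
  then have "E (dom a) a \<and> E (dom a) b"
    using dom_adj_cases[of a] dom_adj_cases[of b] True assms(2) sym by metis
  then show ?thesis by (simp add: middle_def True)
next
  case False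
  have "\<exists>m. E m a \<and> E m b" using assms sym unfolding square_def by blast
  then show ?thesis using someI_ex[of "\<lambda>m. E m a \<and> E m b"] False by (simp add: middle_def)
qed

text \<open>Here the choice of the common dominator as middle vertex matters: otherwise \<open>a\<close>,
  \<open>middle a b\<close>, \<open>u'\<close> and \<open>dom a\<close> would form the 4-cycle of a house with roof \<open>b\<close>.\<close>

lemma dom_shift:
  assumes "E a (middle a b)" "E (middle a b) b" "E b u'" "E (middle a b) u'"
    and "\<not> E a b" "\<not> E a u'" "a \<noteq> u'" and du: "dom u' = dom a"
  shows "dom (middle a b) = dom a"
proof (rule ccontr)
  define u d where "u = middle a b" and "d = dom a"
  assume "dom (middle a b) \<noteq> dom a"
  then have n: "dom u \<noteq> dom a" by (simp add: u_def)
  have nd: "\<not> E d u" using not_dom_adj[OF n] by (simp add: d_def)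
  have e: "E a u" "E u b" "E u u'" using assms by (simp_all add: u_def)
  have da: "d = a \<or> E d a" "d = u' \<or> E d u'"
    using dom_adj_cases[of a] dom_adj_cases[of u'] du by (simp_all add: d_def)
  have "d \<noteq> a" using nd e(1) by blast
  moreover have "d \<noteq> u'" using nd e(3) sym by blast
  ultimately have d: "E d a" "E d u'" using da by auto
  have db: "\<not> E b d"
  proof
    assume "E b d"
    then have "dom b = d" using dom_unique[of d b] dom(1) sym by (auto simp: d_def dm_def)
    then have "u = d" by (simp add: u_def d_def middle_def)
    then show False using n by (simp add: d_def)
  qed
  show False
    by (rule no_house[OF e(1,3) sym[OF d(2)] d(1) assms(6) nsym[OF nd] sym[OF e(2)] assms(3)
          nsym[OF assms(5)] db])
qed

text \<open>Otherwise \<open>dom a\<close>, \<open>a\<close>, the two middle vertices,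
  \<open>c\<close> and \<open>dom c\<close> form an induced \<open>P6\<close>:
  \<open>dom_shift\<close>, applied from both sides, keeps \<open>dom a\<close> away from the second
  middle vertex and \<open>dom c\<close> away from the first.\<close>

lemma dominated_middle:
  assumes "E a (middle a b)" "E (middle a b) b" "E b (middle b c)" "E (middle b c) c"
    "E (middle a b) (middle b c)"
    and "\<not> E a b" "\<not> E b c" "\<not> square E a c" "a \<noteq> c"
  shows "dom (middle a b) = dom a \<or> dom (middle b c) = dom c"
proof (rule ccontr)
  define u w where "u = middle a b" and "w = middle b c"
  have e: "E a u" "E u b" "E b w" "E w c" "E u w" using assms by (simp_all add: u_def w_def)
  have ac: "\<not> E a c" using squareI1 assms by metis
  have aw: "\<not> E a w" using squareI assms e by metis
  have uc: "\<not> E u c" using squareI assms e by metis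
  have "a \<noteq> w" using e(4) ac by blast
  moreover have "c \<noteq> u" using e(1) ac by blast
  assume "\<not> (dom (middle a b) = dom a \<or> dom (middle b c) = dom c)"
  then have n: "dom u \<noteq> dom a" "dom w \<noteq> dom c" by (simp_all add: u_def w_def)
  have n2: "dom w \<noteq> dom a"
    using dom_shift[of a b w] n(1) assms(6) e aw \<open>a \<noteq> w\<close> unfolding u_def by blast
  have "E c (middle c b)" "E (middle c b) b" "E b u" "E (middle c b) u"
    using e sym unfolding w_def middle_commute[of c b] by blast+
  then have n3: "dom u \<noteq> dom c"
    using dom_shift[of c b u] n(2) nsym[OF assms(7)] nsym[OF uc] \<open>c \<noteq> u\<close>
    unfolding w_def middle_commute[of c b] by blast
  have dac: "dom a \<noteq> dom c" using dom_far assms by blast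
  have da: "E (dom a) a" using dom_adj_cases[of a] not_dom_adj[OF n(1)] e(1) by metis
  have dc: "E c (dom c)" using dom_adj_cases[of c] not_dom_adj[OF n(2)] e(4) sym by metis
  show False
    using no_P6[OF da e(1,5,4) dc not_dom_adj[OF n(1)] not_dom_adj[OF n2] not_dom_adj[OF dac[symmetric]]
      dom_not_adj aw ac nsym[OF not_dom_adj[OF dac]] uc nsym[OF not_dom_adj[OF n3]]
      nsym[OF not_dom_adj[OF n(2)]]] .
qed

section \<open>An induced cycle of the square together with its middle vertices\<close>

context
  fixes c :: "int \<Rightarrow> 'a" and k :: int and u :: "int \<Rightarrow> 'a"
  assumes h: "hole (square E) c k" and k: "k \<ge> 4"
    and u_def: "\<And>i. u i = middle (c i) (c (i + 1))"
begin

lemma not_dvd_small: "\<not> k dvd 1" "\<not> k dvd 2" "\<not> k dvd 3"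
  using small_not_dvd[of _ k] k by auto

lemma u_adj: "E (u i) (c i)" "E (u i) (c (i + 1))"
  using middle_adj[of "c i" "c (i + 1)"] square_hole_not_adj[OF h k] hole_adj[OF h, of i "i + 1"]
  unfolding u_def by simp_all

lemma u_u: "E (u i) (u (i + 1))"
  using square_hole_middles_adj[OF h k u_adj[of i], of "u (i + 1)"] u_adj[of "i + 1"]
  by (simp add: algebra_simps)

lemma u_c: "E (u i) (c j) \<Longrightarrow> k dvd i - j \<or> k dvd i + 1 - j"
  using square_hole_middle_nbrs[OF h k u_adj] .

lemma c_c: "\<not> E (c i) (c j)"
  using square_hole_not_adj[OF h k] .

lemma dom_c: "dom (c i) = dom (c j) \<Longrightarrow> k dvd i - j \<or> k dvd i - j - 1 \<or> k dvd i - j + 1"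
  using dom_far[of "c i" "c j"] hole_eq[OF h, of i j] hole_adj[OF h, of i j] by blast

lemma dom_u: "dom (u i) = dom (c i) \<or> dom (u (i + 1)) = dom (c (i + 2))"
proof -
  have e: "i + 1 + 1 = i + 2" by simp
  have u1: "u (i + 1) = middle (c (i + 1)) (c (i + 2))" using u_def[of "i + 1"] unfolding e .
  have "\<not> square E (c i) (c (i + 2))" "c i \<noteq> c (i + 2)"
    using hole_adj[OF h, of i "i + 2"] hole_eq[OF h, of i "i + 2"] not_dvd_small by auto
  then show ?thesis
    using dominated_middle[of "c i" "c (i + 1)" "c (i + 2)"] u_adj[of i] u_adj[of "i + 1", unfolded e] c_c
      u_u[of i] sym unfolding u_def[of i, symmetric] u1[symmetric] by blast
qed

text \<open>If \<open>c 0\<close> and \<open>c 1\<close> share a dominator, it equals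
  \<open>u 0\<close> and dominates its neighbours \<open>u 1\<close> and \<open>u (- 1)\<close>, so
  the dominators of \<open>c 2\<close> and \<open>c (- 1)\<close> are adjacent to neither. The
  induced path \<open>dom (c 2)\<close>, \<open>c 2\<close>, \<open>u 1\<close> continues with
  \<open>u (- 1)\<close>, \<open>c (- 1)\<close>, \<open>dom (c (- 1))\<close> if \<open>u 1\<close>
  and \<open>u (- 1)\<close> are adjacent, and with \<open>u 0\<close>, \<open>u (- 1)\<close>,
  \<open>c (- 1)\<close> otherwise.\<close>

lemma same_dom: "dom (c 0) \<noteq> dom (c 1)"
proof
  assume d: "dom (c 0) = dom (c 1)"
  have u0: "u 0 = dom (c 0)" using u_def[of 0] d by (simp add: middle_def)
  have e: "E (u 1) (c 2)" "E (u (- 1)) (c (- 1))" "E (u (- 1)) (c 0)" "E (u 1) (c 1)" "E (u 0) (u 1)"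
     "E (u (- 1)) (u 0)"
    using u_adj[of 1] u_adj[of "-1"] u_u[of 0] u_u[of "-1"] by auto
  have du: "dom (u 1) = dom (c 0)" "dom (u (- 1)) = dom (c 0)" "dom (u 0) = dom (c 0)"
    using dom_unique[OF dom(1)[of "c 0"]] e(5,6) sym unfolding u0[symmetric] dm_def by blast+
  have n2: "dom (c 2) \<noteq> dom (c 0)" using dom_c[of 2 0] not_dvd_small by auto
  have m1: "dom (c (- 1)) \<noteq> dom (c 0)" using dom_c[of "-1" 1] not_dvd_small unfolding d by auto
  have d2m1: "dom (c 2) \<noteq> dom (c (- 1))"
  proof
    assume eq: "dom (c 2) = dom (c (- 1))"
    \<comment> \<open>Vertices with equal dominators are within distance two; the indices 2 and -1
      are cyclically close only for \<open>k = 4\<close>. In that case \<open>u 2\<close> is a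
      dominator too, and it would dominate \<open>u 1\<close> besides \<open>u 0\<close>.\<close>
    then have "k dvd 4" using dom_c[of 2 "-1"] not_dvd_small by auto
    then have "k = 4" using k zdvd_imp_le[of k 4] by auto
    then have "c 3 = c (- 1)" using hole_eq[OF h, of 3 "-1"] by simp
    then have "u 2 = dom (c 2)" using u_def[of 2] eq by (simp add: middle_def)
    moreover have "E (u 1) (u 2)" using u_u[of 1] by simp
    ultimately have "dom (u 1) = dom (c 2)"
      using dom_unique[OF dom(1)[of "c 2"]] sym unfolding dm_def by metis
    then show False using du n2 by simp
  qed
  note n = not_dom_adj
  have a: "E (dom (c 2)) (c 2)" "E (c (- 1)) (dom (c (- 1)))"
    using dom_adj_cases[of "c 2"] dom_adj_cases[of "c (- 1)"] e(1,2) n[of "u 1" "c 2"]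
      n[of "u (- 1)" "c (- 1)"] du n2 m1 sym by metis+
  have b: "\<not> E (dom (c 2)) (u 0)" "\<not> E (dom (c 2)) (u 1)" "\<not> E (dom (c 2)) (u (- 1))"
     "\<not> E (dom (c 2)) (c (- 1))" "\<not> E (u 1) (dom (c (- 1)))" "\<not> E (u (- 1)) (dom (c (- 1)))"
     "\<not> E (c 2) (dom (c (- 1)))"
    using n du n2 m1 d2m1 sym by metis+
  have f: "\<not> E (u (- 1)) (c 2)" "\<not> E (u 0) (c 2)" "\<not> E (u 0) (c (- 1))" "\<not> E (u 1) (c (- 1))"
    using u_c[of "-1" 2] u_c[of 0 2] u_c[of 0 "-1"] u_c[of 1 "-1"] not_dvd_small by auto
  show False
  proof (cases "E (u 1) (u (- 1))")
    case True
    show False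
      by (rule no_P6[OF a(1) sym[OF e(1)] True e(2) a(2) b(2,3,4) dom_not_adj nsym[OF f(1)] c_c b(7)
         f(4) b(5,6)])
  next
    case False
    show False
      by (rule no_P6[OF a(1) sym[OF e(1)] sym[OF e(5)] sym[OF e(6)] e(2) b(2,1,3,4) nsym[OF f(2)]
         nsym[OF f(1)] c_c False f(4,3)])
  qed
qed

text \<open>Without chords the middle vertices form an induced cycle of length \<open>k\<close>. It
  is a hole for \<open>k \<ge> 5\<close>; for \<open>k = 4\<close> the vertex \<open>c 1\<close> is
  a roof over the edge \<open>u 0 u 1\<close> and completes a house.\<close>

lemma u_chord:
  obtains i j where "E (u i) (u j)" "\<not> k dvd i - j" "\<not> k dvd i - j - 1" "\<not> k dvd i - j + 1"
proof (rule ccontr)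
  note [simp] = not_dvd_small
  assume "\<not> thesis"
  then have nochord: "E (u i) (u j) \<Longrightarrow> k dvd i - j \<or> k dvd i - j - 1 \<or> k dvd i - j + 1" for i j
    using that by blast
  have periodic: "u i = u j" if "k dvd i - j" for i j
    using hole_eq[OF h, of i j] hole_eq[OF h, of "i + 1" "j + 1"] that unfolding u_def by simp
  \<comment> \<open>On the cycle \<open>u i\<close> is adjacent to \<open>c i\<close> and
    \<open>c (i + 1)\<close> only, and this pair determines \<open>i\<close> modulo
    \<open>k\<close>.\<close>
  have inj: "u i = u j \<longleftrightarrow> k dvd i - j" for i j
  proof
    assume eq: "u i = u j"
    have *: "k dvd i - j \<or> k dvd i + 1 - j" using u_c[of i j] u_adj(1)[of j] unfolding eq by simp
    have "k dvd i - (j + 1) \<or> k dvd i + 1 - (j + 1)" using u_c[of i "j + 1"] u_adj(2)[of j] unfolding eq by simp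
    then have "k dvd i - j - 1 \<or> k dvd i - j" by (simp add: algebra_simps)
    moreover have "\<not> (k dvd i - j - 1 \<and> k dvd i + 1 - j)"
    proof
      assume "k dvd i - j - 1 \<and> k dvd i + 1 - j"
      then have "k dvd (i + 1 - j) - (i - j - 1)" by (blast intro: dvd_diff)
      then show False by simp
    qed
    ultimately show "k dvd i - j" using * by blast
  qed (rule periodic)
  have adj: "E (u i) (u j) \<longleftrightarrow> k dvd i - j - 1 \<or> k dvd i - j + 1" for i j
  proof
    assume e: "E (u i) (u j)"
    then have "\<not> k dvd i - j" using periodic irr by metis
    then show "k dvd i - j - 1 \<or> k dvd i - j + 1" using nochord[OF e] by blast
  next
    assume "k dvd i - j - 1 \<or> k dvd i - j + 1"
    then show "E (u i) (u j)"
    proof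
      assume "k dvd i - j - 1"
      then have "u i = u (j + 1)" using periodic[of i "j + 1"] by (simp add: algebra_simps)
      then show ?thesis using u_u[of j] sym by simp
    next
      assume "k dvd i - j + 1"
      then have "u (i + 1) = u j" using periodic[of "i + 1" j] by (simp add: algebra_simps)
      then show ?thesis using u_u[of i] by simp
    qed
  qed
  have hu: "hole E u k" unfolding hole_def using inj adj by blast
  show False
  proof (cases "k = 4")
    case False
    then show False using no_hole[of k u] hu k by simp
  next
    case True
    have "E (u 3) (u 0)" "\<not> E (u 3) (u 1)" "\<not> E (u 0) (u 2)" using adj True by auto
    moreover have "\<not> E (c 1) (u 3)" "\<not> E (c 1) (u 2)"
      using u_c[of 3 1] u_c[of 2 1] sym True by auto
    moreover have "E (c 1) (u 0)" "E (c 1) (u 1)" using u_adj(2)[of 0] u_adj(1)[of 1] sym by auto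
    moreover have "E (u 0) (u 1)" "E (u 1) (u 2)" "E (u 2) (u 3)" using u_u[of 0] u_u[of 1] u_u[of 2] by auto
    ultimately show False using no_house[of "u 3" "u 0" "u 1" "u 2" "c 1"] by blast
  qed
qed

text \<open>A chord \<open>u i u j\<close> extends on both sides by \<open>c (i + 1)\<close> and
  \<open>c (j + 1)\<close> and then by their dominators to an induced \<open>P6\<close>: the middle
  vertices are dominated from their left ends, while the path leaves them through the right ends,
  and the dominators of different cycle vertices are different.\<close>

lemma left_dom:
  assumes distinct: "\<And>i. dom (c i) \<noteq> dom (c (i + 1))" and R: "\<And>i. dom (u i) = dom (c i)"
  shows False
proof -
  obtain i j where ij: "E (u i) (u j)" "\<not> k dvd i - j" "\<not> k dvd i - j - 1" "\<not> k dvd i - j + 1"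
    by (rule u_chord)
  have inj: "k dvd a - b" if "dom (c a) = dom (c b)" for a b
  proof -
    consider "k dvd a - b" | "k dvd a - b - 1" | "k dvd a - b + 1" using dom_c[OF \<open>dom (c a) = dom (c b)\<close>] by blast
    then show ?thesis
    proof cases
      case 2
      then have "c a = c (b + 1)" using hole_eq[OF h, of a "b + 1"] by (simp add: algebra_simps)
      then show ?thesis using distinct[of b] that by simp
    next
      case 3
      then have "c (a + 1) = c b" using hole_eq[OF h, of "a + 1" b] by (simp add: algebra_simps)
      then show ?thesis using distinct[of a] that by simp
    qed simp
  qed
  define x y where "x = c (i + 1)" and "y = c (j + 1)"
  have "j - (i + 1) = - (i - j + 1)" by simp
  then have ji: "\<not> k dvd j - (i + 1)" using ij(4) by (simp only: dvd_minus_iff not_False_eq_True)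
  have d: "dom (u i) \<noteq> dom x" "dom (u j) \<noteq> dom x" "dom (u i) \<noteq> dom y" "dom (u j) \<noteq> dom y" "dom x \<noteq> dom y"
    unfolding R x_def y_def
    using inj[of i "i + 1"] inj[of j "j + 1"] inj[of j "i + 1"] inj[of i "j + 1"] inj[of "i + 1" "j + 1"] ij ji not_dvd_small
    by (auto simp: algebra_simps)
  have e: "E (u i) x" "E (u j) y" using u_adj(2) by (simp_all add: x_def y_def)
  have f: "\<not> E x (u j)" "\<not> E (u i) y"
  proof -
    show "\<not> E x (u j)"
    proof
      assume "E x (u j)"
      then have "k dvd j - (i + 1) \<or> k dvd j + 1 - (i + 1)" using u_c[of j "i + 1"] sym x_def by blast
      then have "k dvd - (i - j + 1) \<or> k dvd - (i - j)" by (simp add: algebra_simps)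
      then show False using ij unfolding dvd_minus_iff by blast
    qed
    show "\<not> E (u i) y"
    proof
      assume "E (u i) y"
      then have "k dvd i - (j + 1) \<or> k dvd i + 1 - (j + 1)" using u_c[of i "j + 1"] y_def by blast
      then show False using ij by (simp add: algebra_simps)
    qed
  qed
  have g: "E (dom x) x" "E y (dom y)"
    using dom_adj_cases[of x] dom_adj_cases[of y] not_dom_adj[of "u i" x] not_dom_adj[of "u j" y] d e sym
    by metis+
  have xy: "\<not> E x y" unfolding x_def y_def by (rule c_c)
  show False
    using no_P6[OF g(1) sym[OF e(1)] ij(1) e(2) g(2)] not_dom_adj d f xy dom_not_adj sym by metis
qed

end

text \<open>Domination from the right is contagious: if \<open>u i\<close> is not dominated by
  \<open>dom (c i)\<close>, then \<open>u (i + 1)\<close> is dominated by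
  \<open>dom (c (i + 2))\<close>, which differs from \<open>dom (c (i + 1))\<close>, so the same
  failure occurs at \<open>i + 1\<close> and hence all around the cycle. Thus either all middle
  vertices are dominated from the left or all from the right, and reflection exchanges the two
  cases.\<close>

theorem square_no_hole:
  assumes k: "k \<ge> 4"
  shows "\<not> hole (square E) c k"
proof
  assume h: "hole (square E) c k"
  have distinct: "dom (c i) \<noteq> dom (c (i + 1))" if "hole (square E) c k" for c i
    using same_dom[OF hole_rotate[OF that, of i] k refl] by (simp add: algebra_simps)
  define u where "u = (\<lambda>i. middle (c i) (c (i + 1)))"
  have u: "u i = middle (c i) (c (i + 1))" for i by (simp add: u_def)
  show False
  proof (cases "\<forall>i. dom (u i) = dom (c i)")
    case True
    then show False using left_dom[OF h k u distinct[OF h]] by blast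
  next
    case False
    then obtain i where i: "dom (u i) \<noteq> dom (c i)" by blast
    have *: "dom (u (i + int n)) \<noteq> dom (c (i + int n))" for n
    proof (induction n)
      case 0
      then show ?case using i by simp
    next
      case (Suc n)
      then have "dom (u (i + int n + 1)) = dom (c (i + int n + 2))"
        using dom_u[OF h k u, of "i + int n"] by blast
      then show ?case using distinct[OF h, of "i + int n + 1"] by (simp add: algebra_simps)
    qed
    have all: "dom (u j) \<noteq> dom (c j)" for j
    proof -
      \<comment> \<open>The induction only moves upwards; adding a large multiple of
        \<open>k\<close> to \<open>j\<close> brings it above \<open>i\<close> and leaves the cycle
        unchanged.\<close>
      have "k * (\<bar>i\<bar> + \<bar>j\<bar>) \<ge> 1 * (\<bar>i\<bar> + \<bar>j\<bar>)" using k by (intro mult_right_mono) auto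
      then have "0 \<le> j + k * (\<bar>i\<bar> + \<bar>j\<bar>) - i" by arith
      then obtain n where "j + k * (\<bar>i\<bar> + \<bar>j\<bar>) - i = int n" by (rule zero_le_imp_eq_int[THEN exE])
      then have n: "j + k * (\<bar>i\<bar> + \<bar>j\<bar>) = i + int n" by simp
      have "c (j + k * (\<bar>i\<bar> + \<bar>j\<bar>)) = c j" "c (j + k * (\<bar>i\<bar> + \<bar>j\<bar>) + 1) = c (j + 1)"
        using hole_eq[OF h] by simp_all
      then show ?thesis using *[of n] unfolding n[symmetric] u by simp
    qed
    have L: "dom (u j) = dom (c (j + 1))" for j
      using dom_u[OF h k u, of "j - 1"] all[of "j - 1"] by (simp add: algebra_simps)
    define c' where "c' = (\<lambda>i. c (- i))"
    have h': "hole (square E) c' k" unfolding c'_def by (rule hole_reflect[OF h])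
    have "dom (middle (c' i) (c' (i + 1))) = dom (c' i)" for i
      using L[of "- i - 1"] middle_commute[of "c (- i)"] unfolding u c'_def by simp
    then show False using left_dom[OF h' k refl distinct[OF h']] by blast
  qed
qed

end

section \<open>Chordal graphs and heaviest independent sets\<close>

definition simplicial :: "('a \<Rightarrow> 'a \<Rightarrow> bool) \<Rightarrow> 'a set \<Rightarrow> 'a \<Rightarrow> bool" where
  "simplicial E S s \<longleftrightarrow> s \<in> S \<and> (\<forall>a\<in>S. \<forall>b\<in>S. E s a \<longrightarrow> E s b \<longrightarrow> a \<noteq> b \<longrightarrow> E a b)"

text \<open>Dirac's argument; placing the simplicial vertex outside the closed neighbourhood of
  \<open>v\<close> is what carries the induction. The neighbours \<open>N\<close> of a component
  \<open>C\<close> of the non-neighbours of \<open>v\<close> form a clique, since two nonadjacent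
  ones would lie on an induced cycle through \<open>v\<close> and \<open>C\<close>. The smaller set
  \<open>C \<union> N\<close> has a simplicial vertex in \<open>C\<close>, and it remains simplicial
  in \<open>S\<close> because its neighbours all lie in \<open>C \<union> N\<close>.\<close>

lemma simplicial_avoiding:
  fixes E :: "'a \<Rightarrow> 'a \<Rightarrow> bool"
  assumes sym: "\<And>a b. E a b \<Longrightarrow> E b a" and irr: "\<And>a. \<not> E a a"
    and chordal: "\<And>c k. k \<ge> 4 \<Longrightarrow> \<not> hole E c k"
  assumes "finite S" "v \<in> S" "w \<in> S" "w \<noteq> v" "\<not> E v w"
  shows "\<exists>s. simplicial E S s \<and> s \<noteq> v \<and> \<not> E v s"
  using assms(4-)
proof (induction "card S" arbitrary: S v w rule: less_induct)
  case less
  define W where "W = {z \<in> S. z \<noteq> v \<and> \<not> E v z}"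
  define C where "C = {z. (\<lambda>a b. a \<in> W \<and> b \<in> W \<and> E a b)\<^sup>*\<^sup>* w z}"
  define N where "N = {x \<in> S - C. \<exists>z\<in>C. E x z}"
  have wW: "w \<in> W" using less.prems by (simp add: W_def)
  have CW: "z \<in> W" if "z \<in> C" for z
  proof -
    have "(\<lambda>a b. a \<in> W \<and> b \<in> W \<and> E a b)\<^sup>*\<^sup>* w z" using that by (simp add: C_def)
    then show ?thesis by (cases rule: rtranclp.cases) (use wW in auto)
  qed
  have wC: "w \<in> C" by (simp add: C_def)
  have conn: "(\<lambda>a b. a \<in> W \<and> b \<in> W \<and> E a b)\<^sup>*\<^sup>* a b" if "a \<in> C" "b \<in> C" for a b
  proof -
    have "symp (\<lambda>a b. a \<in> W \<and> b \<in> W \<and> E a b)\<^sup>*\<^sup>*"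
      by (rule symp_rtranclp) (auto intro!: sympI intro: sym)
    then show ?thesis using that[unfolded C_def mem_Collect_eq] by (meson rtranclp_trans sympE)
  qed
  have Cstep: "b \<in> C" if "a \<in> C" "b \<in> W" "E a b" for a b
    using CW[OF that(1)] that unfolding C_def by (auto intro: rtranclp.rtrancl_into_rtrancl)
  have Nv: "E v x" if xN: "x \<in> N" for x
  proof -
    obtain z where z: "z \<in> C" "E x z" "x \<in> S" "x \<notin> C" using xN by (auto simp: N_def)
    have "x \<notin> W" using Cstep[OF z(1) _ sym[OF z(2)]] z(4) by blast
    moreover have "x \<noteq> v" using CW[OF z(1)] z(2) by (auto simp: W_def)
    ultimately show ?thesis using z(3) by (simp add: W_def)
  qed
  have clique: "E x y" if xy: "x \<in> N" "y \<in> N" "x \<noteq> y" for x y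
  proof (rule ccontr)
    assume n: "\<not> E x y"
    obtain a b where a: "a \<in> C" "E x a" and b: "b \<in> C" "E y b" using xy by (auto simp: N_def)
    have W: "z \<noteq> v \<and> \<not> E v z" if "z \<in> W" for z using that by (simp add: W_def)
    obtain c k where "k \<ge> 4" "hole E c k"
      using apex_hole[of E, OF sym irr Nv[OF xy(1)] Nv[OF xy(2)] xy(3) n W conn[OF a(1) b(1)] CW[OF a(1)] a(2) b(2)]
      by blast
    then show False using chordal by blast
  qed
  define T where "T = C \<union> N"
  have CS: "C \<subseteq> S" using CW by (auto simp: W_def)
  have TS: "T \<subseteq> S" using CS by (auto simp: T_def N_def)
  have vT: "v \<notin> T" using CW Nv irr by (auto simp: T_def W_def)
  have lt: "card T < card S" using TS vT less.prems(1,2) by (metis psubsetI psubset_card_mono)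
  have finT: "finite T" "finite C" using TS less.prems(1) finite_subset by (auto simp: T_def)
  have "\<exists>s\<in>C. simplicial E T s"
  \<comment> \<open>A vertex \<open>z\<close> of \<open>N\<close> that misses something in
    \<open>T\<close> is taken as the vertex to avoid: being nonadjacent to \<open>z\<close>, the
    simplicial vertex lies outside the clique \<open>N\<close>. If there is no such
    \<open>z\<close>, the vertices of \<open>N\<close> are adjacent to all others in
    \<open>T\<close>, and a simplicial vertex of \<open>C\<close> alone suffices.\<close>
  proof (cases "\<forall>z\<in>N. \<forall>y\<in>T. y \<noteq> z \<longrightarrow> E z y")
    case False
    then obtain z y where z: "z \<in> N" "y \<in> T" "y \<noteq> z" "\<not> E z y" by blast
    then obtain s where s: "simplicial E T s" "s \<noteq> z" "\<not> E z s"
      using less.hyps[OF lt finT(1), of z y] by (auto simp: T_def)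
    then have "s \<notin> N" using clique z(1) by blast
    then show ?thesis using s by (auto simp: T_def simplicial_def)
  next
    case True
    have "card C < card S"
      using CS vT less.prems(1,2) by (metis UnI1 T_def psubsetI psubset_card_mono)
    have "\<exists>s. simplicial E C s"
    proof (cases "\<exists>a\<in>C. \<exists>b\<in>C. b \<noteq> a \<and> \<not> E a b")
      case True
      then obtain a b where "a \<in> C" "b \<in> C" "b \<noteq> a" "\<not> E a b" by blast
      then show ?thesis using less.hyps[OF \<open>card C < card S\<close> finT(2)] by blast
    next
      case False
      then have "simplicial E C w" using wC by (auto simp: simplicial_def)
      then show ?thesis by blast
    qed
    then obtain s where s: "simplicial E C s" by blast
    have "E a b" if ab: "a \<in> T" "b \<in> T" "E s a" "E s b" "a \<noteq> b" for a b
    proof -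
      consider "a \<in> N" | "b \<in> N" | "a \<in> C" "b \<in> C" using ab(1,2) unfolding T_def by blast
      then show ?thesis
      proof cases
        case 1
        show ?thesis using \<open>\<forall>z\<in>N. \<forall>y\<in>T. y \<noteq> z \<longrightarrow> E z y\<close> 1 ab(2,5) by auto
      next
        case 2
        have "E b a" using \<open>\<forall>z\<in>N. \<forall>y\<in>T. y \<noteq> z \<longrightarrow> E z y\<close> 2 ab(1,5) by auto
        then show ?thesis by (rule sym)
      next
        case 3
        then show ?thesis using s ab by (simp add: simplicial_def)
      qed
    qed
    then show ?thesis using s by (auto simp: simplicial_def T_def)
  qed
  then obtain s where s: "s \<in> C" "simplicial E T s" by blast
  have nb: "a \<in> T" if "a \<in> S" "E s a" for a
    using that(1) s(1) sym[OF that(2)] unfolding T_def N_def by blast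
  have "simplicial E S s"
    using s CS nb unfolding simplicial_def by blast
  moreover have "s \<noteq> v" "\<not> E v s" using CW[OF s(1)] by (auto simp: W_def)
  ultimately show ?case by blast
qed

lemma chordal_simplicial:
  fixes E :: "'a \<Rightarrow> 'a \<Rightarrow> bool"
  assumes sym: "\<And>a b. E a b \<Longrightarrow> E b a" and irr: "\<And>a. \<not> E a a"
    and chordal: "\<And>c k. k \<ge> 4 \<Longrightarrow> \<not> hole E c k"
    and S: "finite S" "S \<noteq> {}"
  shows "\<exists>s. simplicial E S s"
proof (cases "\<exists>a\<in>S. \<exists>b\<in>S. b \<noteq> a \<and> \<not> E a b")
  case True
  then obtain a b where "a \<in> S" "b \<in> S" "b \<noteq> a" "\<not> E a b" by blast
  from simplicial_avoiding[of E, OF sym irr chordal S(1) this] show ?thesis by blast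
next
  case False
  obtain s where "s \<in> S" using S(2) by blast
  then have "simplicial E S s" using False unfolding simplicial_def by metis
  then show ?thesis by blast
qed

section \<open>Independent sets and Frank's algorithm\<close>

definition indep :: "('a \<Rightarrow> 'a \<Rightarrow> bool) \<Rightarrow> 'a set \<Rightarrow> bool" where
  "indep E I \<longleftrightarrow> (\<forall>a\<in>I. \<forall>b\<in>I. \<not> E a b)"

lemma indep_clique_cases:
  assumes "indep E J" "\<And>a b. a \<in> Q \<Longrightarrow> b \<in> Q \<Longrightarrow> a \<noteq> b \<Longrightarrow> E a b"
  obtains "J \<inter> Q = {}" | a where "J \<inter> Q = {a}"
  using assms unfolding indep_def by blast

text \<open>
  One step of Frank's algorithm: subtracting the weight of a simplicial vertex from the weights in
  its closed neighbourhood lowers the optimum by exactly that weight.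
\<close>

lemma frank_step:
  fixes r r' :: "'a \<Rightarrow> nat"
  assumes sym: "\<And>a b. E a b \<Longrightarrow> E b a" and irr: "\<And>a. \<not> E a a"
    and S: "finite S" and v: "simplicial E S v"
    and r': "\<And>u. r' u = (if u = v \<or> E v u then r u - r v else r u)"
    and I: "indep E I" "I \<subseteq> S - {v}" "\<And>u. u \<in> I \<Longrightarrow> r' u > 0"
    and opt: "\<And>J. indep E J \<Longrightarrow> J \<subseteq> S - {v} \<Longrightarrow> sum r' J \<le> sum r' I"
    and I': "I' = (if r v > 0 \<and> (\<forall>u\<in>I. \<not> E v u) then insert v I else I)"
  shows "indep E I'" "I' \<subseteq> S" "\<And>u. u \<in> I' \<Longrightarrow> r u > 0"
    and "\<And>J. indep E J \<Longrightarrow> J \<subseteq> S \<Longrightarrow> sum r J \<le> sum r I'"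
proof -
  define Q where "Q = {u \<in> S. u = v \<or> E v u}"
  have Q: "E a b" if "a \<in> Q" "b \<in> Q" "a \<noteq> b" for a b
    using v that sym unfolding Q_def simplicial_def by blast
  have vS: "v \<in> S" using v by (simp add: simplicial_def)
  show "indep E I'" using I(1) irr sym unfolding I' indep_def by auto
  show "I' \<subseteq> S" using I(2) vS unfolding I' by auto
  show "r u > 0" if "u \<in> I'" for u
  proof (cases "u \<in> I")
    case True
    then have "r' u > 0" by (rule I(3))
    then show ?thesis unfolding r' by (auto split: if_splits)
  next
    case False
    then show ?thesis using that unfolding I' by (auto split: if_splits)
  qed
  have finI: "finite I" using I(2) S finite_subset by blast
  have "sum r I' = sum r' I + r v"
  proof (cases "\<exists>u\<in>I. E v u")
    case True
    then obtain u where u: "u \<in> I" "E v u" by blast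
    have uQ: "u \<in> Q" using u I(2) by (auto simp: Q_def)
    have other: "r' x = r x" if "x \<in> I - {u}" for x
    proof -
      have "x \<notin> Q" using Q[of u x] uQ that I(1) u(1) unfolding indep_def by blast
      then show ?thesis using that I(2) unfolding r' Q_def by auto
    qed
    \<comment> \<open>The residual weights on \<open>I\<close> are carried along as positive so that
      the subtraction is exact here.\<close>
    have "r u = r' u + r v" using I(3)[OF u(1)] u(2) unfolding r' by simp
    moreover have "sum r (I - {u}) = sum r' (I - {u})" by (rule sum.cong) (use other in auto)
    ultimately have "sum r I = sum r' I + r v" using finI u(1) by (simp add: sum.remove[of I u])
    then show ?thesis using True unfolding I' by auto
  next
    case False
    have "sum r I = sum r' I"
      by (rule sum.cong) (use False I(2) in \<open>auto simp: r'\<close>)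
    moreover have "v \<notin> I" using I(2) by auto
    ultimately show ?thesis using False finI unfolding I' by auto
  qed
  note opt' = this
  show "sum r J \<le> sum r I'" if J: "indep E J" "J \<subseteq> S" for J
  proof -
    have finJ: "finite J" using J(2) S finite_subset by blast
    have J': "indep E (J - {v})" "J - {v} \<subseteq> S - {v}" using J by (auto simp: indep_def)
    have notQ: "r x = r' x" if "x \<in> J" "x \<notin> Q" for x
      using that J(2) unfolding r' Q_def by auto
    \<comment> \<open>The closed neighbourhood of \<open>v\<close> is a clique, so \<open>J\<close>
      has at most one vertex in it and loses at most \<open>r v\<close>.\<close>
    have "sum r J \<le> sum r' (J - {v}) + r v"
    proof (rule indep_clique_cases[OF J(1) Q])
      assume e: "J \<inter> Q = {}"
      have "sum r J = sum r' J" by (rule sum.cong) (use notQ e in auto)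
      moreover have "v \<notin> J" using e vS by (auto simp: Q_def)
      ultimately show ?thesis by simp
    next
      fix a assume a: "J \<inter> Q = {a}"
      have aJ: "a \<in> J" using a by auto
      have e: "sum r (J - {a}) = sum r' (J - {a})" by (rule sum.cong) (use notQ a in auto)
      show ?thesis
      proof (cases "a = v")
        case True
        then show ?thesis using e aJ finJ by (simp add: sum.remove)
      next
        case False
        then have "v \<notin> J" using a vS by (auto simp: Q_def)
        \<comment> \<open>In this direction truncation is harmless, as it only enlarges the
          right-hand side.\<close>
        moreover have "r a \<le> r' a + r v" unfolding r' by auto
        moreover have "sum r J = r a + sum r (J - {a})" "sum r' J = r' a + sum r' (J - {a})"
          using aJ finJ by (simp_all add: sum.remove)
        ultimately show ?thesis using e by simp
      qed
    qed (assumption)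
    also have "\<dots> \<le> sum r' I + r v" using opt[OF J'] by simp
    finally show ?thesis unfolding opt' .
  qed
qed

text \<open>Vertex \<open>x s\<close> is eliminated in step \<open>s\<close>, \<open>r s\<close> are the residual weights before this step, and
  \<open>I s\<close> is the solution for the vertices that are then left.\<close>

lemma frank:
  fixes r :: "nat \<Rightarrow> 'a \<Rightarrow> nat"
  assumes sym: "\<And>a b. E a b \<Longrightarrow> E b a" and irr: "\<And>a. \<not> E a a"
    and V: "finite V" "card V = n"
    and x: "\<And>s. s < n \<Longrightarrow> simplicial E (V - x ` {..<s}) (x s)"
    and r: "\<And>s u. s < n \<Longrightarrow> r (Suc s) u = (if u = x s \<or> E (x s) u then r s u - r s (x s) else r s u)"
    and I0: "I n = {}"
    and I: "\<And>s. s < n \<Longrightarrow> I s = (if r s (x s) > 0 \<and> (\<forall>u\<in>I (Suc s). \<not> E (x s) u)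
              then insert (x s) (I (Suc s)) else I (Suc s))"
  shows "indep E (I 0) \<and> I 0 \<subseteq> V \<and> (\<forall>J. indep E J \<longrightarrow> J \<subseteq> V \<longrightarrow> sum (r 0) J \<le> sum (r 0) (I 0))"
proof -
  define S where "S s = V - x ` {..<s}" for s
  have inj: "inj_on x {..<n}"
  proof -
    have "x s \<noteq> x t" if "s < t" "t < n" for s t
    proof -
      have "x t \<notin> x ` {..<t}" using x[OF that(2)] unfolding simplicial_def by blast
      moreover have "x s \<in> x ` {..<t}" using that(1) by simp
      ultimately show ?thesis by metis
    qed
    then show ?thesis unfolding inj_on_def by (metis lessThan_iff linorder_neqE_nat)
  qed
  have "x ` {..<n} \<subseteq> V" using x unfolding simplicial_def by auto
  then have "x ` {..<n} = V" using V inj by (simp add: card_image card_subset_eq)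
  then have Sn: "S n = {}" by (simp add: S_def)
  have "s \<le> n \<Longrightarrow> indep E (I s) \<and> I s \<subseteq> S s \<and> (\<forall>u\<in>I s. r s u > 0) \<and>
    (\<forall>J. indep E J \<longrightarrow> J \<subseteq> S s \<longrightarrow> sum (r s) J \<le> sum (r s) (I s))" for s
  proof (induction "n - s" arbitrary: s)
    case 0
    then have "s = n" by simp
    then show ?case using I0 Sn by (auto simp: indep_def)
  next
    case (Suc d)
    then have s: "s < n" by simp
    have IH: "indep E (I (Suc s)) \<and> I (Suc s) \<subseteq> S (Suc s) \<and> (\<forall>u\<in>I (Suc s). r (Suc s) u > 0) \<and>
      (\<forall>J. indep E J \<longrightarrow> J \<subseteq> S (Suc s) \<longrightarrow> sum (r (Suc s)) J \<le> sum (r (Suc s)) (I (Suc s)))"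
      using Suc by simp
    have SS: "S (Suc s) = S s - {x s}" by (auto simp: S_def lessThan_Suc)
    have fin: "finite (S s)" using V by (simp add: S_def)
    note step = frank_step[of E, OF sym irr fin x[OF s, folded S_def] r[OF s] _ _ _ _ I[OF s]]
    show ?case using step IH unfolding SS by meson
  qed
  from this[of 0] show ?thesis by (simp add: S_def)
qed

text \<open>Loops of the program count upwards, so the backward pass is restated with
  \<open>K t\<close> as the solution after \<open>t\<close> rounds, when the last \<open>t\<close>
  eliminated vertices have been considered.\<close>

lemma frank_forward:
  fixes r :: "nat \<Rightarrow> 'a \<Rightarrow> nat"
  assumes "\<And>a b. E a b \<Longrightarrow> E b a" and "\<And>a. \<not> E a a"
    and "finite V" "card V = n"
    and "\<And>s. s < n \<Longrightarrow> simplicial E (V - x ` {..<s}) (x s)"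
    and "\<And>s u. s < n \<Longrightarrow> r (Suc s) u = (if u = x s \<or> E (x s) u then r s u - r s (x s) else r s u)"
    and K0: "K 0 = {}"
    and K: "\<And>t. t < n \<Longrightarrow> K (Suc t) =
      (if r (n - Suc t) (x (n - Suc t)) > 0 \<and> (\<forall>u\<in>K t. \<not> E (x (n - Suc t)) u)
       then insert (x (n - Suc t)) (K t) else K t)"
  shows "indep E (K n) \<and> K n \<subseteq> V \<and> (\<forall>J. indep E J \<longrightarrow> J \<subseteq> V \<longrightarrow> sum (r 0) J \<le> sum (r 0) (K n))"
proof -
  have K': "K (n - s) = (if r s (x s) > 0 \<and> (\<forall>u\<in>K (n - Suc s). \<not> E (x s) u)
              then insert (x s) (K (n - Suc s)) else K (n - Suc s))" if "s < n" for s
    using K[of "n - Suc s"] that by (simp add: Suc_diff_Suc)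
  have "indep E (K (n - 0)) \<and> K (n - 0) \<subseteq> V \<and>
    (\<forall>J. indep E J \<longrightarrow> J \<subseteq> V \<longrightarrow> sum (r 0) J \<le> sum (r 0) (K (n - 0)))"
    by (rule frank[of E V n x r "\<lambda>s. K (n - s)"]) (fact assms K' | simp add: K0)+
  then show ?thesis by simp
qed

section \<open>Reduction to independent sets of the square\<close>

abbreviation adj :: "'a graph \<Rightarrow> 'a \<Rightarrow> 'a \<Rightarrow> bool" where
  "adj G u v \<equiv> {u, v} \<in> edges G"

lemma adj_sym: "adj G u v \<Longrightarrow> adj G v u"
  by (simp add: insert_commute)

lemma adj_verts: "simple_graph G \<Longrightarrow> adj G u v \<Longrightarrow> u \<in> verts G \<and> v \<in> verts G"
  unfolding simple_graph_def by blast

lemma adj_irrefl: "simple_graph G \<Longrightarrow> \<not> adj G u u"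
  unfolding simple_graph_def by fastforce

lemma square_adj_sym: "square (adj G) u v \<Longrightarrow> square (adj G) v u"
  unfolding square_def using adj_sym by metis

lemma square_irrefl: "\<not> square E u u"
  by (simp add: square_def)

section \<open>From forbidden induced subgraphs to rules on the adjacency relation\<close>

lemma free_ofD:
  fixes g :: "'b \<Rightarrow> 'a"
  assumes "free_of F G" and inj: "inj_on g (verts F)" and V: "g ` verts F \<subseteq> verts G"
    and e: "\<And>a b. a \<in> verts F \<Longrightarrow> b \<in> verts F \<Longrightarrow> adj G (g a) (g b) \<longleftrightarrow> adj F a b"
  shows False
proof -
  have inv: "inv_into (verts F) g (g a) = a" if "a \<in> verts F" for a
    using inj that by (rule inv_into_f_f)
  have "isomorphic (induced_subgraph G (g ` verts F)) F"
    unfolding isomorphic_def induced_subgraph_def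
  proof (intro exI conjI ballI)
    show "bij_betw (inv_into (verts F) g) (verts (g ` verts F, {e \<in> edges G. e \<subseteq> g ` verts F})) (verts F)"
      using inj by (simp add: bij_betw_inv_into inj_on_imp_bij_betw)
  qed (use e inv in auto)
  then show False using assms(1) V unfolding free_of_def by blast
qed

text \<open>The lists below enumerate the images of the vertices \<open>0, 1, \<dots>\<close> of the forbidden graph.\<close>

lemma free_of_listD:
  assumes "free_of F G" "simple_graph G" and F: "verts F = {..<length xs}" and d: "distinct xs"
    and V: "set xs \<subseteq> verts G"
    and e: "\<And>i j. i < j \<Longrightarrow> j < length xs \<Longrightarrow> adj G (xs ! i) (xs ! j) \<longleftrightarrow> adj F i j"
    and irr: "\<And>i. \<not> adj F i i"
  shows False
proof (rule free_ofD[of F G "\<lambda>i. xs ! i"])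
  show "adj G (xs ! i) (xs ! j) \<longleftrightarrow> adj F i j" if "i \<in> verts F" "j \<in> verts F" for i j
  proof (cases i j rule: linorder_cases)
    case less
    then show ?thesis using e that F by simp
  next
    case equal
    then show ?thesis using irr adj_irrefl[OF assms(2)] by simp
  next
    case greater
    then show ?thesis using e[of j i] that F by (simp add: insert_commute)
  qed
qed (use assms in \<open>auto simp: F inj_on_def nth_eq_iff_index_eq\<close>)

lemma path_adj: "adj (path_graph k) i j \<longleftrightarrow> (j = Suc i \<and> j < k) \<or> (i = Suc j \<and> i < k)"
  unfolding path_graph_def by (auto simp: doubleton_eq_iff)

lemma house_adj: "adj house i j \<longleftrightarrow> i < 5 \<and> j < 5 \<and> i \<noteq> j \<and> j \<noteq> Suc i \<and> i \<noteq> Suc j"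
proof -
  have "verts (path_graph 5) = {..<5}" by (simp add: path_graph_def)
  then have "adj house i j \<longleftrightarrow> (\<exists>u v. {i, j} = {u, v} \<and> u < 5 \<and> v < 5 \<and> u \<noteq> v \<and> \<not> adj (path_graph 5) u v)"
    unfolding house_def complement_def by simp
  also have "\<dots> \<longleftrightarrow> i < 5 \<and> j < 5 \<and> i \<noteq> j \<and> \<not> adj (path_graph 5) i j"
    by (auto simp: doubleton_eq_iff insert_commute)
  finally show ?thesis unfolding path_adj by auto
qed

lemma domino_adj: "adj domino i j \<longleftrightarrow> adj (path_graph 5) i j \<or>
    (i = 5 \<and> (j = 0 \<or> j = 2 \<or> j = 4)) \<or> (j = 5 \<and> (i = 0 \<or> i = 2 \<or> i = 4))"
  unfolding domino_def by (auto simp: doubleton_eq_iff)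

lemma cycle_adj: "adj (cycle_graph k) i j \<longleftrightarrow> (j = Suc i mod k \<and> i < k) \<or> (i = Suc j mod k \<and> j < k)"
  unfolding cycle_graph_def by (auto simp: doubleton_eq_iff)

lemma hole_no_free_of_cycle:
  assumes G: "simple_graph G" and h: "hole (adj G) c k" and k: "k \<ge> 5"
  shows "\<not> free_of (cycle_graph (nat k)) G"
proof
  assume f: "free_of (cycle_graph (nat k)) G"
  define n where "n = nat k"
  have n: "int n = k" "n \<ge> 5" using k by (auto simp: n_def)
  have V: "verts (cycle_graph n) = {..<n}" by (simp add: cycle_graph_def)
  have small: "k dvd z \<longleftrightarrow> z = 0 \<or> z = k \<or> z = - k" if "\<bar>z\<bar> < 2 * k" for z
  proof
    assume "k dvd z"
    then obtain q where q: "z = k * q" by auto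
    have "\<bar>q\<bar> < 2"
    proof (rule ccontr)
      assume "\<not> \<bar>q\<bar> < 2"
      then have "k * 2 \<le> k * \<bar>q\<bar>" using k by simp
      then show False using that k unfolding q by (simp add: abs_mult)
    qed
    then have "q = 0 \<or> q = 1 \<or> q = -1" by linarith
    then show "z = 0 \<or> z = k \<or> z = - k" using q by auto
  qed auto
  show False
  proof (rule free_ofD[OF f, of "\<lambda>i. c (int i)"], unfold n_def[symmetric] V)
    show "inj_on (\<lambda>i. c (int i)) {..<n}"
    proof (rule inj_onI)
      fix a b assume "a \<in> {..<n}" "b \<in> {..<n}" "c (int a) = c (int b)"
      then show "a = b" using small[of "int a - int b"] hole_eq[OF h] n by auto
    qed
    have "c i \<in> verts G" for i
      using adj_verts[OF G, of "c i" "c (i + 1)"] hole_adj[OF h, of i "i + 1"] by simp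
    then show "(\<lambda>i. c (int i)) ` {..<n} \<subseteq> verts G" by auto
    fix a b assume "a \<in> {..<n}" "b \<in> {..<n}"
    then have ab: "a < n" "b < n" by auto
    have m: "Suc x mod n = (if Suc x = n then 0 else Suc x)" if "x < n" for x
      using that by auto
    have "adj G (c (int a)) (c (int b)) \<longleftrightarrow> k dvd int a - int b - 1 \<or> k dvd int a - int b + 1"
      by (rule hole_adj[OF h])
    also have "\<dots> \<longleftrightarrow> (b = Suc a mod n \<and> a < n) \<or> (a = Suc b mod n \<and> b < n)"
      using small[of "int a - int b - 1"] small[of "int a - int b + 1"] ab n
      unfolding m[OF ab(1)] m[OF ab(2)] by auto
    finally show "adj G (c (int a)) (c (int b)) \<longleftrightarrow> adj (cycle_graph n) a b"
      unfolding cycle_adj .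
  qed
qed

lemma P6_HHD_free_graph:
  assumes G: "simple_graph G" and P: "free_of (path_graph 6) G" and H: "HHD_free G"
  shows "P6_HHD_free (adj G)"
proof
  note irr = adj_irrefl[OF G]
  note V = adj_verts[OF G]
  show "adj G b a" if "adj G a b" for a b using that by (rule adj_sym)
  show "\<not> adj G a a" for a by (rule irr)
  show "\<not> hole (adj G) c k" if "k \<ge> 5" for c k
  proof -
    have "nat k \<ge> 5" using that by simp
    then have "free_of (cycle_graph (nat k)) G" using H unfolding HHD_free_def by blast
    then show ?thesis using hole_no_free_of_cycle[OF G _ that] by blast
  qed
  show False if e: "adj G x1 x2" "adj G x2 x3" "adj G x3 x4" "adj G x4 x5" "adj G x5 x6"
    "\<not> adj G x1 x3" "\<not> adj G x1 x4" "\<not> adj G x1 x5" "\<not> adj G x1 x6" "\<not> adj G x2 x4" "\<not> adj G x2 x5"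
    "\<not> adj G x2 x6" "\<not> adj G x3 x5" "\<not> adj G x3 x6" "\<not> adj G x4 x6" for x1 x2 x3 x4 x5 x6
  proof (rule free_of_listD[OF P G, of "[x1, x2, x3, x4, x5, x6]"])
    show "distinct [x1, x2, x3, x4, x5, x6]"
      using e irr adj_sym[of _ _ G] unfolding distinct.simps set_simps insert_iff empty_iff by metis
    show "set [x1, x2, x3, x4, x5, x6] \<subseteq> verts G" using e V by auto
    show "adj G ([x1, x2, x3, x4, x5, x6] ! i) ([x1, x2, x3, x4, x5, x6] ! j) \<longleftrightarrow> adj (path_graph 6) i j"
      if "i < j" "j < length [x1, x2, x3, x4, x5, x6]" for i j
      using that e unfolding path_adj by (auto simp: less_Suc_eq)
  qed (auto simp: path_adj path_graph_def)
  show False if e: "adj G x1 x2" "adj G x2 x3" "adj G x3 x4" "adj G x4 x1" "\<not> adj G x1 x3" "\<not> adj G x2 x4"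
    "adj G y x2" "adj G y x3" "\<not> adj G y x1" "\<not> adj G y x4" for x1 x2 x3 x4 y
  \<comment> \<open>The house is a complement, so consecutive vertices of this list are its
    nonadjacent pairs.\<close>
  proof (rule free_of_listD[of house G "[x2, x4, y, x1, x3]"])
    show "distinct [x2, x4, y, x1, x3]"
      using e irr adj_sym[of _ _ G] unfolding distinct.simps set_simps insert_iff empty_iff by metis
    show "set [x2, x4, y, x1, x3] \<subseteq> verts G" using e V by auto
    show "adj G ([x2, x4, y, x1, x3] ! i) ([x2, x4, y, x1, x3] ! j) \<longleftrightarrow> adj house i j"
      if "i < j" "j < length [x2, x4, y, x1, x3]" for i j
      using that e adj_sym[of _ _ G] unfolding house_adj by (auto simp: less_Suc_eq)
  qed (use H G in \<open>auto simp: house_adj HHD_free_def house_def complement_def path_graph_def\<close>)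
  show False if e: "adj G x1 x2" "adj G x2 x3" "adj G x3 x4" "adj G x4 x5" "adj G y x1" "adj G y x3" "adj G y x5"
    "\<not> adj G x1 x3" "\<not> adj G x1 x4" "\<not> adj G x1 x5" "\<not> adj G x2 x4" "\<not> adj G x2 x5" "\<not> adj G x3 x5"
    "\<not> adj G y x2" "\<not> adj G y x4" for x1 x2 x3 x4 x5 y
  proof (rule free_of_listD[of domino G "[x1, x2, x3, x4, x5, y]"])
    show "distinct [x1, x2, x3, x4, x5, y]"
      using e irr adj_sym[of _ _ G] unfolding distinct.simps set_simps insert_iff empty_iff by metis
    show "set [x1, x2, x3, x4, x5, y] \<subseteq> verts G" using e V by auto
    show "adj G ([x1, x2, x3, x4, x5, y] ! i) ([x1, x2, x3, x4, x5, y] ! j) \<longleftrightarrow> adj domino i j"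
      if "i < j" "j < length [x1, x2, x3, x4, x5, y]" for i j
      using that e adj_sym[of _ _ G] unfolding domino_adj path_adj by (auto simp: less_Suc_eq insert_commute)
  qed (use H G in \<open>auto simp: domino_adj path_adj HHD_free_def domino_def path_graph_def\<close>)
qed

text \<open>Adding all non-vertices to \<open>D\<close> makes it an efficient dominating set of the graph on the whole
  type in which they are isolated.\<close>

lemma square_no_hole_graph:
  assumes G: "simple_graph G" "free_of (path_graph 6) G" "HHD_free G"
    and D: "efficient_dominating_set G D" and k: "k \<ge> 4"
  shows "\<not> hole (square (adj G)) c k"
proof -
  interpret P6_HHD_free "adj G" using P6_HHD_free_graph[OF G] .
  interpret P6_HHD_free_ed "adj G" "D \<union> - verts G"
  proof
    fix v
    show "\<exists>!d. d \<in> D \<union> - verts G \<and> (d = v \<or> adj G d v)"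
    proof (cases "v \<in> verts G")
      case True
      then have "\<exists>!d. d \<in> D \<and> (d = v \<or> adj G d v)"
        using D unfolding efficient_dominating_set_def dominates_def by blast
      moreover have "d \<in> verts G" if "d = v \<or> adj G d v" for d
        using that True adj_verts[OF G(1)] by blast
      ultimately show ?thesis by (metis ComplD Un_iff)
    next
      case False
      then have "v \<notin> D" using D unfolding efficient_dominating_set_def by blast
      moreover have "\<not> adj G d v" for d using False adj_verts[OF G(1)] by blast
      ultimately show ?thesis using False by auto
    qed
  qed
  show ?thesis by (rule square_no_hole[OF k])
qed

section \<open>Efficient domination as a maximum weight problem\<close>

definition nbhd :: "'a graph \<Rightarrow> 'a \<Rightarrow> 'a set" where
  "nbhd G v = {u \<in> verts G. dominates G v u}"

text \<open>Two different vertices are adjacent in the square exactly if some vertex is dominated by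
  both. So independence is the uniqueness of dominators, and covering is their existence.\<close>

lemma eds_iff_indep_square:
  assumes G: "simple_graph G"
  shows "efficient_dominating_set G D \<longleftrightarrow>
    D \<subseteq> verts G \<and> indep (square (adj G)) D \<and> (\<Union>v\<in>D. nbhd G v) = verts G"
proof -
  have *: "square (adj G) a b \<longleftrightarrow> (\<exists>u\<in>verts G. a \<noteq> b \<and> dominates G a u \<and> dominates G b u)"
    if "a \<in> verts G" "b \<in> verts G" for a b
  proof
    assume "square (adj G) a b"
    then consider "a \<noteq> b" "adj G a b" | m where "a \<noteq> b" "adj G a m" "adj G m b"
      unfolding square_def by blast
    then show "\<exists>u\<in>verts G. a \<noteq> b \<and> dominates G a u \<and> dominates G b u"
    proof cases
      case 1
      then show ?thesis using that unfolding dominates_def by blast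
    next
      case 2
      then show ?thesis using adj_verts[OF G 2(2)] adj_sym[OF 2(3)] unfolding dominates_def by blast
    qed
  next
    assume "\<exists>u\<in>verts G. a \<noteq> b \<and> dominates G a u \<and> dominates G b u"
    then show "square (adj G) a b" using adj_sym unfolding square_def dominates_def by metis
  qed
  show ?thesis
  proof (cases "D \<subseteq> verts G")
    case True
    have "(\<exists>!d. d \<in> D \<and> dominates G d v) \<longleftrightarrow> (\<exists>d\<in>D. dominates G d v) \<and>
      (\<forall>a\<in>D. \<forall>b\<in>D. dominates G a v \<longrightarrow> dominates G b v \<longrightarrow> a = b)" for v by auto
    then have "(\<forall>v\<in>verts G. \<exists>!d. d \<in> D \<and> dominates G d v) \<longleftrightarrow>
      (\<forall>v\<in>verts G. \<exists>d\<in>D. dominates G d v) \<and>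
      (\<forall>v\<in>verts G. \<forall>a\<in>D. \<forall>b\<in>D. dominates G a v \<longrightarrow> dominates G b v \<longrightarrow> a = b)"
      by (simp only: ball_conj_distrib)
    also have "\<dots> \<longleftrightarrow>
      (\<forall>v\<in>verts G. \<exists>d\<in>D. dominates G d v) \<and>
      (\<forall>a\<in>D. \<forall>b\<in>D. \<not> (\<exists>u\<in>verts G. a \<noteq> b \<and> dominates G a u \<and> dominates G b u))"
      by blast
    also have "\<dots> \<longleftrightarrow> (\<Union>v\<in>D. nbhd G v) = verts G \<and> indep (square (adj G)) D"
    proof -
      have "(\<forall>v\<in>verts G. \<exists>d\<in>D. dominates G d v) \<longleftrightarrow> (\<Union>v\<in>D. nbhd G v) = verts G"
        unfolding nbhd_def by auto
      moreover have "\<not> square (adj G) a b \<longleftrightarrow>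
        \<not> (\<exists>u\<in>verts G. a \<noteq> b \<and> dominates G a u \<and> dominates G b u)" if "a \<in> D" "b \<in> D" for a b
        using *[of a b] True that by blast
      ultimately show ?thesis unfolding indep_def by simp
    qed
    finally show ?thesis unfolding efficient_dominating_set_def using True by blast
  qed (simp add: efficient_dominating_set_def)
qed

lemma sum_card_nbhd:
  assumes G: "simple_graph G" and I: "indep (square (adj G)) I" "I \<subseteq> verts G"
  shows "(\<Sum>v\<in>I. card (nbhd G v)) = card (\<Union>v\<in>I. nbhd G v)"
proof (rule card_UN_disjoint[symmetric])
  have f: "finite (verts G)" using G by (simp add: simple_graph_def)
  show "finite I" using I(2) f finite_subset by blast
  show "\<forall>i\<in>I. finite (nbhd G i)" using f by (simp add: nbhd_def)
  show "\<forall>a\<in>I. \<forall>b\<in>I. a \<noteq> b \<longrightarrow> nbhd G a \<inter> nbhd G b = {}"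
  proof (intro ballI impI)
    fix a b assume ab: "a \<in> I" "b \<in> I" "a \<noteq> b"
    then have "\<not> square (adj G) a b" using I(1) unfolding indep_def by blast
    then show "nbhd G a \<inter> nbhd G b = {}"
      using ab(3) adj_sym[of _ _ G] unfolding nbhd_def dominates_def square_def by blast
  qed
qed

text \<open>In a simple graph the subtraction does not truncate at a vertex: \<open>v\<close>
  belongs to its own closed neighbourhood and \<open>w v\<close> is smaller than the factor. On an
  independent set of the square the closed neighbourhoods are disjoint, so the weights add up to the
  factor times the number of dominated vertices, minus the weight under \<open>w\<close>.\<close>

definition eds_weight :: "'a graph \<Rightarrow> ('a \<Rightarrow> nat) \<Rightarrow> 'a \<Rightarrow> nat" where
  "eds_weight G w v = Suc (sum w (verts G)) * card (nbhd G v) - w v"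

text \<open>The factor exceeds every possible weight, so that a heaviest independent set of the square
  dominates as many vertices as possible and, subject to this, has least weight under \<open>w\<close>.\<close>

lemma max_weight_indep_square:
  assumes G: "simple_graph G"
    and K: "indep (square (adj G)) K" "K \<subseteq> verts G"
    and max: "\<And>J. indep (square (adj G)) J \<Longrightarrow> J \<subseteq> verts G \<Longrightarrow>
      sum (eds_weight G w) J \<le> sum (eds_weight G w) K"
    and D0: "efficient_dominating_set G D0"
  shows "min_weight_eds G w K"
proof -
  define M n where "M = Suc (sum w (verts G))" and "n = card (verts G)"
  have f: "finite (verts G)" using G by (simp add: simple_graph_def)
  have W: "sum (eds_weight G w) I + sum w I = M * card (\<Union>v\<in>I. nbhd G v)"
    if I: "indep (square (adj G)) I" "I \<subseteq> verts G" for I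
  proof -
    have "eds_weight G w v + w v = M * card (nbhd G v)" if "v \<in> I" for v
    proof -
      have "v \<in> nbhd G v" using that I by (auto simp: nbhd_def dominates_def)
      then have "card (nbhd G v) \<ge> 1" using f by (simp add: card_gt_0_iff Suc_le_eq nbhd_def) blast
      moreover have "w v \<le> sum w (verts G)" using that I f by (simp add: member_le_sum subsetD)
      ultimately have "w v \<le> M * card (nbhd G v)"
        unfolding M_def by (metis le_SucI le_trans mult.commute mult_le_mono2 nat_mult_1_right)
      then show ?thesis by (simp add: eds_weight_def M_def)
    qed
    then have "sum (eds_weight G w) I + sum w I = (\<Sum>v\<in>I. M * card (nbhd G v))"
      by (simp add: sum.distrib[symmetric])
    then show ?thesis using sum_card_nbhd[OF G I] by (simp add: sum_distrib_left[symmetric])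
  qed
  have D: "sum (eds_weight G w) D + sum w D = M * n" "indep (square (adj G)) D" "D \<subseteq> verts G"
    if "efficient_dominating_set G D" for D
    using that W[of D] unfolding eds_iff_indep_square[OF G] n_def by auto
  have wle: "sum w I < M" if "I \<subseteq> verts G" for I
    using sum_mono2[OF f that, of w] by (simp add: M_def)
  have UV: "(\<Union>v\<in>K. nbhd G v) \<subseteq> verts G" by (auto simp: nbhd_def)
  have full: "(\<Union>v\<in>K. nbhd G v) = verts G"
  proof (rule ccontr)
    assume "(\<Union>v\<in>K. nbhd G v) \<noteq> verts G"
    then have "card (\<Union>v\<in>K. nbhd G v) < n" unfolding n_def using UV f by (metis psubsetI psubset_card_mono)
    then have "M * Suc (card (\<Union>v\<in>K. nbhd G v)) \<le> M * n" by (metis Suc_leI mult_le_mono2)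
    \<comment> \<open>A vertex left undominated costs \<open>M\<close>, more than the entire weight
      of \<open>D0\<close> under \<open>w\<close>.\<close>
    then have "M + (sum (eds_weight G w) K + sum w K) \<le> sum (eds_weight G w) D0 + sum w D0"
      using W[OF K] D(1)[OF D0] by simp
    then show False using max[OF D(2,3)[OF D0]] wle[OF D(3)[OF D0]] by simp
  qed
  have K': "efficient_dominating_set G K" unfolding eds_iff_indep_square[OF G] using K full by blast
  moreover have "sum w K \<le> sum w D'" if "efficient_dominating_set G D'" for D'
    using D(1)[OF K'] D(1)[OF that] max[OF D(2,3)[OF that]] by simp
  ultimately show ?thesis unfolding min_weight_eds_def by blast
qed

section \<open>Unit cost and logarithmic cost\<close>

text \<open>Unit cost is easy to bound for a given program; the passage to logarithmic cost is made
  once, for arbitrary programs.\<close>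

inductive steps :: "com \<Rightarrow> memory \<Rightarrow> nat \<Rightarrow> memory \<Rightarrow> bool" where
  steps_Skip: "steps Skip m 1 m"
| steps_Write: "steps (Write x i e) m 1 (m(x := (m x)(aval i m := aval e m)))"
| steps_Seq: "steps c m s m' \<Longrightarrow> steps d m' t m'' \<Longrightarrow> steps (Seq c d) m (s + t) m''"
| steps_CondTrue: "aval b m \<noteq> 0 \<Longrightarrow> steps c m t m' \<Longrightarrow> steps (Cond b c d) m (1 + t) m'"
| steps_CondFalse: "aval b m = 0 \<Longrightarrow> steps d m t m' \<Longrightarrow> steps (Cond b c d) m (1 + t) m'"
| steps_WhileFalse: "aval b m = 0 \<Longrightarrow> steps (While b c) m 1 m"
| steps_WhileTrue: "aval b m \<noteq> 0 \<Longrightarrow> steps c m s m' \<Longrightarrow> steps (While b c) m' t m'' \<Longrightarrow>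
    steps (While b c) m (1 + s + t) m''"

text \<open>Besides the number of operations this bounds the bits by which a value can exceed the
  numbers in memory, hence the bit length of constants. Since \<open>csize\<close> includes the
  expressions, one number controls both the cost and the growth caused by a step.\<close>

primrec asize :: "aexp \<Rightarrow> nat" where
  "asize (Const n) = 1 + floorlog 2 n"
| "asize (Read x e) = 1 + asize e"
| "asize (Plus a b) = 1 + asize a + asize b"
| "asize (Minus a b) = 1 + asize a + asize b"

primrec csize :: "com \<Rightarrow> nat" where
  "csize Skip = 1"
| "csize (Write x i e) = 1 + asize i + asize e"
| "csize (Seq c d) = csize c + csize d"
| "csize (Cond b c d) = 1 + asize b + csize c + csize d"
| "csize (While b c) = 1 + asize b + csize c"

definition bits_bound :: "nat \<Rightarrow> memory \<Rightarrow> bool" where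
  "bits_bound b m \<longleftrightarrow> (\<forall>x i. m x i < 2 ^ b)"

lemma aval_bound:
  assumes "bits_bound b m"
  shows "aval e m < 2 ^ (b + asize e)"
proof (induction e)
  case (Const n)
  have "n < 2 ^ floorlog 2 n" by (rule floorlog_leD) simp_all
  also have "\<dots> \<le> 2 ^ (b + asize (Const n))" by (rule power_increasing) simp_all
  finally show ?case by simp
next
  case (Read x e)
  have "m x (aval e m) < 2 ^ b" using assms by (simp add: bits_bound_def)
  also have "\<dots> \<le> 2 ^ (b + asize (Read x e))" by (rule power_increasing) simp_all
  finally show ?case by simp
next
  case (Plus d e)
  have le: "(2::nat) ^ (b + asize d) \<le> 2 ^ (b + asize d + asize e)"
    "(2::nat) ^ (b + asize e) \<le> 2 ^ (b + asize d + asize e)"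
    by (rule power_increasing; simp)+
  have eq: "(2::nat) ^ (b + asize (Plus d e)) = 2 ^ (b + asize d + asize e) + 2 ^ (b + asize d + asize e)"
    by (simp add: algebra_simps)
  show ?case using Plus le unfolding eq aval.simps by linarith
next
  case (Minus d e)
  have "(2::nat) ^ (b + asize d) \<le> 2 ^ (b + asize (Minus d e))" by (rule power_increasing) simp_all
  then show ?case using Minus(1) by simp
qed

lemma floorlog_aval:
  assumes "bits_bound b m" "asize e \<le> Z"
  shows "floorlog 2 (aval e m) \<le> b + Z"
  using floorlog_leI[OF aval_bound[OF assms(1), of e]] assms(2) by simp

lemma acost_bound:
  assumes "bits_bound b m" "asize e \<le> Z"
  shows "acost e m \<le> asize e * (1 + b + Z)"
  using assms(2)
proof (induction e)
  case (Const n)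
  then show ?case by simp
next
  case (Read x e)
  have "floorlog 2 (aval (Read x e) m) \<le> b + Z" by (rule floorlog_aval[OF assms(1) Read.prems])
  then show ?case using Read by simp
next
  case (Plus d e)
  have "floorlog 2 (aval (Plus d e) m) \<le> b + Z" by (rule floorlog_aval[OF assms(1) Plus.prems])
  then show ?case using Plus by (simp add: add_mult_distrib)
next
  case (Minus d e)
  have "floorlog 2 (aval (Minus d e) m) \<le> b + Z" by (rule floorlog_aval[OF assms(1) Minus.prems])
  then show ?case using Minus by (simp add: add_mult_distrib)
qed

lemma guard_cost:
  assumes "bits_bound b m" "1 + asize e \<le> Z"
  shows "1 + acost e m \<le> Z * (1 + b + Z)"
proof -
  have "1 + acost e m \<le> 1 + asize e * (1 + b + Z)"
    using acost_bound[OF assms(1), of e Z] assms(2) by simp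
  also have "\<dots> \<le> (1 + asize e) * (1 + b + Z)" by simp
  also have "\<dots> \<le> Z * (1 + b + Z)" using assms(2) by (intro mult_le_mono1)
  finally show ?thesis .
qed

lemma bits_bound_mono: "bits_bound b m \<Longrightarrow> b \<le> b' \<Longrightarrow> bits_bound b' m"
  unfolding bits_bound_def by (meson less_le_trans one_le_numeral power_increasing)

lemma cost_mono: "k * (Z * (1 + b + k * Z)) \<le> k * (Z * (1 + b' + k' * Z))"
  if "b + k * Z \<le> b' + k' * Z" for k Z b b' k' :: nat
  using that by (intro mult_le_mono2) simp

text \<open>Each step adds at most \<open>Z\<close> to the bit length of the numbers in memory.\<close>

lemma exec_of_steps:
  assumes "steps c m k m'" "csize c \<le> Z" "bits_bound b m"
  shows "\<exists>t. exec c m t m' \<and> t \<le> k * (Z * (1 + b + k * Z)) \<and> bits_bound (b + k * Z) m'"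
  using assms
proof (induction arbitrary: b rule: steps.induct)
  case (steps_Skip m)
  then show ?case using exec.Skip bits_bound_mono[OF steps_Skip(2), of "b + 1 * Z"] by fastforce
next
  case (steps_Write x i e m)
  have Z: "asize i \<le> Z" "asize e \<le> Z" using steps_Write by simp_all
  have "1 + acost i m + acost e m \<le> 1 + asize i * (1 + b + Z) + asize e * (1 + b + Z)"
    using acost_bound[OF steps_Write(2) Z(1)] acost_bound[OF steps_Write(2) Z(2)] by simp
  also have "\<dots> \<le> (1 + asize i + asize e) * (1 + b + Z)" by (simp add: algebra_simps)
  also have "\<dots> \<le> Z * (1 + b + Z)" using steps_Write(1) by (intro mult_le_mono1) simp
  finally have "1 + acost i m + acost e m \<le> 1 * (Z * (1 + b + 1 * Z))" by simp
  moreover have "bits_bound (b + 1 * Z) (m(x := (m x)(aval i m := aval e m)))"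
  proof -
    have "aval e m < 2 ^ (b + asize e)" by (rule aval_bound[OF steps_Write(2)])
    also have "\<dots> \<le> 2 ^ (b + Z)" using Z(2) by (intro power_increasing) simp_all
    finally show ?thesis using bits_bound_mono[OF steps_Write(2), of "b + Z"]
      unfolding bits_bound_def by simp
  qed
  ultimately show ?case using exec.Write by blast
next
  case (steps_Seq c m s m' d t m'')
  obtain t1 where t1: "exec c m t1 m'" "t1 \<le> s * (Z * (1 + b + s * Z))" "bits_bound (b + s * Z) m'"
    using steps_Seq.IH(1)[of b] steps_Seq.prems by auto
  obtain t2 where t2: "exec d m' t2 m''" "t2 \<le> t * (Z * (1 + (b + s * Z) + t * Z))"
    "bits_bound ((b + s * Z) + t * Z) m''"
    using steps_Seq.IH(2)[OF _ t1(3)] steps_Seq.prems by auto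
  have "t1 \<le> s * (Z * (1 + b + (s + t) * Z))"
    by (rule le_trans[OF t1(2) cost_mono]) (simp add: algebra_simps)
  moreover have "t2 \<le> t * (Z * (1 + b + (s + t) * Z))"
    by (rule le_trans[OF t2(2) cost_mono]) (simp add: algebra_simps)
  ultimately have "t1 + t2 \<le> s * (Z * (1 + b + (s + t) * Z)) + t * (Z * (1 + b + (s + t) * Z))"
    by (rule add_mono)
  then have "t1 + t2 \<le> (s + t) * (Z * (1 + b + (s + t) * Z))" by (simp only: add_mult_distrib)
  moreover have "bits_bound (b + (s + t) * Z) m''" using t2(3) by (simp add: algebra_simps)
  ultimately show ?case using exec.Seq[OF t1(1) t2(1)] by blast
next
  case (steps_CondTrue e m c t m' d)
  obtain t1 where t1: "exec c m t1 m'" "t1 \<le> t * (Z * (1 + b + t * Z))" "bits_bound (b + t * Z) m'"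
    using steps_CondTrue.IH[of b] steps_CondTrue.prems by auto
  have "1 + acost e m \<le> Z * (1 + b + Z)"
    using guard_cost[OF steps_CondTrue.prems(2)] steps_CondTrue.prems(1) by simp
  also have "\<dots> \<le> 1 * (Z * (1 + b + (1 + t) * Z))" by simp
  finally have "1 + acost e m + t1 \<le> 1 * (Z * (1 + b + (1 + t) * Z)) + t * (Z * (1 + b + (1 + t) * Z))"
    using le_trans[OF t1(2) cost_mono[of b t Z b "1 + t"]] by simp
  then have "1 + acost e m + t1 \<le> (1 + t) * (Z * (1 + b + (1 + t) * Z))" by (simp only: add_mult_distrib)
  moreover have "bits_bound (b + (1 + t) * Z) m'" by (rule bits_bound_mono[OF t1(3)]) simp
  ultimately show ?case using exec.CondTrue[OF steps_CondTrue.hyps(1) t1(1)] by blast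
next
  case (steps_CondFalse e m d t m' c)
  obtain t1 where t1: "exec d m t1 m'" "t1 \<le> t * (Z * (1 + b + t * Z))" "bits_bound (b + t * Z) m'"
    using steps_CondFalse.IH[of b] steps_CondFalse.prems by auto
  have "1 + acost e m \<le> Z * (1 + b + Z)"
    using guard_cost[OF steps_CondFalse.prems(2)] steps_CondFalse.prems(1) by simp
  also have "\<dots> \<le> 1 * (Z * (1 + b + (1 + t) * Z))" by simp
  finally have "1 + acost e m + t1 \<le> 1 * (Z * (1 + b + (1 + t) * Z)) + t * (Z * (1 + b + (1 + t) * Z))"
    using le_trans[OF t1(2) cost_mono[of b t Z b "1 + t"]] by simp
  then have "1 + acost e m + t1 \<le> (1 + t) * (Z * (1 + b + (1 + t) * Z))" by (simp only: add_mult_distrib)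
  moreover have "bits_bound (b + (1 + t) * Z) m'" by (rule bits_bound_mono[OF t1(3)]) simp
  ultimately show ?case using exec.CondFalse[OF steps_CondFalse.hyps(1) t1(1)] by blast
next
  case (steps_WhileFalse e m c)
  have "1 + acost e m \<le> 1 * (Z * (1 + b + 1 * Z))"
    using guard_cost[OF steps_WhileFalse.prems(2)] steps_WhileFalse.prems(1) by simp
  moreover have "bits_bound (b + 1 * Z) m" by (rule bits_bound_mono[OF steps_WhileFalse.prems(2)]) simp
  ultimately show ?case using exec.WhileFalse[OF steps_WhileFalse.hyps(1)] by blast
next
  case (steps_WhileTrue e m c s m' t m'')
  obtain t1 where t1: "exec c m t1 m'" "t1 \<le> s * (Z * (1 + b + s * Z))" "bits_bound (b + s * Z) m'"
    using steps_WhileTrue.IH(1)[of b] steps_WhileTrue.prems by auto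
  obtain t2 where t2: "exec (While e c) m' t2 m''" "t2 \<le> t * (Z * (1 + (b + s * Z) + t * Z))"
    "bits_bound ((b + s * Z) + t * Z) m''"
    using steps_WhileTrue.IH(2)[OF _ t1(3)] steps_WhileTrue.prems by auto
  let ?k = "1 + s + t"
  have "1 + acost e m \<le> Z * (1 + b + Z)"
    using guard_cost[OF steps_WhileTrue.prems(2)] steps_WhileTrue.prems(1) by simp
  also have "\<dots> \<le> 1 * (Z * (1 + b + ?k * Z))" by simp
  finally have t0: "1 + acost e m \<le> 1 * (Z * (1 + b + ?k * Z))" .
  have "t1 \<le> s * (Z * (1 + b + ?k * Z))"
    by (rule le_trans[OF t1(2) cost_mono]) (simp add: algebra_simps)
  moreover have "t2 \<le> t * (Z * (1 + b + ?k * Z))"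
    by (rule le_trans[OF t2(2) cost_mono]) (simp add: algebra_simps)
  ultimately have "1 + acost e m + t1 + t2 \<le> 1 * (Z * (1 + b + ?k * Z)) + s * (Z * (1 + b + ?k * Z)) +
      t * (Z * (1 + b + ?k * Z))"
    by (intro add_mono t0)
  then have "1 + acost e m + t1 + t2 \<le> ?k * (Z * (1 + b + ?k * Z))" by (simp only: add_mult_distrib)
  moreover have "bits_bound (b + ?k * Z) m''" by (rule bits_bound_mono[OF t2(3)]) (simp add: algebra_simps)
  ultimately show ?case using exec.WhileTrue[OF steps_WhileTrue.hyps(1) t1(1) t2(1)] by blast
qed

lemma input_size_bounds:
  "bits_bound (input_size xs) (input_memory xs)" "length xs \<le> input_size xs"
proof -
  show len: "length xs \<le> input_size xs"
    unfolding input_size_def by (induction xs) auto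
  have el: "floorlog 2 x \<le> input_size xs" if "x \<in> set xs" for x
    using that unfolding input_size_def by (induction xs) auto
  have "input_memory xs x i < 2 ^ input_size xs" for x i
  proof (cases "x = ''in'' \<and> i \<le> length xs")
    case True
    show ?thesis
    proof (cases i)
      case 0
      have "length xs < 2 ^ length xs" by simp
      also have "\<dots> \<le> 2 ^ input_size xs" using len by (intro power_increasing) simp_all
      finally show ?thesis using 0 True by (simp add: input_memory_def)
    next
      case (Suc j)
      then have "xs ! j \<in> set xs" using True by simp
      then have "xs ! j < 2 ^ input_size xs" using floorlog_leD[OF el] by simp
      then show ?thesis using Suc True by (simp add: input_memory_def)
    qed
  qed (auto simp: input_memory_def)
  then show "bits_bound (input_size xs) (input_memory xs)" by (simp add: bits_bound_def)
qed

lemma poly_nat_mono: "a \<le> b \<Longrightarrow> poly p a \<le> poly p b" for p :: "nat poly"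
  by (induction p) (auto intro: add_mono mult_mono)

lemma poly_time_solvableI:
  fixes q :: "nat poly"
  assumes "\<And>x. x \<in> I \<Longrightarrow> \<exists>k m. steps c (input_memory (enc x)) k m \<and>
    k \<le> poly q (input_size (enc x)) \<and> ans x (output_list m)"
  shows "poly_time_solvable I enc ans"
proof -
  define Z where "Z = csize c"
  \<comment> \<open>The bound of \<open>exec_of_steps\<close> as a polynomial: \<open>q\<close>
    replaces the number of steps, and the indeterminate replaces the initial bit length.\<close>
  define p where "p = q * ([:Z:] * ([:1, 1:] + q * [:Z:]))"
  have "\<exists>t m. exec c (input_memory (enc x)) t m \<and> t \<le> poly p (input_size (enc x)) \<and> ans x (output_list m)"
    if x: "x \<in> I" for x
  proof -
    let ?b = "input_size (enc x)"
    obtain k m where m: "steps c (input_memory (enc x)) k m" "k \<le> poly q ?b" "ans x (output_list m)"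
      using assms[OF x] by blast
    then obtain t where t: "exec c (input_memory (enc x)) t m" "t \<le> k * (Z * (1 + ?b + k * Z))"
      using exec_of_steps[OF m(1) _ input_size_bounds(1)] by (auto simp: Z_def)
    note t(2)
    also have "k * (Z * (1 + ?b + k * Z)) \<le> poly q ?b * (Z * (1 + ?b + poly q ?b * Z))"
      using m(2) by (intro mult_le_mono add_mono) simp_all
    also have "\<dots> = poly p ?b" by (simp add: p_def algebra_simps)
    finally show ?thesis using t(1) m(3) by blast
  qed
  then show ?thesis unfolding poly_time_solvable_def by blast
qed

section \<open>A language of polynomial-time programs\<close>

text \<open>
  A language of nested loops whose bound is the first number of the input. Since this number
  cannot be overwritten, programs are total and run in polynomial time by construction.
\<close>

datatype ex = Num nat | Arr string ex | Add ex ex | Sub ex ex | Ite ex ex ex | Sum string ex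

datatype st = Asg string ex ex | Sq st st | If ex st st | For string st

abbreviation bind :: "string \<Rightarrow> nat \<Rightarrow> memory \<Rightarrow> memory" where
  "bind x i m \<equiv> m(x := (m x)(0 := i))"

primrec ev :: "ex \<Rightarrow> memory \<Rightarrow> nat" where
  "ev (Num n) m = n"
| "ev (Arr x e) m = m x (ev e m)"
| "ev (Add a b) m = ev a m + ev b m"
| "ev (Sub a b) m = ev a m - ev b m"
| "ev (Ite c a b) m = (if ev c m \<noteq> 0 then ev a m else ev b m)"
| "ev (Sum x e) m = (\<Sum>i<m ''in'' 1. ev e (bind x i m))"

text \<open>After a loop its variable holds the bound, because that is what the compiled while-loop
  leaves behind. The variable of a \<open>Sum\<close>, in contrast, is local.\<close>

primrec sem :: "st \<Rightarrow> memory \<Rightarrow> memory" where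
  "sem (Asg x i e) m = m(x := (m x)(ev i m := ev e m))"
| "sem (Sq s t) m = sem t (sem s m)"
| "sem (If c s t) m = (if ev c m \<noteq> 0 then sem s m else sem t m)"
| "sem (For x s) m = bind x (m ''in'' 1) (fold (\<lambda>j m. sem s (bind x j m)) [0..<m ''in'' 1] m)"

text \<open>Names starting with \<open>#\<close> are reserved for the intermediate results of expressions.\<close>

definition user :: "string \<Rightarrow> bool" where
  "user x \<longleftrightarrow> take 1 x \<noteq> ''#''"

definition tmp :: "nat \<Rightarrow> string" where
  "tmp k = CHR ''#'' # replicate k CHR ''t''"

primrec written :: "st \<Rightarrow> string set" where
  "written (Asg x i e) = {x}"
| "written (Sq s t) = written s \<union> written t"
| "written (If c s t) = written s \<union> written t"
| "written (For x s) = insert x (written s)"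

primrec wf_ex :: "ex \<Rightarrow> bool" where
  "wf_ex (Num n) = True"
| "wf_ex (Arr x e) = (user x \<and> wf_ex e)"
| "wf_ex (Add a b) = (wf_ex a \<and> wf_ex b)"
| "wf_ex (Sub a b) = (wf_ex a \<and> wf_ex b)"
| "wf_ex (Ite c a b) = (wf_ex c \<and> wf_ex a \<and> wf_ex b)"
| "wf_ex (Sum x e) = (user x \<and> x \<noteq> ''in'' \<and> wf_ex e)"

primrec wf_st :: "st \<Rightarrow> bool" where
  "wf_st (Asg x i e) = (user x \<and> x \<noteq> ''in'' \<and> wf_ex i \<and> wf_ex e)"
| "wf_st (Sq s t) = (wf_st s \<and> wf_st t)"
| "wf_st (If c s t) = (wf_ex c \<and> wf_st s \<and> wf_st t)"
| "wf_st (For x s) = (user x \<and> x \<noteq> ''in'' \<and> x \<notin> written s \<and> wf_st s)"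

abbreviation get :: "string \<Rightarrow> aexp" where
  "get x \<equiv> Read x (Const 0)"

abbreviation set_var :: "string \<Rightarrow> aexp \<Rightarrow> com" where
  "set_var x e \<equiv> Write x (Const 0) e"

abbreviation remaining :: "string \<Rightarrow> aexp" where
  "remaining x \<equiv> Minus (Read ''in'' (Const 1)) (get x)"

text \<open>A stack discipline: the value is delivered in \<open>tmp k\<close>, and the net effect
  is confined to \<open>tmp j\<close> with \<open>j \<ge> k\<close>. A \<open>Sum\<close>
  accumulates in \<open>tmp k\<close>, saves the outer value of its variable in
  \<open>tmp (Suc k)\<close> and evaluates the summand from \<open>tmp (Suc (Suc k))\<close>
  on.\<close>

primrec cmp_ex :: "ex \<Rightarrow> nat \<Rightarrow> com" where
  "cmp_ex (Num n) k = set_var (tmp k) (Const n)"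
| "cmp_ex (Arr x e) k = Seq (cmp_ex e k) (set_var (tmp k) (Read x (get (tmp k))))"
| "cmp_ex (Add a b) k = Seq (cmp_ex a k) (Seq (cmp_ex b (Suc k))
     (set_var (tmp k) (Plus (get (tmp k)) (get (tmp (Suc k))))))"
| "cmp_ex (Sub a b) k = Seq (cmp_ex a k) (Seq (cmp_ex b (Suc k))
     (set_var (tmp k) (Minus (get (tmp k)) (get (tmp (Suc k))))))"
| "cmp_ex (Ite c a b) k = Seq (cmp_ex c k) (Cond (get (tmp k)) (cmp_ex a k) (cmp_ex b k))"
| "cmp_ex (Sum x e) k = Seq (set_var (tmp k) (Const 0)) (Seq (set_var (tmp (Suc k)) (get x))
     (Seq (set_var x (Const 0)) (Seq
       (While (remaining x) (Seq (cmp_ex e (Suc (Suc k)))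
         (Seq (set_var (tmp k) (Plus (get (tmp k)) (get (tmp (Suc (Suc k))))))
           (set_var x (Plus (get x) (Const 1))))))
       (set_var x (get (tmp (Suc k)))))))"

primrec cmp_st :: "st \<Rightarrow> com" where
  "cmp_st (Asg x i e) = Seq (cmp_ex i 0) (Seq (cmp_ex e 1) (Write x (get (tmp 0)) (get (tmp 1))))"
| "cmp_st (Sq s t) = Seq (cmp_st s) (cmp_st t)"
| "cmp_st (If c s t) = Seq (cmp_ex c 0) (Cond (get (tmp 0)) (cmp_st s) (cmp_st t))"
| "cmp_st (For x s) = Seq (set_var x (Const 0))
     (While (remaining x) (Seq (cmp_st s) (set_var x (Plus (get x) (Const 1)))))"

text \<open>The indeterminate stands for the loop bound. A round of a \<open>Sum\<close> adds the
  guard and two assignments to the summand; the 5 counts three initial assignments, the failing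
  guard and the restoration of the variable.\<close>

primrec time_ex :: "ex \<Rightarrow> nat poly" where
  "time_ex (Num n) = 1"
| "time_ex (Arr x e) = time_ex e + 1"
| "time_ex (Add a b) = time_ex a + time_ex b + 1"
| "time_ex (Sub a b) = time_ex a + time_ex b + 1"
| "time_ex (Ite c a b) = time_ex c + time_ex a + time_ex b + 1"
| "time_ex (Sum x e) = [:0, 1:] * (time_ex e + 3) + 5"

primrec time_st :: "st \<Rightarrow> nat poly" where
  "time_st (Asg x i e) = time_ex i + time_ex e + 1"
| "time_st (Sq s t) = time_st s + time_st t"
| "time_st (If c s t) = time_ex c + time_st s + time_st t + 1"
| "time_st (For x s) = [:0, 1:] * (time_st s + 2) + 2"

section \<open>Correctness and running time of the compiled programs\<close>

lemma tmp_eq [simp]: "tmp i = tmp j \<longleftrightarrow> i = j"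
  unfolding tmp_def by (metis length_replicate list.inject)

lemma user_not_tmp: "user x \<Longrightarrow> x \<noteq> tmp k"
  by (auto simp: user_def tmp_def)

lemma user_in [simp]: "user ''in''"
  by (simp add: user_def)

definition agree :: "nat \<Rightarrow> memory \<Rightarrow> memory \<Rightarrow> bool" where
  "agree k m m' \<longleftrightarrow> (\<forall>x. (\<forall>j\<ge>k. x \<noteq> tmp j) \<longrightarrow> m' x = m x)"

lemma agree_user: "agree k m m' \<Longrightarrow> user x \<Longrightarrow> m' x = m x"
  unfolding agree_def using user_not_tmp by blast

lemma agree_tmp: "agree k m m' \<Longrightarrow> j < k \<Longrightarrow> m' (tmp j) = m (tmp j)"
  unfolding agree_def by simp

lemma agree_trans: "agree k m m' \<Longrightarrow> agree k' m' m'' \<Longrightarrow> k \<le> k' \<Longrightarrow> agree k m m''"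
  unfolding agree_def by (metis order.trans)

lemma agree_update: "agree k m m' \<Longrightarrow> k \<le> j \<Longrightarrow> agree k m (m'(tmp j := f))"
  unfolding agree_def by simp

lemma ev_cong:
  assumes "wf_ex e" "\<And>x. user x \<Longrightarrow> m x = m' x"
  shows "ev e m = ev e m'"
  using assms
proof (induction e arbitrary: m m')
  case (Sum x e)
  have "ev e (bind x i m) = ev e (bind x i m')" for i
    using Sum by (intro Sum.IH) auto
  then show ?case using Sum.prems(2)[OF user_in] by simp
next
  case (Ite c a b)
  have "ev c m = ev c m'" "ev a m = ev a m'" "ev b m = ev b m'"
    using Ite.prems Ite.IH[of m m'] by simp_all
  then show ?case by simp
next
  case (Add a b)
  have "ev a m = ev a m'" "ev b m = ev b m'"
    using Add.prems Add.IH[of m m'] by simp_all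
  then show ?case by simp
next
  case (Sub a b)
  have "ev a m = ev a m'" "ev b m = ev b m'"
    using Sub.prems Sub.IH[of m m'] by simp_all
  then show ?case by simp
next
  case (Arr x e)
  have "ev e m = ev e m'" "m x = m' x"
    using Arr.prems Arr.IH[of m m'] by simp_all
  then show ?case by simp
qed simp

text \<open>Guards of compiled loops evaluate to the number of rounds still to come, so the guard is
  itself the termination measure.\<close>

lemma steps_while_count:
  assumes body: "\<And>i m. i < n \<Longrightarrow> P i m \<Longrightarrow> \<exists>s m'. steps c m s m' \<and> s \<le> B \<and> P (Suc i) m'"
    and guard: "\<And>i m. i \<le> n \<Longrightarrow> P i m \<Longrightarrow> aval g m = n - i"
  shows "i \<le> n \<Longrightarrow> P i m \<Longrightarrow> \<exists>s m'. steps (While g c) m s m' \<and> s \<le> 1 + (n - i) * (B + 1) \<and> P n m'"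
proof (induction "n - i" arbitrary: i m)
  case 0
  then have "i = n" by simp
  moreover have "steps (While g c) m 1 m"
    by (rule steps_WhileFalse) (use guard[OF 0(2,3)] 0(1) in simp)
  ultimately show ?case using 0 by (intro exI[of _ 1] exI[of _ m]) simp
next
  case (Suc d)
  have lt: "i < n" using Suc(2) by simp
  have d: "d = n - Suc i" using Suc(2) by simp
  have g: "aval g m \<noteq> 0" using guard[OF Suc(3,4)] lt by simp
  obtain s m1 where 1: "steps c m s m1" "s \<le> B" "P (Suc i) m1" using body[OF lt Suc(4)] by blast
  obtain t m2 where 2: "steps (While g c) m1 t m2" "t \<le> 1 + (n - Suc i) * (B + 1)" "P n m2"
    using Suc(1)[OF d _ 1(3)] lt by (meson Suc_leI)
  have "n - i = Suc (n - Suc i)" using lt by simp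
  then have "1 + s + t \<le> 1 + (n - i) * (B + 1)" using 1(2) 2(2) by simp
  then show ?case using steps_WhileTrue[OF g 1(1) 2(1)] 2(3) by blast
qed

lemma steps_set_var: "steps (set_var x e) m 1 (bind x (aval e m) m)"
  using steps_Write[of x "Const 0" e m] by simp

lemma cmp_ex_witness:
  "steps c m s m' \<Longrightarrow> s \<le> B \<Longrightarrow> agree k m m' \<Longrightarrow> m' (tmp k) 0 = v \<Longrightarrow>
   \<exists>s m'. steps c m s m' \<and> s \<le> B \<and> agree k m m' \<and> m' (tmp k) 0 = v"
  by blast

lemma cmp_st_witness:
  "steps c m s m' \<Longrightarrow> s \<le> B \<Longrightarrow> \<forall>x. user x \<longrightarrow> m' x = m0 x \<Longrightarrow>
   \<exists>s m'. steps c m s m' \<and> s \<le> B \<and> (\<forall>x. user x \<longrightarrow> m' x = m0 x)"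
  by blast

lemma steps_cmp_ex:
  assumes "wf_ex e"
  shows "\<exists>s m'. steps (cmp_ex e k) m s m' \<and> s \<le> poly (time_ex e) (m ''in'' 1) \<and> agree k m m' \<and>
    m' (tmp k) 0 = ev e m"
  using assms
proof (induction e arbitrary: k m)
  case (Num n)
  have "agree k m (bind (tmp k) n m)" unfolding agree_def by simp
  moreover have st: "steps (cmp_ex (Num n) k) m 1 (bind (tmp k) n m)"
    using steps_set_var[of "tmp k" "Const n" m] by simp
  ultimately show ?case by (intro cmp_ex_witness[OF st]) simp_all
next
  case (Arr x e)
  then obtain s m1 where 1: "steps (cmp_ex e k) m s m1" "s \<le> poly (time_ex e) (m ''in'' 1)"
    "agree k m m1" "m1 (tmp k) 0 = ev e m" by (metis wf_ex.simps(2))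
  have "agree k m (bind (tmp k) (m1 x (ev e m)) m1)" using 1(3) by (rule agree_update) simp
  moreover have "m1 x = m x" using agree_user[OF 1(3)] Arr.prems by simp
  moreover have st: "steps (cmp_ex (Arr x e) k) m (s + 1) (bind (tmp k) (m1 x (ev e m)) m1)"
    using steps_Seq[OF 1(1) steps_set_var[of "tmp k" "Read x (get (tmp k))" m1]] 1(4) by simp
  ultimately show ?case using 1(2) by (intro cmp_ex_witness[OF st]) simp_all
next
  case (Add a b)
  then obtain s m1 where 1: "steps (cmp_ex a k) m s m1" "s \<le> poly (time_ex a) (m ''in'' 1)"
    "agree k m m1" "m1 (tmp k) 0 = ev a m" by (metis wf_ex.simps(3))
  obtain t m2 where 2: "steps (cmp_ex b (Suc k)) m1 t m2" "t \<le> poly (time_ex b) (m1 ''in'' 1)"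
    "agree (Suc k) m1 m2" "m2 (tmp (Suc k)) 0 = ev b m1" using Add by (metis wf_ex.simps(3))
  have in1: "m1 ''in'' = m ''in''" by (rule agree_user[OF 1(3)]) simp
  have b: "ev b m1 = ev b m" using Add.prems agree_user[OF 1(3)] by (intro ev_cong) auto
  let ?m = "bind (tmp k) (ev a m + ev b m) m2"
  have a: "m2 (tmp k) 0 = ev a m" using agree_tmp[OF 2(3)] 1(4) by simp
  have "agree k m ?m" by (rule agree_update[OF agree_trans[OF 1(3) 2(3)]]) simp_all
  moreover have st: "steps (cmp_ex (Add a b) k) m (s + (t + 1)) ?m"
    using steps_Seq[OF 1(1) steps_Seq[OF 2(1) steps_set_var[of "tmp k" "Plus (get (tmp k)) (get (tmp (Suc k)))" m2]]]
      a 2(4) b by simp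
  ultimately show ?case using 1(2) 2(2) in1 by (intro cmp_ex_witness[OF st]) simp_all
next
  case (Sub a b)
  then obtain s m1 where 1: "steps (cmp_ex a k) m s m1" "s \<le> poly (time_ex a) (m ''in'' 1)"
    "agree k m m1" "m1 (tmp k) 0 = ev a m" by (metis wf_ex.simps(4))
  obtain t m2 where 2: "steps (cmp_ex b (Suc k)) m1 t m2" "t \<le> poly (time_ex b) (m1 ''in'' 1)"
    "agree (Suc k) m1 m2" "m2 (tmp (Suc k)) 0 = ev b m1" using Sub by (metis wf_ex.simps(4))
  have in1: "m1 ''in'' = m ''in''" by (rule agree_user[OF 1(3)]) simp
  have b: "ev b m1 = ev b m" using Sub.prems agree_user[OF 1(3)] by (intro ev_cong) auto
  let ?m = "bind (tmp k) (ev a m - ev b m) m2"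
  have a: "m2 (tmp k) 0 = ev a m" using agree_tmp[OF 2(3)] 1(4) by simp
  have "agree k m ?m" by (rule agree_update[OF agree_trans[OF 1(3) 2(3)]]) simp_all
  moreover have st: "steps (cmp_ex (Sub a b) k) m (s + (t + 1)) ?m"
    using steps_Seq[OF 1(1) steps_Seq[OF 2(1) steps_set_var[of "tmp k" "Minus (get (tmp k)) (get (tmp (Suc k)))" m2]]]
      a 2(4) b by simp
  ultimately show ?case using 1(2) 2(2) in1 by (intro cmp_ex_witness[OF st]) simp_all
next
  case (Ite c a b)
  then obtain s m1 where 1: "steps (cmp_ex c k) m s m1" "s \<le> poly (time_ex c) (m ''in'' 1)"
    "agree k m m1" "m1 (tmp k) 0 = ev c m" by (metis wf_ex.simps(5))
  have in1: "m1 ''in'' = m ''in''" by (rule agree_user[OF 1(3)]) simp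
  have ev1: "ev e m1 = ev e m" if "wf_ex e" for e
    using that agree_user[OF 1(3)] by (intro ev_cong) auto
  show ?case
  proof (cases "ev c m = 0")
    case False
    obtain t m2 where 2: "steps (cmp_ex a k) m1 t m2" "t \<le> poly (time_ex a) (m1 ''in'' 1)"
      "agree k m1 m2" "m2 (tmp k) 0 = ev a m1" using Ite by (metis wf_ex.simps(5))
    have st: "steps (cmp_ex (Ite c a b) k) m (s + (1 + t)) m2"
      using steps_Seq[OF 1(1) steps_CondTrue[OF _ 2(1)]] 1(4) False by simp
    then show ?thesis using 1(2) 2 in1 ev1[of a] Ite.prems False agree_trans[OF 1(3) 2(3)]
      by (intro cmp_ex_witness[OF st]) simp_all
  next
    case True
    obtain t m2 where 2: "steps (cmp_ex b k) m1 t m2" "t \<le> poly (time_ex b) (m1 ''in'' 1)"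
      "agree k m1 m2" "m2 (tmp k) 0 = ev b m1" using Ite by (metis wf_ex.simps(5))
    have st: "steps (cmp_ex (Ite c a b) k) m (s + (1 + t)) m2"
      using steps_Seq[OF 1(1) steps_CondFalse[OF _ 2(1)]] 1(4) True by simp
    then show ?thesis using 1(2) 2 in1 ev1[of b] Ite.prems True agree_trans[OF 1(3) 2(3)]
      by (intro cmp_ex_witness[OF st]) simp_all
  qed
next
  case (Sum x e)
  have wf: "user x" "x \<noteq> ''in''" "wf_ex e" using Sum.prems by auto
  have xt: "x \<noteq> tmp j" "tmp j \<noteq> x" "tmp j \<noteq> ''in''" "''in'' \<noteq> tmp j" for j
    using user_not_tmp[OF wf(1)] user_not_tmp[OF user_in] by metis+
  define n where "n = m ''in'' 1"
  define B where "B = poly (time_ex e) n"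
  define body where "body = Seq (cmp_ex e (Suc (Suc k)))
         (Seq (set_var (tmp k) (Plus (get (tmp k)) (get (tmp (Suc (Suc k))))))
           (set_var x (Plus (get x) (Const 1))))"
  \<comment> \<open>Comparing with \<open>m\<close> after rebinding \<open>x\<close> to
    \<open>i\<close> makes the summand see the memory prescribed by \<open>ev\<close>. The
    accumulator and the saved value of \<open>x\<close> survive because the summand works above
    them.\<close>
  define P where "P = (\<lambda>i m'. agree k (bind x i m) m' \<and> m' (tmp (Suc k)) 0 = m x 0 \<and>
     m' (tmp k) 0 = (\<Sum>j<i. ev e (bind x j m)))"
  have P_in: "m' ''in'' = m ''in''" "m' x 0 = i" if "P i m'" for i m'
    using agree_user[of k "bind x i m" m' "''in''"] agree_user[of k "bind x i m" m' x] that wf(1,2)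
    unfolding P_def by auto
  have guard: "aval (remaining x) m' = n - i" if "P i m'" for i m'
    using P_in[OF that] by (simp add: n_def)
  have step: "\<exists>s m''. steps body m' s m'' \<and> s \<le> B + 2 \<and> P (Suc i) m''" if P: "P i m'" for i m'
  proof -
    have ag: "agree k (bind x i m) m'" using P by (simp add: P_def)
    obtain s m1 where 1: "steps (cmp_ex e (Suc (Suc k))) m' s m1" "s \<le> poly (time_ex e) (m' ''in'' 1)"
      "agree (Suc (Suc k)) m' m1" "m1 (tmp (Suc (Suc k))) 0 = ev e m'" using Sum.IH[OF wf(3)] by metis
    have ev: "ev e m' = ev e (bind x i m)" using agree_user[OF ag] wf(3) by (intro ev_cong) auto
    have t: "m1 (tmp k) = m' (tmp k)" "m1 (tmp (Suc k)) = m' (tmp (Suc k))"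
      using agree_tmp[OF 1(3)] by auto
    have m1x: "m1 x 0 = i" using agree_user[OF 1(3) wf(1)] P_in(2)[OF P] by simp
    let ?m1 = "bind (tmp k) (\<Sum>j<Suc i. ev e (bind x j m)) m1"
    let ?m2 = "bind x (Suc i) ?m1"
    have m1: "steps (set_var (tmp k) (Plus (get (tmp k)) (get (tmp (Suc (Suc k)))))) m1 1 ?m1"
      using steps_set_var[of "tmp k" "Plus (get (tmp k)) (get (tmp (Suc (Suc k))))" m1] t 1(4) ev P
      unfolding P_def by simp
    have m2: "steps (set_var x (Plus (get x) (Const 1))) ?m1 1 ?m2"
      using steps_set_var[of x "Plus (get x) (Const 1)" ?m1] m1x xt by simp
    have "agree k (bind x (Suc i) m) ?m2"
      unfolding agree_def
    proof (intro allI impI)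
      fix y assume y: "\<forall>j\<ge>k. y \<noteq> tmp j"
      then have "m1 y = bind x i m y" using agree_trans[OF ag 1(3)] unfolding agree_def by simp
      then show "?m2 y = bind x (Suc i) m y" using y xt by auto
    qed
    then have "P (Suc i) ?m2" using P t xt unfolding P_def by simp
    moreover have "s + (1 + 1) \<le> B + 2" using 1(2) P_in[OF P] by (simp add: B_def n_def)
    ultimately show ?thesis using steps_Seq[OF 1(1) steps_Seq[OF m1 m2]] unfolding body_def by blast
  qed
  let ?m1 = "bind (tmp k) 0 m" let ?m2 = "bind (tmp (Suc k)) (m x 0) ?m1" let ?m3 = "bind x 0 ?m2"
  have s1: "steps (set_var (tmp k) (Const 0)) m 1 ?m1"
    using steps_set_var[of "tmp k" "Const 0" m] by simp
  have s2: "steps (set_var (tmp (Suc k)) (get x)) ?m1 1 ?m2"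
    using steps_set_var[of "tmp (Suc k)" "get x" ?m1] xt by simp
  have s3: "steps (set_var x (Const 0)) ?m2 1 ?m3"
    using steps_set_var[of x "Const 0" ?m2] by simp
  have "P 0 ?m3" using xt unfolding P_def agree_def by auto
  then obtain s m4 where 4: "steps (While (remaining x) body) ?m3 s m4" "s \<le> 1 + n * (B + 3)" "P n m4"
    using steps_while_count[of n P body "B + 2" "remaining x" 0 ?m3] step guard by (auto simp: eval_nat_numeral)
  let ?m5 = "bind x (m x 0) m4"
  have s5: "steps (set_var x (get (tmp (Suc k)))) m4 1 ?m5"
    using steps_set_var[of x "get (tmp (Suc k))" m4] 4(3) unfolding P_def by simp
  have "agree k m ?m5"
    using 4(3) unfolding P_def agree_def by auto
  moreover have "?m5 (tmp k) 0 = ev (Sum x e) m" using 4(3) xt unfolding P_def n_def by simp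
  moreover have st: "steps (cmp_ex (Sum x e) k) m (1 + (1 + (1 + (s + 1)))) ?m5"
    using steps_Seq[OF s1 steps_Seq[OF s2 steps_Seq[OF s3 steps_Seq[OF 4(1) s5]]]]
    unfolding body_def by simp
  moreover have "1 + (1 + (1 + (s + 1))) \<le> poly (time_ex (Sum x e)) (m ''in'' 1)"
    using 4(2) by (simp add: B_def n_def)
  ultimately show ?case by blast
qed

lemma sem_frame: "x \<notin> written s \<Longrightarrow> sem s m x = m x"
proof (induction s arbitrary: m)
  case (For y s)
  have "fold (\<lambda>j m. sem s (bind y j m)) js m x = m x" for js
    by (induction js arbitrary: m) (use For in auto)
  then show ?case using For.prems by simp
qed auto

lemma wf_st_in: "wf_st s \<Longrightarrow> ''in'' \<notin> written s"
  by (induction s) auto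

lemma sem_in: "wf_st s \<Longrightarrow> sem s m ''in'' = m ''in''"
  using sem_frame wf_st_in by blast

text \<open>A simulation: \<open>m0\<close> belongs to the abstract semantics and \<open>m\<close>
  to the machine. They may differ in the reserved arrays, which keep leftovers of earlier
  expressions.\<close>

lemma steps_cmp_st:
  assumes "wf_st s" "\<And>x. user x \<Longrightarrow> m x = m0 x"
  shows "\<exists>k m'. steps (cmp_st s) m k m' \<and> k \<le> poly (time_st s) (m0 ''in'' 1) \<and>
    (\<forall>x. user x \<longrightarrow> m' x = sem s m0 x)"
  using assms
proof (induction s arbitrary: m m0)
  case (Asg x i e)
  obtain k1 m1 where 1: "steps (cmp_ex i 0) m k1 m1" "k1 \<le> poly (time_ex i) (m ''in'' 1)"
    "agree 0 m m1" "m1 (tmp 0) 0 = ev i m" using steps_cmp_ex[of i 0 m] Asg.prems(1) by auto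
  obtain k2 m2 where 2: "steps (cmp_ex e 1) m1 k2 m2" "k2 \<le> poly (time_ex e) (m1 ''in'' 1)"
    "agree 1 m1 m2" "m2 (tmp 1) 0 = ev e m1" using steps_cmp_ex[of e 1 m1] Asg.prems(1) by auto
  have u: "m1 y = m0 y" "m2 y = m0 y" if "user y" for y
    using agree_user[OF 1(3) that] agree_user[OF 2(3) that] Asg.prems(2)[OF that] by auto
  have e: "ev i m = ev i m0" "ev e m1 = ev e m0"
    using Asg.prems u by (auto intro!: ev_cong)
  let ?m = "m2(x := (m2 x)(ev i m0 := ev e m0))"
  have "m2 (tmp 0) 0 = ev i m0" using agree_tmp[OF 2(3), of 0] 1(4) e by simp
  then have st: "steps (cmp_st (Asg x i e)) m (k1 + (k2 + 1)) ?m"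
    using steps_Seq[OF 1(1) steps_Seq[OF 2(1) steps_Write[of x "get (tmp 0)" "get (tmp 1)" m2]]] 2(4) e
    by simp
  moreover have "\<forall>y. user y \<longrightarrow> ?m y = sem (Asg x i e) m0 y" using u Asg.prems by auto
  moreover have "k1 + (k2 + 1) \<le> poly (time_st (Asg x i e)) (m0 ''in'' 1)"
    using 1(2) 2(2) u(1)[OF user_in] Asg.prems(2)[OF user_in] by simp
  ultimately show ?case by blast
next
  case (Sq s t)
  obtain k1 m1 where 1: "steps (cmp_st s) m k1 m1" "k1 \<le> poly (time_st s) (m0 ''in'' 1)"
    "\<forall>x. user x \<longrightarrow> m1 x = sem s m0 x" using Sq.IH(1)[of m m0] Sq.prems by auto
  obtain k2 m2 where 2: "steps (cmp_st t) m1 k2 m2" "k2 \<le> poly (time_st t) (sem s m0 ''in'' 1)"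
    "\<forall>x. user x \<longrightarrow> m2 x = sem t (sem s m0) x" using Sq.IH(2)[of m1 "sem s m0"] Sq.prems(1) 1(3) by auto
  have "k1 + k2 \<le> poly (time_st (Sq s t)) (m0 ''in'' 1)"
    using 1(2) 2(2) sem_in Sq.prems(1) by simp
  moreover have st: "steps (cmp_st (Sq s t)) m (k1 + k2) m2" using steps_Seq[OF 1(1) 2(1)] by simp
  ultimately show ?case using 2(3) by (intro cmp_st_witness[OF st]) simp_all
next
  case (If c s t)
  obtain k1 m1 where 1: "steps (cmp_ex c 0) m k1 m1" "k1 \<le> poly (time_ex c) (m ''in'' 1)"
    "agree 0 m m1" "m1 (tmp 0) 0 = ev c m" using steps_cmp_ex[of c 0 m] If.prems(1) by auto
  have u: "m1 y = m0 y" if "user y" for y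
    using agree_user[OF 1(3) that] If.prems(2)[OF that] by auto
  have e: "ev c m = ev c m0" using If.prems by (intro ev_cong) auto
  have k1: "k1 \<le> poly (time_ex c) (m0 ''in'' 1)" using 1(2) If.prems(2)[OF user_in] by simp
  show ?case
  proof (cases "ev c m0 = 0")
    case False
    obtain k2 m2 where 2: "steps (cmp_st s) m1 k2 m2" "k2 \<le> poly (time_st s) (m0 ''in'' 1)"
      "\<forall>x. user x \<longrightarrow> m2 x = sem s m0 x" using If.IH(1)[of m1 m0] If.prems(1) u by auto
    have st: "steps (cmp_st (If c s t)) m (k1 + (1 + k2)) m2"
      using steps_Seq[OF 1(1) steps_CondTrue[OF _ 2(1)]] 1(4) e False by simp
    then show ?thesis using k1 2(2,3) False by (intro cmp_st_witness[OF st]) simp_all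
  next
    case True
    obtain k2 m2 where 2: "steps (cmp_st t) m1 k2 m2" "k2 \<le> poly (time_st t) (m0 ''in'' 1)"
      "\<forall>x. user x \<longrightarrow> m2 x = sem t m0 x" using If.IH(2)[of m1 m0] If.prems(1) u by auto
    have st: "steps (cmp_st (If c s t)) m (k1 + (1 + k2)) m2"
      using steps_Seq[OF 1(1) steps_CondFalse[OF _ 2(1)]] 1(4) e True by simp
    then show ?thesis using k1 2(2,3) True by (intro cmp_st_witness[OF st]) simp_all
  qed
next
  case (For x s)
  have wf: "user x" "x \<noteq> ''in''" "x \<notin> written s" "wf_st s" using For.prems(1) by auto
  define n where "n = m0 ''in'' 1"
  define B where "B = poly (time_st s) n"
  define body where "body = Seq (cmp_st s) (set_var x (Plus (get x) (Const 1)))"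
  define F where "F = (\<lambda>i. fold (\<lambda>j m. sem s (bind x j m)) [0..<i] m0)"
  have FS: "F (Suc i) = sem s (bind x i (F i))" for i by (simp add: F_def)
  have F_in: "F i ''in'' = m0 ''in''" for i
    by (induction i) (use FS sem_in[OF wf(4)] wf(2) in \<open>auto simp: F_def\<close>)
  define P where "P = (\<lambda>i m'. \<forall>y. user y \<longrightarrow> m' y = bind x i (F i) y)"
  have guard: "aval (remaining x) m' = n - i" if "P i m'" for i m'
    using that wf(1,2) F_in unfolding P_def n_def by simp
  have step: "\<exists>k m''. steps body m' k m'' \<and> k \<le> B + 1 \<and> P (Suc i) m''" if P: "P i m'" for i m'
  proof -
    have sim: "m' y = bind x i (F i) y" if "user y" for y using P that unfolding P_def by blast
    obtain k m1 where 1: "steps (cmp_st s) m' k m1"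
      "k \<le> poly (time_st s) (bind x i (F i) ''in'' 1)" "\<forall>y. user y \<longrightarrow> m1 y = F (Suc i) y"
      using For.IH[of m' "bind x i (F i)", OF wf(4) sim] unfolding FS by blast
    \<comment> \<open>As \<open>wf_st\<close> forbids the body to write the loop variable, the
      increment after it really counts rounds.\<close>
    have "F (Suc i) x 0 = i" unfolding FS using sem_frame[OF wf(3)] by simp
    then have "m1 x 0 = i" using 1(3) wf(1) by simp
    then have "steps (set_var x (Plus (get x) (Const 1))) m1 1 (bind x (Suc i) m1)"
      using steps_set_var[of x "Plus (get x) (Const 1)" m1] by simp
    from steps_Seq[OF 1(1) this] have "steps body m' (k + 1) (bind x (Suc i) m1)"
      by (simp add: body_def)
    moreover have "P (Suc i) (bind x (Suc i) m1)" using 1(3) wf(1) unfolding P_def by simp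
    moreover have "k + 1 \<le> B + 1" using 1(2) wf(2) F_in by (simp add: B_def n_def)
    ultimately show ?thesis by blast
  qed
  have s1: "steps (set_var x (Const 0)) m 1 (bind x 0 m)"
    using steps_set_var[of x "Const 0" m] by simp
  have "P 0 (bind x 0 m)" using For.prems(2) wf(1) unfolding P_def F_def by simp
  then obtain k m2 where 2: "steps (While (remaining x) body) (bind x 0 m) k m2" "k \<le> 1 + n * (B + 2)" "P n m2"
    using steps_while_count[of n P body "B + 1" "remaining x" 0 "bind x 0 m"] step guard by auto
  have st: "steps (cmp_st (For x s)) m (1 + k) m2" using steps_Seq[OF s1 2(1)] by (simp add: body_def)
  moreover have "1 + k \<le> poly (time_st (For x s)) (m0 ''in'' 1)"
    using 2(2) by (simp add: B_def n_def)
  moreover have "\<forall>y. user y \<longrightarrow> m2 y = sem (For x s) m0 y"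
    using 2(3) unfolding P_def F_def n_def by simp
  ultimately show ?case by blast
qed

text \<open>Times are polynomials in the value of the first input number, not in its bit length.
  This value is polynomial in the input size because the input has at least that many
  entries.\<close>

theorem poly_time_solvable_st:
  assumes wf: "wf_st s"
    and enc: "\<And>x. x \<in> I \<Longrightarrow> enc x \<noteq> [] \<and> hd (enc x) \<le> length (enc x)"
    and ans: "\<And>x. x \<in> I \<Longrightarrow> ans x (output_list (sem s (input_memory (enc x))))"
  shows "poly_time_solvable I enc ans"
proof (rule poly_time_solvableI[where c = "cmp_st s" and q = "time_st s"])
  fix x assume x: "x \<in> I"
  let ?m = "input_memory (enc x)"
  obtain k m where m: "steps (cmp_st s) ?m k m" "k \<le> poly (time_st s) (?m ''in'' 1)"
    "\<forall>y. user y \<longrightarrow> m y = sem s ?m y"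
    using steps_cmp_st[OF wf] by blast
  have "?m ''in'' 1 = hd (enc x)"
    using enc[OF x] by (cases "enc x") (auto simp: input_memory_def)
  also have "\<dots> \<le> input_size (enc x)" using enc[OF x] input_size_bounds(2)[of "enc x"] by simp
  finally have "k \<le> poly (time_st s) (input_size (enc x))"
    using m(2) poly_nat_mono by (meson le_trans)
  moreover have "m ''out'' = sem s ?m ''out''" using m(3) by (simp add: user_def)
  then have "output_list m = output_list (sem s ?m)" by (simp add: output_list_def)
  ultimately show "\<exists>k m. steps (cmp_st s) ?m k m \<and> k \<le> poly (time_st s) (input_size (enc x)) \<and>
    ans x (output_list m)"
    using m(1) ans[OF x] by metis
qed

section \<open>The program\<close>

abbreviation Var :: "string \<Rightarrow> ex" where
  "Var x \<equiv> Arr x (Num 0)"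

text \<open>Truth means nonzero, and truncated subtraction from 1 negates. Negating twice normalises
  a condition to 0 or 1, which matters where a \<open>Sum\<close> counts.\<close>

definition NotE :: "ex \<Rightarrow> ex" where
  "NotE a = Sub (Num 1) a"

definition AndE :: "ex \<Rightarrow> ex \<Rightarrow> ex" where
  "AndE a b = Ite a (NotE (NotE b)) (Num 0)"

definition OrE :: "ex \<Rightarrow> ex \<Rightarrow> ex" where
  "OrE a b = Ite a (Num 1) (NotE (NotE b))"

definition EqE :: "ex \<Rightarrow> ex \<Rightarrow> ex" where
  "EqE a b = NotE (Add (Sub a b) (Sub b a))"

definition LeE :: "ex \<Rightarrow> ex \<Rightarrow> ex" where
  "LeE a b = NotE (Sub a b)"

definition ExE :: "string \<Rightarrow> ex \<Rightarrow> ex" where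
  "ExE x a = NotE (NotE (Sum x a))"

lemma ev_NotE [simp]: "ev (NotE a) m = of_bool (ev a m = 0)"
  by (auto simp: NotE_def)

lemma ev_AndE [simp]: "ev (AndE a b) m = of_bool (ev a m \<noteq> 0 \<and> ev b m \<noteq> 0)"
  by (auto simp: AndE_def)

lemma ev_OrE [simp]: "ev (OrE a b) m = of_bool (ev a m \<noteq> 0 \<or> ev b m \<noteq> 0)"
  by (auto simp: OrE_def)

lemma ev_EqE [simp]: "ev (EqE a b) m = of_bool (ev a m = ev b m)"
  by (auto simp: EqE_def)

lemma ev_LeE [simp]: "ev (LeE a b) m = of_bool (ev a m \<le> ev b m)"
  by (auto simp: LeE_def)

lemma ev_ExE [simp]: "ev (ExE x a) m = of_bool (\<exists>i<m ''in'' 1. ev a (bind x i m) \<noteq> 0)"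
  by (auto simp: ExE_def)

lemmas wf_ops = NotE_def AndE_def OrE_def EqE_def LeE_def ExE_def

text \<open>Cell 1 of the input holds \<open>n\<close>, so the matrix starts at cell 2. The offset
  of a row is a repeated addition over the dummy variable \<open>''l''\<close>, which
  \<open>x\<close> therefore must not be.\<close>

definition AdjE :: "string \<Rightarrow> string \<Rightarrow> ex" where
  "AdjE x y = Arr ''in'' (Add (Num 2) (Add (Sum ''l'' (Var x)) (Var y)))"

definition WtE :: "string \<Rightarrow> ex" where
  "WtE x = Arr ''in'' (Add (Num 2) (Add (Sum ''l'' (Sum ''p'' (Num 1))) (Var x)))"

definition DomE :: "string \<Rightarrow> string \<Rightarrow> ex" where
  "DomE x y = OrE (EqE (Var x) (Var y)) (AdjE x y)"

definition SqE :: "string \<Rightarrow> string \<Rightarrow> ex" where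
  "SqE x y = AndE (NotE (EqE (Var x) (Var y)))
     (OrE (AdjE x y) (ExE ''p'' (AndE (AdjE x ''p'') (AdjE ''p'' y))))"

definition SimplicialE :: "string \<Rightarrow> ex" where
  "SimplicialE x = AndE (Arr ''rem'' (Var x))
     (NotE (ExE ''a'' (AndE (Arr ''rem'' (Var ''a'')) (AndE (SqE x ''a'')
       (ExE ''b'' (AndE (Arr ''rem'' (Var ''b'')) (AndE (SqE x ''b'')
         (AndE (NotE (EqE (Var ''a'') (Var ''b''))) (NotE (SqE ''a'' ''b''))))))))))"

text \<open>The product in \<open>eds_weight\<close> is obtained by adding the factor once for every
  dominated vertex \<open>u\<close>.\<close>

definition init_st :: st where
  "init_st = Sq
     (For ''v'' (Asg ''r'' (Var ''v'') (Sub
       (Sum ''u'' (Ite (DomE ''v'' ''u'') (Add (Num 1) (Sum ''k'' (WtE ''k''))) (Num 0))) (WtE ''v''))))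
     (For ''v'' (Asg ''rem'' (Var ''v'') (Num 1)))"

text \<open>The sum counts the vertices below the first simplicial one.\<close>

definition elim_body :: st where
  "elim_body =
     Sq (Asg ''cur'' (Num 0) (Sum ''v'' (NotE (ExE ''w'' (AndE (LeE (Var ''w'') (Var ''v'')) (SimplicialE ''w''))))))
    (Sq (Asg ''ord'' (Var ''s'') (Var ''cur''))
    (Sq (Asg ''rr'' (Num 0) (Arr ''r'' (Var ''cur'')))
    (Sq (Asg ''pos'' (Var ''s'') (Var ''rr''))
    (Sq (For ''u'' (Asg ''r'' (Var ''u'') (Ite (OrE (EqE (Var ''u'') (Var ''cur'')) (SqE ''cur'' ''u''))
           (Sub (Arr ''r'' (Var ''u'')) (Var ''rr'')) (Arr ''r'' (Var ''u'')))))
        (Asg ''rem'' (Var ''cur'') (Num 0))))))"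

text \<open>The counter goes up while the vertices are revisited in reverse order of elimination.
  The array \<open>''pos''\<close> holds the residual weights at elimination time; the last
  assignment stands for an empty statement.\<close>

definition select_body :: st where
  "select_body =
     Sq (Asg ''t'' (Num 0) (Sub (Arr ''in'' (Num 1)) (Add (Var ''s'') (Num 1))))
    (Sq (Asg ''cur'' (Num 0) (Arr ''ord'' (Var ''t'')))
        (If (AndE (Arr ''pos'' (Var ''t'')) (NotE (ExE ''u'' (AndE (Arr ''sel'' (Var ''u'')) (SqE ''cur'' ''u'')))))
          (Asg ''sel'' (Var ''cur'') (Num 1)) (Asg ''t'' (Num 0) (Num 0))))"

text \<open>The counter is increased before the write, so the first vertex goes to cell 2, behind
  the length in cell 0 and the flag in cell 1.\<close>

definition list_body :: st where
  "list_body = If (Arr ''sel'' (Var ''v''))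
     (Sq (Asg ''cnt'' (Num 0) (Add (Var ''cnt'') (Num 1))) (Asg ''out'' (Add (Var ''cnt'') (Num 1)) (Var ''v'')))
     (Asg ''t'' (Num 0) (Num 0))"

definition output_st :: st where
  "output_st = If (ExE ''v'' (NotE (EqE (Sum ''u'' (AndE (Arr ''sel'' (Var ''u'')) (DomE ''u'' ''v''))) (Num 1))))
     (Sq (Asg ''out'' (Num 0) (Num 1)) (Asg ''out'' (Num 1) (Num 0)))
     (Sq (Asg ''cnt'' (Num 0) (Num 0))
     (Sq (For ''v'' list_body)
     (Sq (Asg ''out'' (Num 0) (Add (Var ''cnt'') (Num 1))) (Asg ''out'' (Num 1) (Num 1)))))"

definition wed_st :: st where
  "wed_st = Sq init_st (Sq (For ''s'' elim_body) (Sq (For ''s'' select_body) output_st))"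

lemma wf_wed_st: "wf_st wed_st"
  by (simp add: wed_st_def init_st_def elim_body_def select_body_def output_st_def list_body_def
      SimplicialE_def SqE_def DomE_def WtE_def AdjE_def wf_ops user_def)

section \<open>Loop rules and the values of the program's expressions\<close>

lemma sem_For_inv:
  assumes "P 0 m" and "\<And>j m'. j < m ''in'' 1 \<Longrightarrow> P j m' \<Longrightarrow> P (Suc j) (sem s (bind x j m'))"
  obtains m' where "P (m ''in'' 1) m'" "sem (For x s) m = bind x (m ''in'' 1) m'"
proof -
  have "n \<le> m ''in'' 1 \<Longrightarrow> P n (fold (\<lambda>j m. sem s (bind x j m)) [0..<n] m)" for n
    by (induction n) (use assms in auto)
  from this[of "m ''in'' 1"] show thesis by (intro that) auto
qed

text \<open>Intended for loops filling an array cell by cell: the new value may use the old content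
  of the cell it replaces, but no other cell of that array.\<close>

lemma sem_For_Asg:
  fixes m :: memory
  assumes ne: "A \<noteq> x"
    and val: "\<And>j m'. j < m ''in'' 1 \<Longrightarrow> (\<And>y. y \<noteq> A \<Longrightarrow> y \<noteq> x \<Longrightarrow> m' y = m y) \<Longrightarrow>
      m' A j = m A j \<Longrightarrow> m' x 0 = j \<Longrightarrow> ev e m' = f j"
  shows "sem (For x (Asg A (Var x) e)) m A = (\<lambda>j. if j < m ''in'' 1 then f j else m A j)"
proof -
  define P where "P = (\<lambda>j m'. (\<forall>y. y \<noteq> A \<longrightarrow> y \<noteq> x \<longrightarrow> m' y = m y) \<and>
    m' A = (\<lambda>i. if i < j then f i else m A i))"
  have "P 0 m" by (simp add: P_def)
  moreover have "P (Suc j) (sem (Asg A (Var x) e) (bind x j m'))" if "j < m ''in'' 1" "P j m'" for j m'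
  proof -
    have "ev e (bind x j m') = f j"
      by (rule val[OF that(1)]) (use that(2) ne in \<open>auto simp: P_def\<close>)
    then show ?thesis using that(2) ne by (auto simp: P_def less_Suc_eq)
  qed
  ultimately obtain m' where "P (m ''in'' 1) m'" "sem (For x (Asg A (Var x) e)) m = bind x (m ''in'' 1) m'"
    by (rule sem_For_inv)
  then show ?thesis using ne by (simp add: P_def)
qed

lemma nth_concat_rows:
  "i < a \<Longrightarrow> j < b \<Longrightarrow> concat (map (\<lambda>i. map (f i) [0..<b]) [0..<a]) ! (i * b + j) = f i j"
proof (induction a)
  case (Suc a)
  have len: "length (concat (map (\<lambda>i. map (f i) [0..<b]) [0..<a])) = a * b"
    by (induction a) auto
  show ?case
  proof (cases "i = a")
    case True
    then show ?thesis using Suc.prems len by (simp add: nth_append)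
  next
    case False
    then have ia: "i < a" using Suc.prems by simp
    have "i * b + j < Suc i * b" using Suc.prems by simp
    also have "\<dots> \<le> a * b" using ia by (intro mult_le_mono1) simp
    finally show ?thesis using Suc.IH[OF ia Suc.prems(2)] len by (simp add: nth_append)
  qed
qed simp

locale wed_input =
  fixes G :: "nat graph" and w :: "nat \<Rightarrow> nat" and n :: nat
  assumes G: "simple_graph G" and V: "verts G = {..<n}"
begin

definition inp :: "memory \<Rightarrow> bool" where
  "inp m \<longleftrightarrow> m ''in'' = input_memory (wed_encoding (G, w)) ''in''"

lemma encoding: "wed_encoding (G, w) =
    n # concat (map (\<lambda>i. map (\<lambda>j. of_bool (adj G i j)) [0..<n]) [0..<n]) @ map w [0..<n]"
  by (simp add: wed_encoding_def V)

lemma length_rows: "length (concat (map (\<lambda>i. map (f i) [0..<n]) [0..<k])) = k * n"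
  by (induction k) auto

lemma inp_n [simp]: "inp m \<Longrightarrow> m ''in'' (Suc 0) = n"
  by (simp add: inp_def input_memory_def encoding)

lemma inp_adj: "inp m \<Longrightarrow> i < n \<Longrightarrow> j < n \<Longrightarrow> m ''in'' (Suc (Suc (n * i + j))) = of_bool (adj G i j)"
proof -
  assume m: "inp m" and ij: "i < n" "j < n"
  have "i * n + j < Suc i * n" using ij by simp
  also have "\<dots> \<le> n * n" using ij by (intro mult_le_mono1) simp
  finally have lt: "i * n + j < n * n" .
  show ?thesis
    using m lt nth_concat_rows[OF ij, of "\<lambda>i j. of_bool (adj G i j)"]
    by (simp add: inp_def input_memory_def encoding nth_append length_rows mult.commute)
qed

lemma inp_wt: "inp m \<Longrightarrow> v < n \<Longrightarrow> m ''in'' (Suc (Suc (n * n + v))) = w v"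
  by (simp add: inp_def input_memory_def encoding nth_append length_rows)

lemma inp_bind [simp]: "x \<noteq> ''in'' \<Longrightarrow> inp (m(x := f)) \<longleftrightarrow> inp m"
  by (simp add: inp_def)

lemma adj_less: "adj G u v \<Longrightarrow> u < n \<and> v < n"
  using adj_verts[OF G] V by auto

lemma ev_AdjE:
  assumes "inp m" "m x 0 < n" "m y 0 < n" "x \<noteq> ''l''"
  shows "ev (AdjE x y) m = of_bool (adj G (m x 0) (m y 0))"
  using assms inp_adj[OF assms(1-3)] by (simp add: AdjE_def)

lemma ev_WtE:
  assumes "inp m" "m x 0 < n"
  shows "ev (WtE x) m = w (m x 0)"
  using assms inp_wt[OF assms] by (simp add: WtE_def)

lemma ev_DomE:
  assumes "inp m" "m x 0 < n" "m y 0 < n" "x \<noteq> ''l''"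
  shows "ev (DomE x y) m = of_bool (dominates G (m x 0) (m y 0))"
  using ev_AdjE[OF assms] by (simp add: DomE_def dominates_def)

lemma ev_SqE:
  assumes "inp m" "m x 0 < n" "m y 0 < n" "x \<noteq> ''l''" "x \<noteq> ''p''" "y \<noteq> ''p''"
  shows "ev (SqE x y) m = of_bool (square (adj G) (m x 0) (m y 0))"
proof -
  have "ev (AdjE x ''p'') (bind ''p'' i m) = of_bool (adj G (m x 0) i)"
    "ev (AdjE ''p'' y) (bind ''p'' i m) = of_bool (adj G i (m y 0))" if "i < n" for i
    using ev_AdjE[of "bind ''p'' i m" x "''p''"] ev_AdjE[of "bind ''p'' i m" "''p''" y] assms that by simp_all
  then have "(\<exists>i<n. ev (AdjE x ''p'') (bind ''p'' i m) \<noteq> 0 \<and> ev (AdjE ''p'' y) (bind ''p'' i m) \<noteq> 0) \<longleftrightarrow>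
     (\<exists>i<n. adj G (m x 0) i \<and> adj G i (m y 0))"
    by (simp cong: conj_cong)
  also have "\<dots> \<longleftrightarrow> (\<exists>i. adj G (m x 0) i \<and> adj G i (m y 0))" using adj_less by blast
  finally show ?thesis
    using assms(1) ev_AdjE[OF assms(1-4)] by (simp add: SqE_def square_def)
qed

definition left :: "memory \<Rightarrow> nat set" where
  "left m = {u. u < n \<and> m ''rem'' u \<noteq> 0}"

lemma ev_SimplicialE:
  assumes "inp m" "m x 0 < n" "x \<notin> {''l'', ''p'', ''a'', ''b''}"
  shows "ev (SimplicialE x) m = of_bool (simplicial (square (adj G)) (left m) (m x 0))"
proof -
  have a: "ev (SqE x ''a'') (bind ''a'' i m) = of_bool (square (adj G) (m x 0) i)" if "i < n" for i
    using ev_SqE[of "bind ''a'' i m" x "''a''"] assms that by simp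
  have b: "ev (SqE x ''b'') (bind ''b'' j (bind ''a'' i m)) = of_bool (square (adj G) (m x 0) j)"
    "ev (SqE ''a'' ''b'') (bind ''b'' j (bind ''a'' i m)) = of_bool (square (adj G) i j)"
    if "i < n" "j < n" for i j
    using ev_SqE[of "bind ''b'' j (bind ''a'' i m)" x "''b''"]
      ev_SqE[of "bind ''b'' j (bind ''a'' i m)" "''a''" "''b''"] assms that by simp_all
  have "ev (SimplicialE x) m = of_bool (m ''rem'' (m x 0) \<noteq> 0 \<and>
    \<not> (\<exists>i<n. m ''rem'' i \<noteq> 0 \<and> square (adj G) (m x 0) i \<and>
       (\<exists>j<n. m ''rem'' j \<noteq> 0 \<and> square (adj G) (m x 0) j \<and> i \<noteq> j \<and> \<not> square (adj G) i j)))"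
    using assms a b by (simp add: SimplicialE_def cong: conj_cong) blast
  also have "\<dots> = of_bool (simplicial (square (adj G)) (left m) (m x 0))"
    using assms(2) unfolding simplicial_def left_def by (intro arg_cong[of _ _ of_bool]) blast
  finally show ?thesis .
qed

end

text \<open>A minimum found by counting, as loops have no early exit: an index contributes 1 as long
  as nothing satisfying \<open>P\<close> has occurred up to it.\<close>

lemma sum_below_least:
  fixes c n :: nat
  assumes "c < n" "P c" "\<And>w. w < c \<Longrightarrow> \<not> P w"
  shows "(\<Sum>v<n. of_bool (\<not> (\<exists>w<n. w \<le> v \<and> P w))) = c"
proof -
  have "(\<not> (\<exists>w<n. w \<le> v \<and> P w)) \<longleftrightarrow> v < c" if "v < n" for v
    using assms that by (metis le_less_trans linorder_not_less)
  then have "(\<Sum>v<n. of_bool (\<not> (\<exists>w<n. w \<le> v \<and> P w))) = (\<Sum>v<n. of_bool (v < c))"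
    by (intro sum.cong refl arg_cong[of _ _ of_bool]) simp
  also have "\<dots> = card {v. v < n \<and> v < c}"
    by (simp add: of_bool_def sum.If_cases Int_def)
  also have "{v. v < n \<and> v < c} = {..<c}" using assms(1) by auto
  finally show ?thesis by simp
qed

section \<open>The elimination and selection loops\<close>

context wed_input
begin

abbreviation H :: "nat \<Rightarrow> nat \<Rightarrow> bool" where
  "H \<equiv> square (adj G)"

lemma inp_frame: "inp m \<Longrightarrow> m' ''in'' = m ''in'' \<Longrightarrow> inp m'"
  by (simp add: inp_def)

lemma init_st:
  assumes m: "inp m" and m': "m' = sem init_st m"
  shows "inp m'" "\<And>u. u < n \<Longrightarrow> m' ''r'' u = eds_weight G w u" "left m' = {..<n}"
    "m' ''sel'' = m ''sel''"
proof -
  define e where "e = Sub (Sum ''u'' (Ite (DomE ''v'' ''u'') (Add (Num 1) (Sum ''k'' (WtE ''k''))) (Num 0))) (WtE ''v'')"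
  define m1 where "m1 = sem (For ''v'' (Asg ''r'' (Var ''v'') e)) m"
  have m1': "m' = sem (For ''v'' (Asg ''rem'' (Var ''v'') (Num 1))) m1"
    by (simp only: m' init_st_def m1_def e_def sem.simps)
  have f1: "m1 y = m y" if "y \<noteq> ''r''" "y \<noteq> ''v''" for y
    unfolding m1_def by (rule sem_frame) (use that in simp)
  have f2: "m' y = m1 y" if "y \<noteq> ''rem''" "y \<noteq> ''v''" for y
    unfolding m1' by (rule sem_frame) (use that in simp)
  have in1: "inp m1" by (rule inp_frame[OF m]) (simp add: f1)
  show "inp m'" by (rule inp_frame[OF in1]) (simp add: f2)
  show "m' ''sel'' = m ''sel''" using f1 f2 by simp
  have "m' ''rem'' = (\<lambda>j. if j < m1 ''in'' 1 then 1 else m1 ''rem'' j)"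
    unfolding m1' by (rule sem_For_Asg) simp_all
  then show "left m' = {..<n}" using in1 by (auto simp: left_def)
  have "m1 ''r'' = (\<lambda>j. if j < m ''in'' 1 then eds_weight G w j else m ''r'' j)"
    unfolding m1_def
  proof (rule sem_For_Asg)
    fix j and m2 :: memory
    assume j: "j < m ''in'' 1" and eq: "\<And>y. y \<noteq> ''r'' \<Longrightarrow> y \<noteq> ''v'' \<Longrightarrow> m2 y = m y" and v: "m2 ''v'' 0 = j"
    have in2: "inp m2" by (rule inp_frame[OF m]) (simp add: eq)
    have jn: "j < n" using j m by simp
    have "ev (DomE ''v'' ''u'') (bind ''u'' i m2) = of_bool (dominates G j i)" if "i < n" for i
      using ev_DomE[of "bind ''u'' i m2" "''v''" "''u''"] in2 that v jn by simp
    moreover have "ev (WtE ''k'') (bind ''k'' i (bind ''u'' l m2)) = w i" if "i < n" for i l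
      using ev_WtE[of "bind ''k'' i (bind ''u'' l m2)" "''k''"] in2 that by simp
    moreover have "ev (WtE ''v'') m2 = w j" using ev_WtE[of m2 "''v''"] in2 v jn by simp
    ultimately have "ev e m2 = (\<Sum>i<n. if dominates G j i then Suc (\<Sum>k<n. w k) else 0) - w j"
      using in2 by (simp add: e_def cong: if_cong)
    also have "(\<Sum>i<n. if dominates G j i then Suc (\<Sum>k<n. w k) else 0) = Suc (\<Sum>k<n. w k) * card (nbhd G j)"
    proof -
      have "{..<n} \<inter> {i. dominates G j i} = nbhd G j" by (auto simp: nbhd_def V)
      then show ?thesis by (simp add: sum.If_cases)
    qed
    finally show "ev e m2 = eds_weight G w j" by (simp add: eds_weight_def V)
  qed simp
  then show "m' ''r'' u = eds_weight G w u" if "u < n" for u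
    using that m f2[of "''r''"] by simp
qed

text \<open>The memory holds only the current residual weights. Replaying them from the order of
  elimination lets the invariant speak about earlier rounds as well.\<close>

primrec resid :: "(nat \<Rightarrow> nat) \<Rightarrow> nat \<Rightarrow> nat \<Rightarrow> nat" where
  "resid x 0 u = eds_weight G w u"
| "resid x (Suc t) u = (if u = x t \<or> H (x t) u then resid x t u - resid x t (x t) else resid x t u)"

lemma resid_cong: "(\<And>t. t < s \<Longrightarrow> x t = y t) \<Longrightarrow> resid x s u = resid y s u"
  by (induction s arbitrary: u) auto

definition elim_inv :: "nat \<Rightarrow> memory \<Rightarrow> bool" where
  "elim_inv s m \<longleftrightarrow> inp m \<and> left m = {..<n} - m ''ord'' ` {..<s} \<and>
    (\<forall>t<s. simplicial H ({..<n} - m ''ord'' ` {..<t}) (m ''ord'' t) \<and>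
      m ''pos'' t = resid (m ''ord'') t (m ''ord'' t)) \<and>
    (\<forall>u<n. m ''r'' u = resid (m ''ord'') s u)"

lemma elim_step:
  assumes simp_ex: "\<And>S. finite S \<Longrightarrow> S \<noteq> {} \<Longrightarrow> \<exists>s. simplicial H S s"
    and s: "s < n" and inv: "elim_inv s m"
  shows "elim_inv (Suc s) (sem elim_body (bind ''s'' s m))"
proof -
  define x where "x = m ''ord''"
  define S where "S = {..<n} - x ` {..<s}"
  have left: "left m = S" using inv by (simp add: elim_inv_def S_def x_def)
  have "card (x ` {..<s}) < card {..<n}" using s card_image_le[of "{..<s}" x] by simp
  then have "\<not> {..<n} \<subseteq> x ` {..<s}" by (metis card_mono finite_imageI finite_lessThan linorder_not_less)
  then have "finite S" "S \<noteq> {}" by (auto simp: S_def)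
  then have ex: "\<exists>c. simplicial H S c" by (rule simp_ex)
  define c where "c = (LEAST c. simplicial H S c)"
  have c: "simplicial H S c" "\<And>v. v < c \<Longrightarrow> \<not> simplicial H S v"
    using LeastI_ex[OF ex] not_less_Least unfolding c_def by auto
  have cn: "c < n" using c(1) by (simp add: simplicial_def S_def)
  define m0 where "m0 = bind ''s'' s m"
  have in0: "inp m0" using inv by (simp add: elim_inv_def m0_def)
  have "ev (SimplicialE ''w'') (bind ''w'' j (bind ''v'' i m0)) = of_bool (simplicial H S j)"
    if "i < n" "j < n" for i j
  proof -
    have "left (bind ''w'' j (bind ''v'' i m0)) = S" unfolding left[symmetric] by (simp add: left_def m0_def)
    then show ?thesis
      using ev_SimplicialE[of "bind ''w'' j (bind ''v'' i m0)" "''w''"] in0 that by simp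
  qed
  then have cur: "ev (Sum ''v'' (NotE (ExE ''w'' (AndE (LeE (Var ''w'') (Var ''v'')) (SimplicialE ''w''))))) m0 = c"
    using in0 sum_below_least[of c n "simplicial H S", OF cn c] by (simp cong: conj_cong)
  define x' where "x' = x(s := c)"
  \<comment> \<open>The state before the update loop. The weight of \<open>c\<close> is kept in
    \<open>''rr''\<close> because the loop sets cell \<open>c\<close> to 0 while later cells still
    need it.\<close>
  define m4 where "m4 = m0(''cur'' := (m ''cur'')(0 := c), ''ord'' := x',
    ''rr'' := (m ''rr'')(0 := m ''r'' c), ''pos'' := (m ''pos'')(s := m ''r'' c))"
  define e where "e = Ite (OrE (EqE (Var ''u'') (Var ''cur'')) (SqE ''cur'' ''u''))
           (Sub (Arr ''r'' (Var ''u'')) (Var ''rr'')) (Arr ''r'' (Var ''u''))"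
  define m5 where "m5 = sem (For ''u'' (Asg ''r'' (Var ''u'') e)) m4"
  have m6: "sem elim_body m0 = m5(''rem'' := (m5 ''rem'')(m5 ''cur'' 0 := 0))"
    unfolding elim_body_def sem.simps(1,2) cur
    by (simp del: sem.simps(4) add: m5_def e_def m4_def m0_def x'_def x_def fun_upd_twist)
  have f: "m5 y = m4 y" if "y \<noteq> ''r''" "y \<noteq> ''u''" for y
    unfolding m5_def by (rule sem_frame) (use that in simp)
  have in4: "inp m4" using in0 by (simp add: m4_def)
  have r5: "m5 ''r'' = (\<lambda>j. if j < m4 ''in'' 1 then
      (if j = c \<or> H c j then m ''r'' j - m ''r'' c else m ''r'' j) else m4 ''r'' j)"
    unfolding m5_def
  proof (rule sem_For_Asg)
    fix j and m2 :: memory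
    assume j: "j < m4 ''in'' 1" and eq: "\<And>y. y \<noteq> ''r'' \<Longrightarrow> y \<noteq> ''u'' \<Longrightarrow> m2 y = m4 y"
      and r: "m2 ''r'' j = m4 ''r'' j" and u: "m2 ''u'' 0 = j"
    have "inp m2" by (rule inp_frame[OF in4]) (simp add: eq)
    moreover have "j < n" using j in4 by simp
    moreover have cur2: "m2 ''cur'' 0 = c" using eq[of "''cur''"] by (simp add: m4_def)
    ultimately have "ev (SqE ''cur'' ''u'') m2 = of_bool (H c j)"
      using ev_SqE[of m2 "''cur''" "''u''"] u cn by simp
    then show "ev e m2 = (if j = c \<or> H c j then m ''r'' j - m ''r'' c else m ''r'' j)"
      using u r cur2 eq[of "''rr''"] by (simp add: e_def m4_def m0_def)
  qed simp
  define m6 where "m6 = sem elim_body m0"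
  have o6: "m6 ''ord'' = x'" using f[of "''ord''"] by (simp add: m6_def m6 m4_def)
  have p6: "m6 ''pos'' = (m ''pos'')(s := m ''r'' c)" using f[of "''pos''"] by (simp add: m6_def m6 m4_def)
  have "m5 ''rem'' = m ''rem''" "m5 ''cur'' 0 = c"
    using f[of "''rem''"] f[of "''cur''"] by (simp_all add: m4_def m0_def)
  then have rem6: "m6 ''rem'' = (m ''rem'')(c := 0)" by (simp add: m6_def m6)
  have r6: "m6 ''r'' = m5 ''r''" by (simp add: m6_def m6)
  have in6: "inp m6" by (rule inp_frame[OF in4]) (simp add: f m6_def m6)
  have im: "x' ` {..<t} = x ` {..<t}" if "t \<le> s" for t using that by (auto simp: x'_def)
  have res: "resid x' t = resid x t" if "t \<le> s" for t
    using that by (intro ext resid_cong) (simp add: x'_def)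
  have rm: "m ''r'' u = resid x s u" if "u < n" for u
    using inv that by (simp add: elim_inv_def x_def)
  have "left m6 = {..<n} - x' ` {..<Suc s}"
  proof -
    have "left m6 = left m - {c}" using rem6 by (auto simp: left_def)
    also have "\<dots> = {..<n} - x' ` {..<Suc s}"
      unfolding left S_def lessThan_Suc image_insert im[OF order_refl] by (auto simp: x'_def)
    finally show ?thesis .
  qed
  moreover have "simplicial H ({..<n} - x' ` {..<t}) (x' t) \<and> m6 ''pos'' t = resid x' t (x' t)" if "t < Suc s" for t
  proof (cases "t = s")
    case True
    then show ?thesis using c(1) im[of s] res[of s] p6 rm[OF cn] by (simp add: S_def x'_def)
  next
    case False
    then have t: "t < s" using that by simp
    have "simplicial H ({..<n} - x ` {..<t}) (x t) \<and> m ''pos'' t = resid x t (x t)"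
      using inv t by (simp add: elim_inv_def x_def)
    moreover have "x' t = x t" using t by (simp add: x'_def)
    ultimately show ?thesis using im[of t] res[of t] t p6 by simp
  qed
  moreover have "m6 ''r'' u = resid x' (Suc s) u" if "u < n" for u
    unfolding r6 r5 using that in4 rm[OF that] rm[OF cn] res[of s] by (simp add: x'_def)
  ultimately have "elim_inv (Suc s) m6" using in6 by (simp add: elim_inv_def o6)
  then show ?thesis by (simp add: m6_def m0_def)
qed

primrec picked :: "(nat \<Rightarrow> nat) \<Rightarrow> nat \<Rightarrow> nat set" where
  "picked x 0 = {}"
| "picked x (Suc t) = (if resid x (n - Suc t) (x (n - Suc t)) > 0 \<and> (\<forall>u\<in>picked x t. \<not> H (x (n - Suc t)) u)
     then insert (x (n - Suc t)) (picked x t) else picked x t)"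

definition selected :: "memory \<Rightarrow> nat set" where
  "selected m = {u. u < n \<and> m ''sel'' u \<noteq> 0}"

lemma select_step:
  assumes t: "t < n" and m: "inp m" "m ''ord'' = x" "selected m = picked x t"
    and p: "m ''pos'' (n - Suc t) = resid x (n - Suc t) (x (n - Suc t))" and xn: "x (n - Suc t) < n"
  shows "selected (sem select_body (bind ''s'' t m)) = picked x (Suc t)"
proof -
  define c where "c = x (n - Suc t)"
  define m1 where "m1 = m(''s'' := (m ''s'')(0 := t), ''t'' := (m ''t'')(0 := n - Suc t), ''cur'' := (m ''cur'')(0 := c))"
  have e: "ev (SqE ''cur'' ''u'') (bind ''u'' i m1) = of_bool (H c i)" if "i < n" for i
    using ev_SqE[of "bind ''u'' i m1" "''cur''" "''u''"] that xn m(1) by (simp add: m1_def c_def)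
  define b where "b = AndE (Arr ''pos'' (Var ''t'')) (NotE (ExE ''u'' (AndE (Arr ''sel'' (Var ''u'')) (SqE ''cur'' ''u''))))"
  have step: "sem select_body (bind ''s'' t m) =
    (if ev b m1 \<noteq> 0
     then m1(''sel'' := (m ''sel'')(c := 1)) else m1(''t'' := (m1 ''t'')(0 := 0)))"
    using m(1,2) unfolding select_body_def b_def[symmetric] by (simp add: m1_def c_def)
  have "ev b m1 \<noteq> 0 \<longleftrightarrow>
    m ''pos'' (n - Suc t) > 0 \<and> \<not> (\<exists>i<n. m ''sel'' i \<noteq> 0 \<and> H c i)"
    using m(1) e by (simp add: b_def m1_def cong: conj_cong)
  also have "\<dots> \<longleftrightarrow> resid x (n - Suc t) c > 0 \<and> (\<forall>u\<in>picked x t. \<not> H c u)"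
    unfolding p m(3)[symmetric] selected_def c_def by blast
  finally have cond: "ev b m1 \<noteq> 0 \<longleftrightarrow>
    resid x (n - Suc t) c > 0 \<and> (\<forall>u\<in>picked x t. \<not> H c u)" .
  have "selected (m1(''sel'' := (m ''sel'')(c := 1))) = insert c (selected m)"
    using xn by (auto simp: selected_def c_def)
  moreover have "selected (m1(''t'' := (m1 ''t'')(0 := 0))) = selected m"
    by (simp add: selected_def m1_def)
  ultimately show ?thesis unfolding step cond using m(3) by (simp add: c_def)
qed

text \<open>The graph class enters only through the existence of simplicial vertices in the square;
  granted that, the two loops perform Frank's algorithm on any simple graph.\<close>

lemma search_correct:
  assumes simp_ex: "\<And>S. finite S \<Longrightarrow> S \<noteq> {} \<Longrightarrow> \<exists>s. simplicial H S s"
    and m: "inp m" "m ''sel'' = (\<lambda>_. 0)"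
    and m': "m' = sem (For ''s'' select_body) (sem (For ''s'' elim_body) (sem init_st m))"
  shows "indep H (selected m')" "selected m' \<subseteq> {..<n}"
    "\<And>J. indep H J \<Longrightarrow> J \<subseteq> {..<n} \<Longrightarrow> sum (eds_weight G w) J \<le> sum (eds_weight G w) (selected m')"
proof -
  define m1 where "m1 = sem init_st m"
  note 1 = init_st[OF m(1) m1_def]
  have "elim_inv 0 m1" using 1 by (simp add: elim_inv_def)
  moreover have "elim_inv (Suc j) (sem elim_body (bind ''s'' j m'))"
    if "j < m1 ''in'' 1" "elim_inv j m'" for j m'
    using elim_step[OF simp_ex _ that(2)] that(1) 1(1) by simp
  ultimately obtain m2 where m2: "elim_inv n m2" "sem (For ''s'' elim_body) m1 = bind ''s'' n m2"
    using sem_For_inv[of elim_inv m1 elim_body "''s''"] 1(1) by auto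
  define m3 where "m3 = sem (For ''s'' elim_body) m1"
  define x where "x = m2 ''ord''"
  have in3: "inp m3" "m3 ''ord'' = x" "m3 ''pos'' = m2 ''pos''"
    using m2 by (simp_all add: m3_def elim_inv_def x_def)
  have x: "simplicial H ({..<n} - x ` {..<t}) (x t)" "m2 ''pos'' t = resid x t (x t)" if "t < n" for t
    using m2(1) that by (simp_all add: elim_inv_def x_def)
  have xn: "x t < n" if "t < n" for t using x(1)[OF that] by (simp add: simplicial_def)
  have sel3: "m3 ''sel'' = m1 ''sel''"
    unfolding m3_def by (rule sem_frame) (simp add: elim_body_def)
  define P where "P = (\<lambda>t m. inp m \<and> m ''ord'' = x \<and> m ''pos'' = m2 ''pos'' \<and> selected m = picked x t)"
  have "P 0 m3" using in3 sel3 1(4) m(2) by (simp add: P_def selected_def)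
  moreover have "P (Suc t) (sem select_body (bind ''s'' t m'))" if "t < m3 ''in'' 1" "P t m'" for t m'
  proof -
    have t: "t < n" using that(1) in3 by simp
    have f: "sem select_body (bind ''s'' t m') y = m' y" if "y \<in> {''in'', ''ord'', ''pos''}" for y
    proof -
      have "sem select_body (bind ''s'' t m') y = bind ''s'' t m' y"
        by (rule sem_frame) (use that in \<open>auto simp: select_body_def\<close>)
      then show ?thesis using that by auto
    qed
    have "selected (sem select_body (bind ''s'' t m')) = picked x (Suc t)"
      by (rule select_step[OF t]) (use that(2) x(2)[of "n - Suc t"] xn[of "n - Suc t"] t in \<open>simp_all add: P_def\<close>)
    then show ?thesis using f that(2) by (simp add: P_def inp_def)
  qed
  ultimately obtain m4 where m4: "P n m4" "sem (For ''s'' select_body) m3 = bind ''s'' n m4"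
    using sem_For_inv[of P m3 select_body "''s''"] in3 by auto
  have "m' = bind ''s'' n m4" using m4(2) by (simp only: m' m3_def m1_def)
  then have sel: "selected m' = picked x n" using m4(1) by (simp add: P_def selected_def)
  have *: "indep H (picked x n) \<and> picked x n \<subseteq> {..<n} \<and>
    (\<forall>J. indep H J \<longrightarrow> J \<subseteq> {..<n} \<longrightarrow> sum (resid x 0) J \<le> sum (resid x 0) (picked x n))"
    by (rule frank_forward[of H "{..<n}" n x "resid x" "picked x"])
      (simp_all add: square_adj_sym square_irrefl x(1))
  have "resid x 0 = eds_weight G w" by auto
  with * show "indep H (selected m')" "selected m' \<subseteq> {..<n}"
    "\<And>J. indep H J \<Longrightarrow> J \<subseteq> {..<n} \<Longrightarrow> sum (eds_weight G w) J \<le> sum (eds_weight G w) (selected m')"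
    unfolding sel by auto
qed

section \<open>Testing the candidate and writing the answer\<close>

lemma eds_check:
  assumes "inp m"
  shows "ev (ExE ''v'' (NotE (EqE (Sum ''u'' (AndE (Arr ''sel'' (Var ''u'')) (DomE ''u'' ''v''))) (Num 1)))) m = 0 \<longleftrightarrow>
    efficient_dominating_set G (selected m)"
proof -
  have "ev (DomE ''u'' ''v'') (bind ''u'' i (bind ''v'' j m)) = of_bool (dominates G i j)" if "i < n" "j < n" for i j
    using ev_DomE[of "bind ''u'' i (bind ''v'' j m)" "''u''" "''v''"] assms that by simp
  then have "ev (ExE ''v'' (NotE (EqE (Sum ''u'' (AndE (Arr ''sel'' (Var ''u'')) (DomE ''u'' ''v''))) (Num 1)))) m = 0 \<longleftrightarrow>
    (\<forall>j<n. (\<Sum>i<n. of_bool (m ''sel'' i \<noteq> 0 \<and> dominates G i j)) = (1::nat))"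
    using assms by (simp cong: conj_cong)
  also have "\<dots> \<longleftrightarrow> (\<forall>j<n. \<exists>!d. d \<in> selected m \<and> dominates G d j)"
  proof -
    have "(\<Sum>i<n. of_bool (m ''sel'' i \<noteq> 0 \<and> dominates G i j)) = card {d \<in> selected m. dominates G d j}" for j
    proof -
      have "{..<n} \<inter> {i. m ''sel'' i \<noteq> 0 \<and> dominates G i j} = {d \<in> selected m. dominates G d j}"
        by (auto simp: selected_def)
      then show ?thesis by (simp add: of_bool_def sum.If_cases)
    qed
    moreover have "card A = 1 \<longleftrightarrow> (\<exists>!d. d \<in> A)" for A :: "nat set"
      unfolding card_1_singleton_iff One_nat_def by auto
    ultimately show ?thesis by simp
  qed
  also have "\<dots> \<longleftrightarrow> efficient_dominating_set G (selected m)"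
    by (auto simp: efficient_dominating_set_def V selected_def)
  finally show ?thesis .
qed

lemma output_st:
  assumes m: "inp m"
  shows "output_list (sem output_st m) =
    (if efficient_dominating_set G (selected m) then 1 # sorted_list_of_set (selected m) else [0])"
proof (cases "efficient_dominating_set G (selected m)")
  case False
  have "sem output_st m = m(''out'' := ((m ''out'')(0 := 1, 1 := 0)))"
    using False eds_check[OF m] by (simp add: output_st_def)
  then show ?thesis using False by (simp add: output_list_def)
next
  case True
  define m1 where "m1 = bind ''cnt'' 0 m"
  \<comment> \<open>Vertices found so far occupy the cells from 2 on; cells 0 and 1 are filled after
    the loop, with the final counter plus one for the flag as the length.\<close>
  define P where "P = (\<lambda>j m'. m' ''sel'' = m ''sel'' \<and>
    map (\<lambda>i. m' ''out'' (i + 2)) [0..<m' ''cnt'' 0] = filter (\<lambda>v. m ''sel'' v \<noteq> 0) [0..<j])"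
  have "P 0 m1" by (simp add: P_def m1_def)
  moreover have "P (Suc j) (sem list_body (bind ''v'' j m'))" if "P j m'" for j m'
  proof (cases "m ''sel'' j = 0")
    case True
    then show ?thesis using that by (simp add: P_def list_body_def)
  next
    case False
    have s: "m' ''sel'' = m ''sel''" using that by (simp add: P_def)
    have upd: "map (\<lambda>i. if i = c then a else g i) [0..<c] = map g [0..<c]" for a c :: nat and g
      by simp
    have "sem list_body (bind ''v'' j m') = m'(''v'' := (m' ''v'')(0 := j),
      ''cnt'' := (m' ''cnt'')(0 := Suc (m' ''cnt'' 0)),
      ''out'' := (m' ''out'')(Suc (Suc (m' ''cnt'' 0)) := j))"
      using False by (simp add: list_body_def s)
    then show ?thesis using that False unfolding P_def by (simp add: upd)
  qed
  ultimately obtain m2 where m2: "P n m2" "sem (For ''v'' list_body) m1 = bind ''v'' n m2"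
    using sem_For_inv[of P m1 list_body "''v''"] m by (auto simp: m1_def)
  define q where "q = m2 ''cnt'' 0"
  have out: "sem output_st m ''out'' = (m2 ''out'')(0 := Suc q, 1 := 1)"
    using True eds_check[OF m] m2(2)
    by (simp del: sem.simps(4) add: output_st_def m1_def[symmetric] q_def)
  have "[1..<Suc (Suc q)] = 1 # map (\<lambda>i. i + 2) [0..<q]"
    using map_add_upt[of 2 q] by (simp add: upt_conv_Cons numeral_2_eq_2 del: upt_Suc)
  then have "output_list (sem output_st m) = 1 # map (\<lambda>i. m2 ''out'' (i + 2)) [0..<q]"
    by (simp add: output_list_def out del: upt_Suc)
  also have "map (\<lambda>i. m2 ''out'' (i + 2)) [0..<q] = filter (\<lambda>v. m ''sel'' v \<noteq> 0) [0..<n]"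
    using m2(1) by (simp add: P_def q_def)
  also have "\<dots> = sorted_list_of_set (selected m)"
  proof -
    have "sorted_list_of_set (set (filter (\<lambda>v. m ''sel'' v \<noteq> 0) [0..<n])) = filter (\<lambda>v. m ''sel'' v \<noteq> 0) [0..<n]"
      by (intro sorted_list_of_set.idem_if_sorted_distinct sorted_wrt_filter distinct_filter) simp_all
    moreover have "set (filter (\<lambda>v. m ''sel'' v \<noteq> 0) [0..<n]) = selected m"
      by (auto simp: selected_def)
    ultimately show ?thesis by simp
  qed
  finally show ?thesis using True by simp
qed

lemma wed_st_correct:
  assumes "free_of (path_graph 6) G" "HHD_free G"
  shows "wed_answer (G, w) (output_list (sem wed_st (input_memory (wed_encoding (G, w)))))"
proof -
  define m where "m = input_memory (wed_encoding (G, w))"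
  define m' where "m' = sem (For ''s'' select_body) (sem (For ''s'' elim_body) (sem init_st m))"
  have m: "inp m" "m ''sel'' = (\<lambda>_. 0)" by (simp_all add: m_def inp_def input_memory_def fun_eq_iff)
  have "m' ''in'' = m ''in''"
    unfolding m'_def using wf_wed_st unfolding wed_st_def by (simp add: sem_in del: sem.simps)
  then have in': "inp m'" using m(1) by (simp add: inp_def)
  have out: "output_list (sem wed_st m) =
    (if efficient_dominating_set G (selected m') then 1 # sorted_list_of_set (selected m') else [0])"
    using output_st[OF in'] by (simp only: wed_st_def m'_def sem.simps(2))
  \<comment> \<open>The assumed set \<open>D\<close> is used twice: it makes the square chordal, so
    that the search is correct, and it is the full covering against which the weights are
    compared.\<close>
  have opt: "min_weight_eds G w (selected m')" if D: "efficient_dominating_set G D" for D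
  proof -
    have "\<exists>s. simplicial H S s" if "finite S" "S \<noteq> {}" for S
      using chordal_simplicial[of H, OF square_adj_sym square_irrefl square_no_hole_graph[OF G assms D] that] .
    note s = search_correct[OF this m m'_def]
    show ?thesis by (rule max_weight_indep_square[OF G _ _ _ D]) (use s in \<open>auto simp: V\<close>)
  qed
  show ?thesis
  proof (cases "\<exists>D. efficient_dominating_set G D")
    case True
    then have "min_weight_eds G w (selected m')" using opt by blast
    then show ?thesis using True out
      unfolding wed_answer_def m_def[symmetric] by (auto simp: min_weight_eds_def)
  next
    \<comment> \<open>Whatever the search has returned fails the test.\<close>
    case False
    then show ?thesis using out unfolding wed_answer_def m_def[symmetric] by auto
  qed
qed

end

theorem corollary2:
  shows "WED_poly_time_on (\<lambda>G. free_of (path_graph 6) G \<and> HHD_free G)"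
  unfolding WED_poly_time_on_def
proof (rule poly_time_solvable_st[OF wf_wed_st])
  fix x :: wed_instance
  assume x: "x \<in> wed_instances (\<lambda>G. free_of (path_graph 6) G \<and> HHD_free G)"
  obtain G w where Gw: "x = (G, w)" by fastforce
  then obtain n where n: "simple_graph G" "verts G = {..<n}" "free_of (path_graph 6) G" "HHD_free G"
    using x by (auto simp: wed_instances_def)
  then interpret wed_input G w n by unfold_locales
  \<comment> \<open>The encoding has \<open>1 + n * n + n\<close> entries.\<close>
  show "wed_encoding x \<noteq> [] \<and> hd (wed_encoding x) \<le> length (wed_encoding x)"
    unfolding Gw encoding by (simp add: length_rows)
  show "wed_answer x (output_list (sem wed_st (input_memory (wed_encoding x))))"
    unfolding Gw using wed_st_correct n by blast
qed

end
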